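(* Let $K$ be a field and let $A$ be an $n\times q$ matrix with entries in $\mathbb{N}$, with nonzero rows and nonzero columns $v_1,\ldots,v_q$. Let $w_1,\ldots,w_r$ be the set of all $\alpha\in\mathbb{N}^n$ such that $\alpha\leq v_i$ for some $i$, and let $S=K[x^{w_1}t,\ldots,x^{w_r}t]\subset K[x_1,\ldots,x_n,t]$. Let $\ell_1,\ldots,\ell_p$ be the maximal elements (with respect to the componentwise order) of the vertex set of the polytope $P=\{x\in\mathbb{R}^n\mid x\geq 0;\ xA\leq\mathbf{1}\}$, and for $1\leq i\leq p$ let $d_i$ be the unique positive integer such that $(-d_i\ell_i,d_i)$ is an integral vector whose nonzero entries are relatively prime. If the system $x\geq 0;\ xA\leq\mathbf{1}$ has the integer rounding property, then $S$ is normal, the canonical module of $S$ is given by the ideal of $S$ $$\omega_S=\left(\left\{x^at^b\ \middle|\ (a,b)\begin{pmatrix}-d_1\ell_1&\cdots&-d_p\ell_p&e_1&\cdots&e_n\\ d_1&\cdots&d_p&0&\cdots&0\end{pmatrix}\geq\mathbf{1}\right\}\right),$$ where $a\in\mathbb{Z}^n$, $b\in\mathbb{Z}$ and the $\ell_i$ and $e_j$ are regarded as column vectors, and the $a$-invariant of $S$ is equal to $-\max_{1\leq i\leq p}\{\lceil 1/d_i+|\ell_i|\rceil\}$.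
   Context: $x^a:=x_1^{a_1}\cdots x_n^{a_n}$; $\mathbf{1}$ is the all-ones vector (of the appropriate size); $e_j$ is the $j$th unit vector of $\mathbb{R}^n$; $|\ell_i|=\langle\ell_i,\mathbf{1}\rangle$ is the sum of the entries of $\ell_i$; vector inequalities are componentwise. $S$ is a standard graded $K$-algebra with the grading in which a monomial $x^at^b\in S$ has degree $b$. Its $a$-invariant $a(S)$ is the degree, as a rational function, of its Hilbert series. Normal means integrally closed in its field of fractions; the normal ring $S$ is Cohen-Macaulay, and its ($*$-)canonical module is taken, as usual, to be (by the Danilov–Stanley formula) the ideal of $S$ generated by the monomials $x^at^b$ with $(a,b)\in\mathbb{N}\mathcal{B}\cap(\mathbb{R}_+\mathcal{B})^{\mathrm{o}}$, where $\mathcal{B}=\{(w_1,1),\ldots,(w_r,1)\}$ and $^{\mathrm{o}}$ denotes relative interior. The system $x\geq 0;\ xA\leq\mathbf{1}$ has the integer rounding property if $$\lceil\min\{\langle y,\mathbf{1}\rangle\mid y\in\mathbb{R}^q,\ y\geq 0;\ Ay\geq a\}\rceil=\min\{\langle y,\mathbf{1}\rangle\mid Ay\geq a;\ y\in\mathbb{N}^q\}$$ for each integral vector $a$ for which $\min\{\langle y,\mathbf{1}\rangle\mid y\geq 0;\ Ay\geq a\}$ is finite. *)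

theory Defs
  imports
    "HOL-Analysis.Analysis"
    "HOL-Library.Poly_Mapping"
    "HOL-Library.Option_ord"
    "HOL-Computational_Algebra.Computational_Algebra"
begin

text \<open>
  The variable \<open>x\<^sub>i\<close> has index \<open>Some i\<close> and \<open>t\<close> has index \<open>None\<close>. A linear order on \<open>'n\<close>, as on
  \<open>{1..n}\<close>, is only needed for this ring to be an instance of class \<open>idom\<close>, hence to have a
  field of fractions of type \<open>fract\<close>.
\<close>

type_synonym ('n, 'k) xt_poly = "('n option \<Rightarrow>\<^sub>0 nat) \<Rightarrow>\<^sub>0 'k"

definition xt_var :: "'n option \<Rightarrow> ('n, 'k::field) xt_poly"
  where "xt_var v = Poly_Mapping.single (Poly_Mapping.single v 1) 1"

definition xt_monom :: "nat ^ 'n \<Rightarrow> nat \<Rightarrow> ('n, 'k::field) xt_poly"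
  where "xt_monom a b = (\<Prod>i\<in>UNIV. xt_var (Some i) ^ (a $ i)) * xt_var None ^ b"

definition scalar_mult :: "'k::field \<Rightarrow> ('m::comm_monoid_add \<Rightarrow>\<^sub>0 'k) \<Rightarrow> ('m \<Rightarrow>\<^sub>0 'k)"
  where "scalar_mult c f = Poly_Mapping.single 0 c * f"

interpretation poly_vs: vector_space scalar_mult
  by unfold_locales
    (simp_all add: scalar_mult_def algebra_simps single_add mult_single flip: mult.assoc)

definition is_subalgebra :: "('m::comm_monoid_add \<Rightarrow>\<^sub>0 'k::field) set \<Rightarrow> bool"
  where "is_subalgebra T \<longleftrightarrow> 1 \<in> T \<and> (\<forall>f\<in>T. \<forall>g\<in>T. f + g \<in> T \<and> f * g \<in> T)
    \<and> (\<forall>c. \<forall>f\<in>T. scalar_mult c f \<in> T)"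

definition generated_subalgebra ::
    "('m::comm_monoid_add \<Rightarrow>\<^sub>0 'k::field) set \<Rightarrow> ('m \<Rightarrow>\<^sub>0 'k) set"
  where "generated_subalgebra G = is_subalgebra hull G"

definition is_ideal_of :: "'a::comm_ring_1 set \<Rightarrow> 'a set \<Rightarrow> bool"
  where "is_ideal_of S I \<longleftrightarrow> I \<subseteq> S \<and> 0 \<in> I \<and> (\<forall>f\<in>I. \<forall>g\<in>I. f + g \<in> I) \<and> (\<forall>s\<in>S. \<forall>f\<in>I. s * f \<in> I)"

text \<open>Meaningful for \<open>G \<subseteq> S\<close>; otherwise no ideal of \<open>S\<close> contains \<open>G\<close> and the hull is \<open>UNIV\<close>.\<close>

definition generated_ideal :: "'a::comm_ring_1 set \<Rightarrow> 'a set \<Rightarrow> 'a set"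
  where "generated_ideal S G = is_ideal_of S hull G"

text \<open>The field of fractions of a subring \<open>S\<close>, inside the field of fractions of the ambient domain.\<close>

definition fraction_field_of :: "'a::idom set \<Rightarrow> 'a fract set"
  where "fraction_field_of S = {Fract f g | f g. f \<in> S \<and> g \<in> S \<and> g \<noteq> 0}"

definition integral_over :: "'a::comm_ring_1 set \<Rightarrow> 'a \<Rightarrow> bool"
  where "integral_over T z \<longleftrightarrow> (\<exists>p. lead_coeff p = 1 \<and> (\<forall>i. coeff p i \<in> T) \<and> poly p z = 0)"

definition normal_subring :: "'a::idom set \<Rightarrow> bool"
  where "normal_subring S \<longleftrightarrow>
    (\<forall>z\<in>fraction_field_of S. integral_over (to_fract ` S) z \<longrightarrow> z \<in> to_fract ` S)"

definition graded_part :: "('n, 'k::field) xt_poly set \<Rightarrow> nat \<Rightarrow> ('n, 'k) xt_poly set"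
  where "graded_part S b = {f \<in> S. \<forall>m\<in>Poly_Mapping.keys f. Poly_Mapping.lookup m None = b}"

definition hilbert_series :: "('n, 'k::field) xt_poly set \<Rightarrow> rat fps"
  where "hilbert_series S = Abs_fps (\<lambda>b. of_nat (poly_vs.dim (graded_part S b)))"

text \<open>The degree \<open>deg p - deg q\<close> of a nonzero rational function \<open>p / q\<close> with power series expansion \<open>F\<close>.\<close>

definition is_rational_degree :: "'a::field fps \<Rightarrow> int \<Rightarrow> bool"
  where "is_rational_degree F e \<longleftrightarrow> (\<exists>p q. p \<noteq> 0 \<and> q \<noteq> 0
    \<and> fps_of_poly q * F = fps_of_poly p \<and> e = int (degree p) - int (degree q))"

lemma is_rational_degree_unique:
  assumes "is_rational_degree F e" and "is_rational_degree F e'"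
  shows "e = e'"
proof -
  obtain p q where 1: "p \<noteq> 0" "q \<noteq> 0" "fps_of_poly q * F = fps_of_poly p"
    "e = int (degree p) - int (degree q)"
    using assms(1) unfolding is_rational_degree_def by blast
  obtain p' q' where 2: "p' \<noteq> 0" "q' \<noteq> 0" "fps_of_poly q' * F = fps_of_poly p'"
    "e' = int (degree p') - int (degree q')"
    using assms(2) unfolding is_rational_degree_def by blast
  have "fps_of_poly (p * q') = fps_of_poly (p' * q)"
    unfolding fps_of_poly_mult 1(3)[symmetric] 2(3)[symmetric] by (simp add: ac_simps)
  then have "degree (p * q') = degree (p' * q)"
    by (simp only: fps_of_poly_eq_iff)
  then show ?thesis
    using 1 2 by (simp add: degree_mult_eq)
qed

definition a_invariant :: "('n, 'k::field) xt_poly set \<Rightarrow> int"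
  where "a_invariant S = (THE e. is_rational_degree (hilbert_series S) e)"

definition real_nvec :: "nat ^ 'n \<Rightarrow> real ^ 'n"
  where "real_nvec a = (\<chi> i. real (a $ i))"

definition real_zvec :: "int ^ 'n \<Rightarrow> real ^ 'n"
  where "real_zvec a = (\<chi> i. real_of_int (a $ i))"

definition monomial_subring :: "(nat ^ 'n) set \<Rightarrow> ('n, 'k::field) xt_poly set"
  where "monomial_subring W = generated_subalgebra ((\<lambda>w. xt_monom w 1) ` W)"

definition lifted_points :: "(nat ^ 'n) set \<Rightarrow> ((real ^ 'n) \<times> real) set"
  where "lifted_points W = (\<lambda>w. (real_nvec w, 1)) ` W"

definition nat_span :: "'v::real_vector set \<Rightarrow> 'v set"
  where "nat_span B = {\<Sum>v\<in>B. real (c v) *\<^sub>R v | c :: 'v \<Rightarrow> nat. True}"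

text \<open>
  The canonical module of a normal \<open>monomial_subring W\<close> with \<open>W\<close> finite and nonempty, given by the
  Danilov--Stanley formula.
\<close>

definition canonical_module :: "(nat ^ 'n) set \<Rightarrow> ('n, 'k::field) xt_poly set"
  where "canonical_module W = generated_ideal (monomial_subring W)
    {xt_monom a b | a b. (real_nvec a, real b) \<in>
        nat_span (lifted_points W) \<inter> rel_interior (convex_cone hull lifted_points W)}"

definition is_minimum :: "'a::order set \<Rightarrow> 'a \<Rightarrow> bool"
  where "is_minimum X m \<longleftrightarrow> m \<in> X \<and> (\<forall>x\<in>X. m \<le> x)"

definition integer_rounding :: "nat ^ 'q ^ 'n \<Rightarrow> bool"
  where "integer_rounding A \<longleftrightarrow> (\<forall>(a :: int ^ 'n) m.
    is_minimum {y \<bullet> 1 | y :: real ^ 'q. 0 \<le> y \<and> real_zvec a \<le> map_matrix real A *v y} m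
    \<longrightarrow> is_minimum {real_nvec y \<bullet> 1 | y :: nat ^ 'q. real_zvec a \<le> map_matrix real A *v real_nvec y}
          (real_of_int \<lceil>m\<rceil>))"

definition packing_polytope :: "nat ^ 'q ^ 'n \<Rightarrow> (real ^ 'n) set"
  where "packing_polytope A = {x. 0 \<le> x \<and> x v* map_matrix real A \<le> 1}"

definition maximal_vertices :: "(real ^ 'n) set \<Rightarrow> (real ^ 'n) set"
  where "maximal_vertices P = {l. l extreme_point_of P \<and>
    (\<forall>l'. l' extreme_point_of P \<and> l \<le> l' \<longrightarrow> l' = l)}"

definition is_primitive_multiplier :: "real ^ 'n \<Rightarrow> int \<Rightarrow> bool"
  where "is_primitive_multiplier l d \<longleftrightarrow> 0 < d \<and> (\<exists>z :: int ^ 'n.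
    real_zvec z = - (real_of_int d *\<^sub>R l) \<and> Gcd ((range (($) z) \<union> {d}) - {0}) = 1)"

definition primitive_multiplier :: "real ^ 'n \<Rightarrow> int"
  where "primitive_multiplier l = (THE d. is_primitive_multiplier l d)"

lemma is_primitive_multiplier_unique:
  fixes l :: "real ^ 'n"
  assumes "is_primitive_multiplier l d" and "is_primitive_multiplier l d'"
  shows "d = d'"
proof -
  have dvd: "d dvd d'" if d: "is_primitive_multiplier l d" and d': "is_primitive_multiplier l d'"
    for d d'
  proof -
    obtain z :: "int ^ 'n" where z: "real_zvec z = - (real_of_int d *\<^sub>R l)"
      "Gcd ((range (($) z) \<union> {d}) - {0}) = 1"
      using d unfolding is_primitive_multiplier_def by blast
    obtain z' :: "int ^ 'n" where z': "real_zvec z' = - (real_of_int d' *\<^sub>R l)"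
      using d' unfolding is_primitive_multiplier_def by blast
    have eq: "d' * z $ i = d * z' $ i" for i
    proof -
      have "real_of_int (z $ i) = - (real_of_int d * l $ i)"
        "real_of_int (z' $ i) = - (real_of_int d' * l $ i)"
        using arg_cong[OF z(1), of "\<lambda>v. v $ i"] arg_cong[OF z', of "\<lambda>v. v $ i"]
        by (simp_all add: real_zvec_def)
      then have "real_of_int (d' * z $ i) = real_of_int (d * z' $ i)"
        by simp
      then show ?thesis
        by (simp only: of_int_eq_iff)
    qed
    have "d dvd Gcd ((*) d' ` ((range (($) z) \<union> {d}) - {0}))"
      by (intro Gcd_greatest) (auto simp: eq)
    then show ?thesis
      unfolding Gcd_mult z(2) by simp
  qed
  have "d dvd d'" "d' dvd d" "0 < d" "0 < d'"
    using dvd assms by (auto simp: is_primitive_multiplier_def)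
  then show ?thesis
    by (simp add: zdvd_antisym_nonneg)
qed

text \<open>
  The integer points \<open>(a, b)\<close> in the description of the canonical module have positive entries, so
  that \<open>nat\<close> does not truncate in the exponents of the corresponding monomials.
\<close>

lemma exponents_positive:
  fixes a :: "int ^ 'n" and b :: int
  assumes "0 \<le> l" and "0 < d"
    and l: "(real_zvec a, real_of_int b) \<bullet> (- (d *\<^sub>R l), d) \<ge> 1"
    and e: "\<forall>j. (real_zvec a, real_of_int b) \<bullet> (axis j 1, 0) \<ge> 1"
  shows "a $ j \<ge> 1" and "b \<ge> 1"
proof -
  have a: "a $ j \<ge> 1" for j
    using e[rule_format, of j] by (simp add: real_zvec_def inner_axis)
  then show "a $ j \<ge> 1" .
  have "0 \<le> real_zvec a \<bullet> l"
    using assms(1) a unfolding inner_vec_def real_zvec_def less_eq_vec_def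
    by (intro sum_nonneg) (auto intro!: mult_nonneg_nonneg order.trans[OF _ a])
  then have "0 \<le> d * (real_zvec a \<bullet> l)"
    using assms(2) by simp
  moreover have "d * (real_zvec a \<bullet> l) + 1 \<le> d * real_of_int b"
    using l by (simp add: mult.commute)
  ultimately have "0 < d * real_of_int b"
    by linarith
  then show "b \<ge> 1"
    using assms(2) by (simp add: zero_less_mult_iff)
qed

end

theory Submission
  imports Defs
begin

text \<open>
  Let \<open>C\<close> be the cone over the points \<open>(w\<^sub>i, 1)\<close>. A separation argument shows \<open>(a, b) \<in> C\<close> iff
  \<open>a \<ge> 0\<close> and \<open>\<langle>x, a\<rangle> \<le> b\<close> for all \<open>x \<in> P\<close>, and it suffices to test the maximal vertices; the
  interior of \<open>C\<close> is given by the strict inequalities. By integer rounding every lattice point of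
  \<open>C\<close> is a sum of generators, so \<open>S\<close> is spanned by the monomials in \<open>C\<close>. Division by the leading monomial
  then shows that \<open>S\<close> is completely integrally closed.

  For the \<open>a\<close>-invariant, a regular triangulation of \<open>C\<close> with generic heights and a generic direction
  \<open>v\<close> in the interior decompose \<open>C\<close> into half-open simplicial cones, and \<open>-v\<close> decomposes the interior
  of \<open>C\<close> into the opposite half-open cones. Reflecting the fundamental boxes shows that the numerators of
  the Hilbert series of \<open>C\<close> and of its interior over \<open>(1 - t)\<^bsup>n+1\<^esup>\<close> are reverses of each other, so the degree of the
  former is minus the least degree of an interior lattice point.
\<close>

section \<open>Regular triangulations of cones\<close>

text \<open>The formula for the \<open>a\<close>-invariant comes from a single lattice point. An
  interior lattice point \<open>(a, b)\<close> has \<open>a \<ge> 1\<close> in every coordinate, and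
  as all \<open>l \<ge> 0\<close>, the choice \<open>a = 1\<close> puts the weakest bounds on
  \<open>b\<close>. Since \<open>d l\<close> is integral, the strict bound
  \<open>l \<bullet> 1 < b\<close> amounts to \<open>1 / d + l \<bullet> 1 \<le> b\<close>; this is
  where the ceilings come from. The same sharpening gives the inequalities of the canonical module,
  and it rests on the rationality of the vertices.

  Two obstacles shape the rest. Closed simplicial cones overlap in faces, and their generators may
  fail to be a lattice basis: generic perturbation assigns each face to one cone without
  inclusion-exclusion, and the lattice points of a box are reflected instead of being listed. For
  normality, an integral equation adds up terms whose leading monomials may cancel; almost
  integrality replaces it by one product identity for each power.\<close>

lemma convex_cone_hull_finite:
  fixes B :: "'v::real_vector set"
  assumes "finite B"
  shows "convex_cone hull B = {\<Sum>u\<in>B. c u *\<^sub>R u | c. \<forall>u\<in>B. 0 \<le> c u}" (is "_ = ?R")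
proof
  show "convex_cone hull B \<subseteq> ?R"
  proof (rule hull_minimal)
    show "B \<subseteq> ?R"
    proof
      fix u assume "u \<in> B"
      then have "u = (\<Sum>w\<in>B. (if w = u then 1 else 0) *\<^sub>R w)"
        using assms by (simp add: if_distrib [of "\<lambda>r. r *\<^sub>R _"] sum.delta cong: if_cong)
      then show "u \<in> ?R"
        by (intro CollectI exI[of _ "\<lambda>w. if w = u then 1 else 0"]) auto
    qed
    show "convex_cone ?R"
      unfolding convex_cone_iff
    proof (intro conjI ballI allI impI)
      show "0 \<in> ?R"
        by (intro CollectI exI[of _ "\<lambda>_. 0"]) auto
    next
      fix x y assume "x \<in> ?R" "y \<in> ?R"
      then obtain c e where "x = (\<Sum>u\<in>B. c u *\<^sub>R u)" "\<forall>u\<in>B. 0 \<le> c u"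
        "y = (\<Sum>u\<in>B. e u *\<^sub>R u)" "\<forall>u\<in>B. 0 \<le> e u"
        by auto
      then show "x + y \<in> ?R"
        by (intro CollectI exI[of _ "\<lambda>u. c u + e u"]) (auto simp: scaleR_left_distrib sum.distrib)
    next
      fix x and a :: real assume "x \<in> ?R" "0 \<le> a"
      then obtain c where "x = (\<Sum>u\<in>B. c u *\<^sub>R u)" "\<forall>u\<in>B. 0 \<le> c u"
        by auto
      then show "a *\<^sub>R x \<in> ?R"
        using \<open>0 \<le> a\<close> by (intro CollectI exI[of _ "\<lambda>u. a * c u"]) (auto simp: scaleR_right.sum)
    qed
  qed
  show "?R \<subseteq> convex_cone hull B"
  proof clarify
    fix c :: "'v \<Rightarrow> real" assume c: "\<forall>u\<in>B. 0 \<le> c u"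
    have "T \<subseteq> B \<Longrightarrow> (\<Sum>u\<in>T. c u *\<^sub>R u) \<in> convex_cone hull B" for T
    proof (induction T rule: infinite_finite_induct)
      case (insert u T)
      then show ?case
        using c by (auto intro!: convex_cone_hull_add convex_cone_hull_mul intro: hull_inc)
    qed (auto intro: convex_cone_hull_contains_0)
    then show "(\<Sum>u\<in>B. c u *\<^sub>R u) \<in> convex_cone hull B"
      by blast
  qed
qed

text \<open>The ratio test of the simplex method: \<open>v\<close> minimises
  \<open>c u / \<alpha> u\<close> over the \<open>u\<close> with \<open>\<alpha> u > 0\<close>, so
  subtracting that multiple of \<alpha> makes the coefficient of \<open>v\<close> vanish before any
  other turns negative. It serves both to shrink a dependent support and to pivot between
  bases.\<close>

lemma ratio_test:
  fixes c \<alpha> :: "'a \<Rightarrow> real"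
  assumes "finite \<sigma>" and "\<forall>u\<in>\<sigma>. 0 \<le> c u" and "\<exists>u\<in>\<sigma>. 0 < \<alpha> u"
  obtains v where "v \<in> \<sigma>" "0 < \<alpha> v" "\<forall>u\<in>\<sigma>. 0 \<le> c u - c v / \<alpha> v * \<alpha> u"
proof -
  let ?X = "{u\<in>\<sigma>. 0 < \<alpha> u}"
  have "finite ?X" "?X \<noteq> {}"
    using assms by auto
  then obtain v where v: "v \<in> ?X" "\<forall>u\<in>?X. c v / \<alpha> v \<le> c u / \<alpha> u"
    using ex_is_arg_min_if_finite[of ?X "\<lambda>u. c u / \<alpha> u"] by (auto simp: is_arg_min_linorder)
  have "0 \<le> c u - c v / \<alpha> v * \<alpha> u" if "u \<in> \<sigma>" for u
  proof (cases "0 < \<alpha> u")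
    case True
    then have "c v / \<alpha> v \<le> c u / \<alpha> u"
      using v that by auto
    then show ?thesis
      using True by (simp add: pos_le_divide_eq)
  next
    case False
    have "0 \<le> c v / \<alpha> v"
      using v assms(2) by auto
    then have "c v / \<alpha> v * \<alpha> u \<le> 0"
      using False by (intro mult_nonneg_nonpos) auto
    then show ?thesis
      using assms(2) that by fastforce
  qed
  then show ?thesis
    using that v by blast
qed

section \<open>Bases taken from the generators and interpolation of heights\<close>

definition basis_in :: "'v::real_vector set \<Rightarrow> 'v set \<Rightarrow> bool"
  where "basis_in B \<sigma> \<longleftrightarrow> \<sigma> \<subseteq> B \<and> independent \<sigma> \<and> span \<sigma> = UNIV"

text \<open>The linear function that agrees with \<open>h\<close> on the basis \<sigma>; its graph
  is the hyperplane through the lifted points \<open>(u, h u)\<close>.\<close>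

definition interpolate :: "('v \<Rightarrow> real) \<Rightarrow> 'v::real_vector set \<Rightarrow> 'v \<Rightarrow> real"
  where "interpolate h \<sigma> x = (\<Sum>u\<in>\<sigma>. representation \<sigma> x u * h u)"

lemma finite_basis_in: "basis_in B \<sigma> \<Longrightarrow> finite (\<sigma> :: 'v::euclidean_space set)"
  by (auto simp: basis_in_def dest: finiteI_independent)

lemma basis_rep_sum:
  fixes \<sigma> :: "'v::euclidean_space set"
  assumes "basis_in B \<sigma>"
  shows "(\<Sum>u\<in>\<sigma>. representation \<sigma> x u *\<^sub>R u) = x"
  using assms finite_basis_in[OF assms] unfolding basis_in_def
  by (intro real_vector.sum_representation_eq) auto

lemma basis_rep_unique:
  fixes \<sigma> :: "'v::euclidean_space set"
  assumes "basis_in B \<sigma>" and "x = (\<Sum>u\<in>\<sigma>. c u *\<^sub>R u)" and "u \<in> \<sigma>"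
  shows "representation \<sigma> x u = c u"
proof -
  have "representation \<sigma> x = (\<lambda>v. if v \<in> \<sigma> then c v else 0)"
    using assms finite_basis_in[OF assms(1)] unfolding basis_in_def
    by (intro real_vector.representation_eqI) (auto intro: sum.cong simp: sum.If_cases Int_absorb1 split: if_splits
        intro!: sum.mono_neutral_cong_left)
  then show ?thesis
    using assms(3) by simp
qed

lemma basis_rep_add:
  fixes \<sigma> :: "'v::euclidean_space set"
  shows "basis_in B \<sigma> \<Longrightarrow> representation \<sigma> (x + y) u = representation \<sigma> x u + representation \<sigma> y u"
  by (simp add: basis_in_def real_vector.representation_add)

lemma basis_rep_scale:
  fixes \<sigma> :: "'v::euclidean_space set"
  shows "basis_in B \<sigma> \<Longrightarrow> representation \<sigma> (a *\<^sub>R x) u = a * representation \<sigma> x u"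
  by (simp add: basis_in_def real_vector.representation_scale)

lemma basis_rep_basis:
  fixes \<sigma> :: "'v::euclidean_space set"
  shows "basis_in B \<sigma> \<Longrightarrow> v \<in> \<sigma> \<Longrightarrow> representation \<sigma> v u = (if u = v then 1 else 0)"
  by (auto simp: basis_in_def real_vector.representation_basis)

lemma linear_interpolate:
  fixes \<sigma> :: "'v::euclidean_space set"
  assumes "basis_in B \<sigma>"
  shows "linear (interpolate h \<sigma>)"
  by (rule linearI)
    (simp_all add: interpolate_def basis_rep_add[OF assms] basis_rep_scale[OF assms]
      sum.distrib algebra_simps sum_distrib_left)

lemma interpolate_basis:
  fixes \<sigma> :: "'v::euclidean_space set"
  assumes "basis_in B \<sigma>" and "v \<in> \<sigma>"
  shows "interpolate h \<sigma> v = h v"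
  using assms finite_basis_in[OF assms(1)]
  by (simp add: interpolate_def basis_rep_basis sum.delta if_distrib [of "\<lambda>r. r * _"] cong: if_cong)

lemma linear_eq_sum_rep:
  fixes \<sigma> :: "'v::euclidean_space set"
  assumes "basis_in B \<sigma>" and "linear f"
  shows "f x = (\<Sum>u\<in>\<sigma>. representation \<sigma> x u * (f u :: real))"
proof -
  have "f x = f (\<Sum>u\<in>\<sigma>. representation \<sigma> x u *\<^sub>R u)"
    by (simp add: basis_rep_sum[OF assms(1)])
  then show ?thesis
    using assms(2) by (simp add: linear_sum linear_scale)
qed

text \<open>The heights are the powers of a real number avoiding the roots of finitely many nonzero polynomials.\<close>

lemma generic_heights:
  fixes B :: "'v::euclidean_space set"
  assumes "finite B"
  obtains h where "\<forall>\<sigma> w. basis_in B \<sigma> \<longrightarrow> w \<in> B - \<sigma> \<longrightarrow> interpolate h \<sigma> w \<noteq> h w"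
proof -
  obtain idx :: "'v \<Rightarrow> nat" where idx: "inj_on idx B"
    using finite_imp_inj_to_nat_seg[OF assms] by blast
  \<comment> \<open>For the heights \<open>h u = t ^ idx u\<close>, the value at \<open>t\<close> is
    the gap \<open>h w - interpolate h \<sigma> w\<close>.\<close>
  define p where "p \<sigma> w = monom 1 (idx w) - (\<Sum>u\<in>\<sigma>. monom (representation \<sigma> w u) (idx u))" for \<sigma> w
  define X where "X = {(\<sigma>, w). basis_in B \<sigma> \<and> w \<in> B - \<sigma>}"
  have "X \<subseteq> Pow B \<times> B"
    by (auto simp: X_def basis_in_def)
  then have "finite X"
    by (rule finite_subset) (use assms in auto)
  moreover have "finite {t. poly (p \<sigma> w) t = 0}" if "(\<sigma>, w) \<in> X" for \<sigma> w
  proof (rule poly_roots_finite)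
    \<comment> \<open>Injectivity of \<open>idx\<close> and \<open>w \<notin> \<sigma>\<close> keep
      the exponent \<open>idx w\<close> out of the subtracted sum.\<close>
    have "coeff (p \<sigma> w) (idx w) = 1"
      using that inj_onD[OF idx]
      by (fastforce simp: p_def X_def coeff_sum basis_in_def subset_iff intro!: sum.neutral)
    then show "p \<sigma> w \<noteq> 0"
      by auto
  qed
  ultimately have "finite (\<Union>(\<sigma>, w)\<in>X. {t. poly (p \<sigma> w) t = 0})"
    by auto
  then obtain t where t: "t \<notin> (\<Union>(\<sigma>, w)\<in>X. {t. poly (p \<sigma> w) t = 0})"
    using ex_new_if_finite infinite_UNIV_char_0 by blast
  show ?thesis
  proof (intro that[of "\<lambda>u. t ^ idx u"] allI impI)
    fix \<sigma> w assume "basis_in B \<sigma>" "w \<in> B - \<sigma>"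
    then have "poly (p \<sigma> w) t \<noteq> 0"
      using t by (auto simp: X_def)
    then show "interpolate (\<lambda>u. t ^ idx u) \<sigma> w \<noteq> t ^ idx w"
      by (simp add: p_def interpolate_def poly_sum poly_monom)
  qed
qed

text \<open>The projections of the simplicial faces of the lower hull of the lifted points \<open>(u, h u)\<close>.\<close>

definition regular_simplices :: "('v \<Rightarrow> real) \<Rightarrow> 'v::euclidean_space set \<Rightarrow> 'v set set"
  where "regular_simplices h B = {\<sigma>. basis_in B \<sigma> \<and> (\<forall>w\<in>B-\<sigma>. interpolate h \<sigma> w < h w)}"

text \<open>Genericity: the spans to be avoided include every hyperplane through a facet of a
  simplicial cone with generators in \<open>B\<close>, so a point off the walls has no vanishing
  coordinate in any basis from \<open>B\<close>.\<close>

definition off_walls :: "'v::euclidean_space set \<Rightarrow> 'v \<Rightarrow> bool"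
  where "off_walls B x \<longleftrightarrow> (\<forall>\<tau>\<subseteq>B. span \<tau> \<noteq> UNIV \<longrightarrow> x \<notin> span \<tau>)"

lemma basis_rep_off_walls:
  fixes \<sigma> :: "'v::euclidean_space set"
  assumes "basis_in B \<sigma>" and "off_walls B v" and "u \<in> \<sigma>"
  shows "representation \<sigma> v u \<noteq> 0"
proof
  assume 0: "representation \<sigma> v u = 0"
  have "v = (\<Sum>w\<in>\<sigma> - {u}. representation \<sigma> v w *\<^sub>R w)"
    using basis_rep_sum[OF assms(1), of v] 0 assms(3) finite_basis_in[OF assms(1)]
    by (simp add: sum.remove)
  then have "v \<in> span (\<sigma> - {u})"
    by (metis (no_types, lifting) span_base span_scale span_sum)
  moreover have "u \<notin> span (\<sigma> - {u})"
    using assms by (auto simp: basis_in_def dependent_def)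
  ultimately show False
    using assms(1,2) unfolding off_walls_def basis_in_def by blast
qed

text \<open>On \<open>B\<close>, \<open>interpolate h \<sigma>\<close> lies weakly below
  \<open>h\<close>, and strictly below it off \<sigma>. Evaluating it at \<open>x\<close> through
  the positive coordinates in \<tau> gives at most the value of \<open>interpolate h \<tau>\<close>,
  and less unless \<tau> \<subseteq> \<sigma>. By symmetry both inclusions follow.\<close>

lemma regular_simplices_unique:
  fixes B :: "'v::euclidean_space set"
  assumes "\<sigma> \<in> regular_simplices h B" "\<tau> \<in> regular_simplices h B"
    and "\<forall>u\<in>\<sigma>. 0 < representation \<sigma> x u" "\<forall>u\<in>\<tau>. 0 < representation \<tau> x u"
  shows "\<sigma> = \<tau>"
proof -
  have le: "interpolate h \<sigma> x \<le> interpolate h \<tau> x \<and>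
      (\<not> \<tau> \<subseteq> \<sigma> \<longrightarrow> interpolate h \<sigma> x < interpolate h \<tau> x)"
    if \<sigma>: "\<sigma> \<in> regular_simplices h B" and \<tau>: "\<tau> \<in> regular_simplices h B"
      and pos: "\<forall>u\<in>\<tau>. 0 < representation \<tau> x u" for \<sigma> \<tau>
  proof -
    have bs: "basis_in B \<sigma>" "basis_in B \<tau>"
      using \<sigma> \<tau> by (auto simp: regular_simplices_def)
    have eq: "interpolate h \<sigma> x = (\<Sum>u\<in>\<tau>. representation \<tau> x u * interpolate h \<sigma> u)"
      by (rule linear_eq_sum_rep[OF bs(2) linear_interpolate[OF bs(1)]])
    have hle: "interpolate h \<sigma> u \<le> h u" if "u \<in> \<tau>" for u
    proof (cases "u \<in> \<sigma>")
      case False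
      then show ?thesis
        using \<sigma> that bs by (force simp: regular_simplices_def basis_in_def)
    qed (simp add: interpolate_basis[OF bs(1)])
    show ?thesis
    proof (intro conjI impI)
      show "interpolate h \<sigma> x \<le> interpolate h \<tau> x"
        unfolding eq unfolding interpolate_def[of h \<tau>]
        using pos hle by (intro sum_mono mult_left_mono) auto
      assume "\<not> \<tau> \<subseteq> \<sigma>"
      then obtain v where v: "v \<in> \<tau>" "v \<notin> \<sigma>" by blast
      then have "interpolate h \<sigma> v < h v"
        using \<sigma> bs by (auto simp: regular_simplices_def basis_in_def)
      then show "interpolate h \<sigma> x < interpolate h \<tau> x"
        unfolding eq unfolding interpolate_def[of h \<tau>]
        using pos hle v finite_basis_in[OF bs(2)]
        by (intro sum_strict_mono_ex1 ballI mult_left_mono bexI[of _ v]) auto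
    qed
  qed
  show ?thesis
    using le[OF assms(1,2,4)] le[OF assms(2,1,3)] by fastforce
qed

text \<open>Caratheodory's theorem for cones: a support of least size admits no linear relation,
  since the ratio test would shrink it.\<close>

lemma minimal_positive_support:
  fixes B :: "'v::euclidean_space set"
  assumes B: "finite B" and f: "linear f" "\<forall>u\<in>B. f u = (1::real)"
    and x: "x \<in> convex_cone hull B"
  obtains \<tau> c where "\<tau> \<subseteq> B" "independent \<tau>" "\<forall>u\<in>\<tau>. 0 < c u" "x = (\<Sum>u\<in>\<tau>. c u *\<^sub>R u)"
proof -
  define Q where "Q \<tau> \<longleftrightarrow> \<tau> \<subseteq> B \<and> (\<exists>c. (\<forall>u\<in>\<tau>. 0 \<le> c u) \<and> x = (\<Sum>u\<in>\<tau>. c u *\<^sub>R u))" for \<tau>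
  have "Q B"
    using x unfolding Q_def convex_cone_hull_finite[OF B] by auto
  then obtain \<tau> where \<tau>: "Q \<tau>" "\<And>\<rho>. Q \<rho> \<Longrightarrow> card \<tau> \<le> card \<rho>"
    using ex_has_least_nat[of Q B card] by blast
  obtain c where c: "\<forall>u\<in>\<tau>. 0 \<le> c u" "x = (\<Sum>u\<in>\<tau>. c u *\<^sub>R u)" "\<tau> \<subseteq> B"
    using \<tau>(1) by (auto simp: Q_def)
  have fin: "finite \<tau>"
    using c(3) B by (rule finite_subset)
  have no: "e v \<noteq> 0" if "v \<in> \<tau>" "\<forall>u\<in>\<tau>. 0 \<le> e u" "x = (\<Sum>u\<in>\<tau>. e u *\<^sub>R u)" for e v
  proof
    assume "e v = 0"
    then have "x = (\<Sum>u\<in>\<tau> - {v}. e u *\<^sub>R u)"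
      using that fin by (simp add: sum.remove[of \<tau> v])
    then have "Q (\<tau> - {v})"
      using that c(3) by (auto simp: Q_def)
    then show False
      using \<tau>(2) that(1) fin by (metis card_Diff1_less not_less)
  qed
  have "independent \<tau>"
  proof
    assume "dependent \<tau>"
    then obtain \<beta> v where \<beta>: "v \<in> \<tau>" "\<beta> v \<noteq> 0" "(\<Sum>u\<in>\<tau>. \<beta> u *\<^sub>R u) = 0"
      using fin by (auto simp: dependent_finite)
    \<comment> \<open>As \<open>f\<close> is 1 on \<open>B\<close>, the coefficients of a relation
      sum to zero; a nontrivial one then has a positive coefficient, as the ratio test
      requires.\<close>
    have "(\<Sum>u\<in>\<tau>. \<beta> u) = f (\<Sum>u\<in>\<tau>. \<beta> u *\<^sub>R u)"
      using f c(3) by (auto simp: linear_sum linear_scale subset_iff intro!: sum.cong)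
    also have "\<dots> = 0"
      unfolding \<beta>(3) using f(1) by (rule linear_0)
    finally have "\<exists>u\<in>\<tau>. 0 < \<beta> u"
      using \<beta>(1,2) fin sum_nonneg_eq_0_iff[of \<tau> "\<lambda>u. - \<beta> u"]
      by (auto simp: sum_negf not_less) (meson linorder_not_le)
    then obtain w where w: "w \<in> \<tau>" "0 < \<beta> w" "\<forall>u\<in>\<tau>. 0 \<le> c u - c w / \<beta> w * \<beta> u"
      using ratio_test[OF fin c(1)] by blast
    have "x = (\<Sum>u\<in>\<tau>. (c u - c w / \<beta> w * \<beta> u) *\<^sub>R u)"
    proof -
      have "(\<Sum>u\<in>\<tau>. (c u - c w / \<beta> w * \<beta> u) *\<^sub>R u) = x - (c w / \<beta> w) *\<^sub>R (\<Sum>u\<in>\<tau>. \<beta> u *\<^sub>R u)"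
        unfolding c(2) by (simp add: scaleR_left_diff_distrib sum_subtractf scaleR_right.sum)
      then show ?thesis
        by (simp add: \<beta>(3))
    qed
    from no[OF w(1,3) this] show False
      using w(2) by simp
  qed
  moreover have "\<forall>u\<in>\<tau>. 0 < c u"
    using no[of _ c] c by force
  ultimately show ?thesis
    using that c by blast
qed

text \<open>Optimality as in linear programming: among the bases whose cone contains
  \<open>x\<close>, take one with the least interpolated height at \<open>x\<close>. If a lifted
  point \<open>(w, h w)\<close> lay below its hyperplane, pivoting \<open>w\<close> into the basis
  would lower that height.\<close>

lemma regular_simplices_cover:
  fixes B :: "'v::euclidean_space set"
  assumes B: "finite B" and f: "linear f" "\<forall>u\<in>B. f u = (1::real)"
    and h: "\<forall>\<sigma> w. basis_in B \<sigma> \<longrightarrow> w \<in> B - \<sigma> \<longrightarrow> interpolate h \<sigma> w \<noteq> h w"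
    and x: "x \<in> convex_cone hull B" "off_walls B x"
  shows "\<exists>\<sigma>\<in>regular_simplices h B. \<forall>u\<in>\<sigma>. 0 < representation \<sigma> x u"
proof -
  define X where "X = {\<sigma>. basis_in B \<sigma> \<and> (\<forall>u\<in>\<sigma>. 0 \<le> representation \<sigma> x u)}"
  have pos: "0 < representation \<sigma> x u" if "\<sigma> \<in> X" "u \<in> \<sigma>" for \<sigma> u
    using that basis_rep_off_walls[OF _ x(2), of \<sigma> u] by (force simp: X_def less_le)
  obtain \<tau> c where \<tau>: "\<tau> \<subseteq> B" "independent \<tau>" "\<forall>u\<in>\<tau>. 0 < c u" "x = (\<Sum>u\<in>\<tau>. c u *\<^sub>R u)"
    using minimal_positive_support[OF B f x(1)] by blast
  have "x \<in> span \<tau>"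
    unfolding \<tau>(4) by (intro span_sum span_scale span_base)
  then have \<tau>b: "basis_in B \<tau>"
    using \<tau> x(2) by (auto simp: basis_in_def off_walls_def)
  then have "\<tau> \<in> X"
    using \<tau> basis_rep_unique[OF \<tau>b \<tau>(4)] by (auto simp: X_def less_imp_le)
  moreover have "finite X"
    by (rule finite_subset[of _ "Pow B"]) (use B in \<open>auto simp: X_def basis_in_def\<close>)
  ultimately obtain \<sigma> where \<sigma>: "\<sigma> \<in> X" "\<And>\<rho>. \<rho> \<in> X \<Longrightarrow> interpolate h \<sigma> x \<le> interpolate h \<rho> x"
    using ex_min_if_finite[of "(\<lambda>\<sigma>. interpolate h \<sigma> x) ` X"] by (auto simp: not_less)
  have b: "basis_in B \<sigma>"
    using \<sigma>(1) by (simp add: X_def)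
  note fin = finite_basis_in[OF b]
  have "interpolate h \<sigma> w < h w" if w: "w \<in> B - \<sigma>" for w
  proof (rule ccontr)
    assume "\<not> interpolate h \<sigma> w < h w"
    then have gt: "h w < interpolate h \<sigma> w"
      using h b w by force
    let ?c = "representation \<sigma> x" and ?\<alpha> = "representation \<sigma> w"
    \<comment> \<open>The coordinates of \<open>w\<close> sum to 1, so one of them is positive and a
      leaving vector exists.\<close>
    have "(\<Sum>u\<in>\<sigma>. ?\<alpha> u) = f w"
      unfolding linear_eq_sum_rep[OF b f(1), of w] using f(2) b
      by (intro sum.cong) (auto simp: basis_in_def)
    then have "(\<Sum>u\<in>\<sigma>. ?\<alpha> u) = 1"
      using f(2) w by simp
    then have "\<exists>u\<in>\<sigma>. 0 < ?\<alpha> u"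
      by (metis not_less sum_nonpos zero_less_one)
    then obtain v where v: "v \<in> \<sigma>" "0 < ?\<alpha> v" "\<forall>u\<in>\<sigma>. 0 \<le> ?c u - ?c v / ?\<alpha> v * ?\<alpha> u"
      using ratio_test[OF fin, of ?c ?\<alpha>] \<sigma>(1) by (auto simp: X_def)
    \<comment> \<open>The coefficient with which \<open>w\<close> enters. It is positive because
      \<open>x\<close> is off the walls, so the pivot strictly lowers the height.\<close>
    define t where "t = ?c v / ?\<alpha> v"
    define \<rho> where "\<rho> = insert w (\<sigma> - {v})"
    define e where "e u = (if u = w then t else ?c u - t * ?\<alpha> u)" for u
    have t: "0 < t"
      using v pos[OF \<sigma>(1) v(1)] by (simp add: t_def)
    \<comment> \<open>Otherwise the \<open>v\<close>-coordinate of \<open>w\<close> would be zero,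
      contrary to the choice of \<open>v\<close>; hence the exchange yields a basis again.\<close>
    have wn: "w \<notin> span (\<sigma> - {v})"
    proof
      assume "w \<in> span (\<sigma> - {v})"
      then have "representation \<sigma> w v = representation (\<sigma> - {v}) w v"
        using b by (subst real_vector.representation_extend[of \<sigma> w "\<sigma> - {v}"]) (auto simp: basis_in_def)
      also have "\<dots> = 0"
        using real_vector.representation_ne_zero[of "\<sigma> - {v}" w v] by blast
      finally show False
        using v by simp
    qed
    have \<rho>: "basis_in B \<rho>"
    proof -
      have ind: "independent \<rho>"
        using wn b unfolding \<rho>_def basis_in_def
        by (meson Diff_subset independent_insertI independent_mono)
      have "card \<rho> = card \<sigma>"
        using w v fin using card_Suc_Diff1[OF fin v(1)] by (simp add: \<rho>_def)
      also have "\<dots> = DIM('v)"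
        using b by (metis basis_in_def dim_UNIV dim_span_eq_card_independent)
      finally have "span \<rho> = UNIV"
        using ind by (metis UNIV_I card_eq_dim dim_UNIV subset_antisym subset_UNIV fin \<rho>_def finite_Diff finite_insert order_refl)
      then show ?thesis
        using ind b w by (auto simp: basis_in_def \<rho>_def)
    qed
    have ex: "x = (\<Sum>u\<in>\<rho>. e u *\<^sub>R u)" and hx: "(\<Sum>u\<in>\<rho>. e u * h u) = interpolate h \<sigma> x - t * (interpolate h \<sigma> w - h w)"
    proof -
      have wv: "w \<notin> \<sigma> - {v}" "\<And>u. u \<in> \<sigma> - {v} \<Longrightarrow> e u = ?c u - t * ?\<alpha> u" "e w = t"
        "?c v - t * ?\<alpha> v = 0"
        using w v by (auto simp: e_def t_def)
      have "(\<Sum>u\<in>\<rho>. e u *\<^sub>R u) = t *\<^sub>R w + (\<Sum>u\<in>\<sigma> - {v}. (?c u - t * ?\<alpha> u) *\<^sub>R u)"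
        unfolding \<rho>_def using wv fin by simp
      also have "(\<Sum>u\<in>\<sigma> - {v}. (?c u - t * ?\<alpha> u) *\<^sub>R u) = (\<Sum>u\<in>\<sigma>. (?c u - t * ?\<alpha> u) *\<^sub>R u)"
        using wv(4) v fin by (simp add: sum.remove[of \<sigma> v])
      also have "\<dots> = (\<Sum>u\<in>\<sigma>. ?c u *\<^sub>R u) - t *\<^sub>R (\<Sum>u\<in>\<sigma>. ?\<alpha> u *\<^sub>R u)"
        by (simp add: scaleR_left_diff_distrib sum_subtractf scaleR_right.sum)
      also have "\<dots> = x - t *\<^sub>R w"
        by (simp only: basis_rep_sum[OF b])
      finally show "x = (\<Sum>u\<in>\<rho>. e u *\<^sub>R u)"
        by simp
      have "(\<Sum>u\<in>\<rho>. e u * h u) = t * h w + (\<Sum>u\<in>\<sigma> - {v}. (?c u - t * ?\<alpha> u) * h u)"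
        unfolding \<rho>_def using wv fin by simp
      also have "(\<Sum>u\<in>\<sigma> - {v}. (?c u - t * ?\<alpha> u) * h u) = (\<Sum>u\<in>\<sigma>. (?c u - t * ?\<alpha> u) * h u)"
        using wv(4) v fin by (simp add: sum.remove[of \<sigma> v])
      also have "\<dots> = interpolate h \<sigma> x - t * interpolate h \<sigma> w"
        by (simp add: left_diff_distrib sum_subtractf sum_distrib_left interpolate_def mult.assoc)
      finally show "(\<Sum>u\<in>\<rho>. e u * h u) = interpolate h \<sigma> x - t * (interpolate h \<sigma> w - h w)"
        by (simp add: algebra_simps)
    qed
    have rep: "representation \<rho> x u = e u" if "u \<in> \<rho>" for u
      by (rule basis_rep_unique[OF \<rho> ex that])
    have "\<rho> \<in> X"
      using \<rho> rep v(3) t by (auto simp: X_def e_def \<rho>_def t_def)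
    moreover have "interpolate h \<rho> x < interpolate h \<sigma> x"
      using hx t gt by (simp add: interpolate_def[of h \<rho>] rep)
    ultimately show False
      using \<sigma>(2) by fastforce
  qed
  then have "\<sigma> \<in> regular_simplices h B"
    using b by (auto simp: regular_simplices_def)
  then show ?thesis
    using pos[OF \<sigma>(1)] by blast
qed

section \<open>Generic perturbation and half-open cones\<close>

lemma off_walls_neg: "off_walls B (- x) \<longleftrightarrow> off_walls B x"
  by (metis add.inverse_inverse off_walls_def span_neg)

text \<open>Finitely many proper subspaces form a negligible set, which cannot cover a nonempty open
  set.\<close>

lemma exists_off_walls:
  fixes B :: "'v::euclidean_space set"
  assumes "finite B" and "open U" and "U \<noteq> {}"
  obtains v where "v \<in> U" "off_walls B v"
proof -
  let ?N = "\<Union>\<tau>\<in>{\<tau>. \<tau> \<subseteq> B \<and> span \<tau> \<noteq> UNIV}. span \<tau>"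
  have "negligible (span \<tau>)" if "span \<tau> \<noteq> UNIV" for \<tau> :: "'v set"
  proof (rule negligible_lowdim)
    have "dim \<tau> \<noteq> DIM('v)"
      using that dim_eq_full by blast
    then show "dim (span \<tau>) < DIM('v)"
      using dim_subset_UNIV[of \<tau>] by (simp add: less_le)
  qed
  then have "negligible ?N"
    using assms(1) by (intro negligible_Union) auto
  then have "\<not> U \<subseteq> ?N"
    using open_not_negligible[OF assms(2,3)] negligible_subset by blast
  then show ?thesis
    using that unfolding off_walls_def by blast
qed

text \<open>The line through \<open>x\<close> in direction \<open>v\<close> meets each proper span
  at most once: two intersections would put \<open>v\<close> itself into the span.\<close>

lemma eventually_off_walls:
  fixes B :: "'v::euclidean_space set"
  assumes "finite B" and "off_walls B v"
  shows "\<forall>\<^sub>F \<epsilon> in at_right 0. off_walls B (x + \<epsilon> *\<^sub>R v)"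
proof -
  have "\<forall>\<^sub>F \<epsilon> in at_right 0. x + \<epsilon> *\<^sub>R v \<notin> span \<tau>" if "\<tau> \<subseteq> B" "span \<tau> \<noteq> UNIV" for \<tau>
  proof (cases "\<exists>r. x + r *\<^sub>R v \<in> span \<tau>")
    case True
    then obtain r where r: "x + r *\<^sub>R v \<in> span \<tau>" by blast
    have "\<epsilon> = r" if e: "x + \<epsilon> *\<^sub>R v \<in> span \<tau>" for \<epsilon>
    proof (rule ccontr)
      assume "\<epsilon> \<noteq> r"
      have "(\<epsilon> - r) *\<^sub>R v \<in> span \<tau>"
        using span_diff[OF e r] by (simp add: scaleR_left_diff_distrib)
      then have "inverse (\<epsilon> - r) *\<^sub>R (\<epsilon> - r) *\<^sub>R v \<in> span \<tau>"
        by (rule span_scale)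
      then have "v \<in> span \<tau>"
        using \<open>\<epsilon> \<noteq> r\<close> by simp
      then show False
        using assms(2) that \<open>\<tau> \<subseteq> B\<close> \<open>span \<tau> \<noteq> UNIV\<close> by (simp add: off_walls_def)
    qed
    then have "x + \<epsilon> *\<^sub>R v \<notin> span \<tau>" if "\<epsilon> \<noteq> r" for \<epsilon>
      using that by blast
    moreover have "\<forall>\<^sub>F \<epsilon> in at_right 0. \<epsilon> \<noteq> r"
      using eventually_neq_at_within by blast
    ultimately show ?thesis
      by (rule eventually_mono[rotated])
  qed auto
  moreover have "finite {\<tau>. \<tau> \<subseteq> B \<and> span \<tau> \<noteq> UNIV}"
    using assms(1) by simp
  ultimately have "\<forall>\<^sub>F \<epsilon> in at_right 0. \<forall>\<tau>\<in>{\<tau>. \<tau> \<subseteq> B \<and> span \<tau> \<noteq> UNIV}. x + \<epsilon> *\<^sub>R v \<notin> span \<tau>"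
    by (intro eventually_ball_finite) auto
  then show ?thesis
    by eventually_elim (auto simp: off_walls_def)
qed

text \<open>\<open>I\<close> lists the facets left out, \<open>J\<close> the coordinates that are
  bounded. With \<open>J = {}\<close> this is a half-open simplicial cone, with
  \<open>J = \<sigma>\<close> its half-open fundamental box, where coordinates in \<open>I\<close>
  range over \<open>(0,1]\<close> and the others over \<open>[0,1)\<close>. The sets in between
  allow one coordinate to be bounded at a time.\<close>

definition half_open_box :: "'v::euclidean_space set \<Rightarrow> 'v set \<Rightarrow> 'v set \<Rightarrow> 'v set"
  where "half_open_box \<sigma> I J = {x. \<forall>u\<in>\<sigma>.
    (if u \<in> I then 0 < representation \<sigma> x u else 0 \<le> representation \<sigma> x u) \<and>
    (u \<in> J \<longrightarrow> (if u \<in> I then representation \<sigma> x u \<le> 1 else representation \<sigma> x u < 1))}"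

text \<open>A point on the facet opposite to \<open>u\<close> leaves the cone through this facet
  when moved along \<open>v\<close> exactly if the \<open>u\<close>-coordinate of \<open>v\<close>
  is negative; these are the facets to leave out.\<close>

definition negative_part :: "'v::euclidean_space \<Rightarrow> 'v set \<Rightarrow> 'v set"
  where "negative_part v \<sigma> = {u\<in>\<sigma>. representation \<sigma> v u < 0}"

lemma negative_part_neg:
  fixes \<sigma> :: "'v::euclidean_space set"
  assumes "basis_in B \<sigma>" and "off_walls B v"
  shows "negative_part (- v) \<sigma> = \<sigma> - negative_part v \<sigma>"
  using basis_rep_off_walls[OF assms] basis_rep_scale[OF assms(1), of "-1" v]
  by (fastforce simp: negative_part_def)

lemma eventually_perturbed_pos:
  fixes a b :: real
  assumes "b \<noteq> 0"
  shows "\<forall>\<^sub>F \<epsilon> in at_right 0. 0 < a + \<epsilon> * b \<longleftrightarrow> (if b < 0 then 0 < a else 0 \<le> a)"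
proof -
  have lim: "((\<lambda>\<epsilon>. a + \<epsilon> * b) \<longlongrightarrow> a) (at_right 0)"
    by (auto intro!: tendsto_eq_intros)
  consider "a > 0" | "a < 0" | "a = 0" by linarith
  then show ?thesis
  proof cases
    case 1
    then show ?thesis
      using order_tendstoD(1)[OF lim] by (auto elim!: eventually_mono)
  next
    case 2
    then show ?thesis
      using order_tendstoD(2)[OF lim, of 0] by (auto elim!: eventually_mono)
  next
    case 3
    have "\<forall>\<^sub>F \<epsilon> in at_right 0. (0::real) < \<epsilon>"
      by (simp add: eventually_at_right_less)
    then show ?thesis
      using 3 assms by (auto elim!: eventually_mono simp: zero_less_mult_iff)
  qed
qed

lemma eventually_perturbed_in_simplex:
  fixes \<sigma> :: "'v::euclidean_space set"
  assumes "basis_in B \<sigma>" and "off_walls B v"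
  shows "\<forall>\<^sub>F \<epsilon> in at_right 0. (\<forall>u\<in>\<sigma>. 0 < representation \<sigma> (x + \<epsilon> *\<^sub>R v) u) \<longleftrightarrow>
    x \<in> half_open_box \<sigma> (negative_part v \<sigma>) {}"
proof -
  have "\<forall>\<^sub>F \<epsilon> in at_right 0. \<forall>u\<in>\<sigma>. 0 < representation \<sigma> x u + \<epsilon> * representation \<sigma> v u \<longleftrightarrow>
      (if representation \<sigma> v u < 0 then 0 < representation \<sigma> x u else 0 \<le> representation \<sigma> x u)"
    using assms by (intro eventually_ball_finite finite_basis_in ballI eventually_perturbed_pos basis_rep_off_walls)
  then show ?thesis
    by eventually_elim
      (auto simp: half_open_box_def negative_part_def basis_rep_add[OF assms(1)] basis_rep_scale[OF assms(1)])
qed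

lemma convex_cone_hull_simplex:
  fixes \<sigma> :: "'v::euclidean_space set"
  assumes "basis_in B \<sigma>" and "\<forall>u\<in>\<sigma>. 0 \<le> representation \<sigma> x u"
  shows "x \<in> convex_cone hull B"
proof -
  have "x \<in> convex_cone hull \<sigma>"
    unfolding convex_cone_hull_finite[OF finite_basis_in[OF assms(1)]]
    using assms(2) basis_rep_sum[OF assms(1), of x] by (intro CollectI exI[of _ "representation \<sigma> x"]) auto
  then show ?thesis
    using assms(1) hull_mono[of \<sigma> B convex_cone] by (auto simp: basis_in_def)
qed

text \<open>For small \<epsilon> > 0 the point \<open>x + \<epsilon> *\<^sub>R v\<close> is off the
  walls, so if it lies in the cone, it is interior to exactly one simplex of the triangulation. The
  coordinates of \<open>x\<close> decide which one, the vanishing ones being resolved by the sign of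
  the coordinates of \<open>v\<close>.\<close>

lemma perturbed_decomposition:
  fixes B :: "'v::euclidean_space set"
  assumes B: "finite B" and f: "linear f" "\<forall>u\<in>B. f u = (1::real)"
    and h: "\<forall>\<sigma> w. basis_in B \<sigma> \<longrightarrow> w \<in> B - \<sigma> \<longrightarrow> interpolate h \<sigma> w \<noteq> h w"
    and v: "off_walls B v"
  shows "(\<forall>\<^sub>F \<epsilon> in at_right 0. x + \<epsilon> *\<^sub>R v \<in> convex_cone hull B) \<longleftrightarrow>
      (\<exists>\<sigma>\<in>regular_simplices h B. x \<in> half_open_box \<sigma> (negative_part v \<sigma>) {})" (is "?E \<longleftrightarrow> ?X")
    and "\<sigma> \<in> regular_simplices h B \<Longrightarrow> \<tau> \<in> regular_simplices h B \<Longrightarrow> \<sigma> \<noteq> \<tau> \<Longrightarrow>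
      half_open_box \<sigma> (negative_part v \<sigma>) {} \<inter> half_open_box \<tau> (negative_part v \<tau>) {} = {}"
proof -
  let ?T = "regular_simplices h B"
  have "finite ?T"
    by (rule finite_subset[of _ "Pow B"]) (use B in \<open>auto simp: regular_simplices_def basis_in_def\<close>)
  then have ev: "\<forall>\<^sub>F \<epsilon> in at_right 0. \<forall>\<sigma>\<in>?T. (\<forall>u\<in>\<sigma>. 0 < representation \<sigma> (x + \<epsilon> *\<^sub>R v) u) \<longleftrightarrow>
      x \<in> half_open_box \<sigma> (negative_part v \<sigma>) {}" for x
    using eventually_perturbed_in_simplex v by (intro eventually_ball_finite) (auto simp: regular_simplices_def)
  show "?E \<longleftrightarrow> ?X"
  proof
    assume ?E
    then have "\<forall>\<^sub>F \<epsilon> in at_right (0::real). ?X"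
      using ev[of x] eventually_off_walls[OF B v, of x]
    proof eventually_elim
      case (elim \<epsilon>)
      then show ?case
        using regular_simplices_cover[OF B f h elim(1,3)] by blast
    qed
    then show ?X
      by simp
  next
    assume ?X
    then obtain \<sigma> where \<sigma>: "\<sigma> \<in> ?T" "x \<in> half_open_box \<sigma> (negative_part v \<sigma>) {}"
      by blast
    show ?E
      using ev[of x]
    proof eventually_elim
      case (elim \<epsilon>)
      then have "\<forall>u\<in>\<sigma>. 0 < representation \<sigma> (x + \<epsilon> *\<^sub>R v) u"
        using \<sigma> by blast
      then show ?case
        using \<sigma>(1) by (intro convex_cone_hull_simplex[of B \<sigma>]) (auto simp: regular_simplices_def less_imp_le)
    qed
  qed
  show "half_open_box \<sigma> (negative_part v \<sigma>) {} \<inter> half_open_box \<tau> (negative_part v \<tau>) {} = {}"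
    if "\<sigma> \<in> ?T" "\<tau> \<in> ?T" "\<sigma> \<noteq> \<tau>"
  proof (rule ccontr)
    assume "\<not> ?thesis"
    then obtain y where y: "y \<in> half_open_box \<sigma> (negative_part v \<sigma>) {}"
        "y \<in> half_open_box \<tau> (negative_part v \<tau>) {}"
      by blast
    have "\<forall>\<^sub>F \<epsilon> in at_right (0::real). False"
      using ev[of y]
    proof eventually_elim
      case (elim \<epsilon>)
      then show ?case
        using regular_simplices_unique[OF that(1,2)] y that by blast
    qed
    then show False
      by simp
  qed
qed

text \<open>Moving along \<open>v\<close> recovers the whole cone, because the cone is topologically
  closed and closed under addition. Moving against \<open>v\<close> detects the interior, because a
  point of the cone plus a positive multiple of an interior point is interior.\<close>

lemma perturbed_in_cone_iff:
  fixes B :: "'v::euclidean_space set"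
  assumes B: "finite B" and v: "v \<in> interior (convex_cone hull B)"
  shows "(\<forall>\<^sub>F \<epsilon> in at_right 0. x + \<epsilon> *\<^sub>R v \<in> convex_cone hull B) \<longleftrightarrow> x \<in> convex_cone hull B"
    and "(\<forall>\<^sub>F \<epsilon> in at_right 0. x + \<epsilon> *\<^sub>R - v \<in> convex_cone hull B) \<longleftrightarrow> x \<in> interior (convex_cone hull B)"
proof -
  let ?C = "convex_cone hull B"
  have lim: "((\<lambda>\<epsilon>. x + \<epsilon> *\<^sub>R w) \<longlongrightarrow> x) (at_right 0)" for w
    by (auto intro!: tendsto_eq_intros)
  show "(\<forall>\<^sub>F \<epsilon> in at_right 0. x + \<epsilon> *\<^sub>R v \<in> ?C) \<longleftrightarrow> x \<in> ?C"
  proof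
    assume "\<forall>\<^sub>F \<epsilon> in at_right 0. x + \<epsilon> *\<^sub>R v \<in> ?C"
    then show "x \<in> ?C"
      using Lim_in_closed_set[OF closed_convex_cone_hull[OF B] _ _ lim] by simp
  next
    assume x: "x \<in> ?C"
    have "\<forall>\<^sub>F \<epsilon> in at_right 0. (0::real) < \<epsilon>"
      by (simp add: eventually_at_right_less)
    then show "\<forall>\<^sub>F \<epsilon> in at_right 0. x + \<epsilon> *\<^sub>R v \<in> ?C"
      by eventually_elim
        (use x v interior_subset in \<open>auto intro!: convex_cone_hull_add convex_cone_hull_mul\<close>)
  qed
  show "(\<forall>\<^sub>F \<epsilon> in at_right 0. x + \<epsilon> *\<^sub>R - v \<in> ?C) \<longleftrightarrow> x \<in> interior ?C"
  proof
    assume "\<forall>\<^sub>F \<epsilon> in at_right 0. x + \<epsilon> *\<^sub>R - v \<in> ?C"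
    moreover have "\<forall>\<^sub>F \<epsilon> in at_right 0. (0::real) < \<epsilon>"
      by (simp add: eventually_at_right_less)
    ultimately have "\<forall>\<^sub>F \<epsilon> in at_right 0. 0 < \<epsilon> \<and> x + \<epsilon> *\<^sub>R - v \<in> ?C"
      by eventually_elim auto
    then obtain \<epsilon> where \<epsilon>: "0 < \<epsilon>" "x + \<epsilon> *\<^sub>R - v \<in> ?C"
      using eventually_happens'[of "at_right (0::real)"] by (metis (mono_tags, lifting) trivial_limit_at_right_real)
    \<comment> \<open>A point of the cone plus a scaled copy of its interior; it contains
      \<open>x\<close> as the image of \<open>v\<close>.\<close>
    let ?U = "(\<lambda>y. (x - \<epsilon> *\<^sub>R v) + \<epsilon> *\<^sub>R y) ` interior ?C"
    have "open ?U"
      using \<epsilon>(1) open_affinity[of "interior ?C" \<epsilon>] by simp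
    moreover have "?U \<subseteq> ?C"
      using \<epsilon> interior_subset by (auto intro!: convex_cone_hull_add convex_cone_hull_mul)
    moreover have "x \<in> ?U"
      using v by force
    ultimately show "x \<in> interior ?C"
      by (meson interiorI)
  next
    assume "x \<in> interior ?C"
    then have "\<forall>\<^sub>F \<epsilon> in at_right 0. x + \<epsilon> *\<^sub>R - v \<in> interior ?C"
      using topological_tendstoD[OF lim open_interior] by blast
    then show "\<forall>\<^sub>F \<epsilon> in at_right 0. x + \<epsilon> *\<^sub>R - v \<in> ?C"
      by eventually_elim (use interior_subset in blast)
  qed
qed

section \<open>Lattice points in half-open simplicial cones\<close>

text \<open>\<Lambda> is the lattice and \<open>f\<close> the degree. Since \<open>card\<close> is 0
  on infinite sets, the coefficients count points only under the finiteness hypotheses of the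
  results below.\<close>

definition lattice_series :: "'v set \<Rightarrow> ('v \<Rightarrow> real) \<Rightarrow> 'v set \<Rightarrow> rat fps"
  where "lattice_series \<Lambda> f S = Abs_fps (\<lambda>b. of_nat (card {x \<in> \<Lambda> \<inter> S. f x = real b}))"

lemma basis_rep_diff_basis:
  fixes \<sigma> :: "'v::euclidean_space set"
  assumes "basis_in B \<sigma>" and "u \<in> \<sigma>"
  shows "representation \<sigma> (x - u) w = representation \<sigma> x w - (if w = u then 1 else 0)"
  using basis_rep_add[OF assms(1), of x "-u" w] basis_rep_scale[OF assms(1), of "-1" u w]
    basis_rep_basis[OF assms, of w]
  by auto

lemma degree_eq_sum_rep:
  fixes \<sigma> :: "'v::euclidean_space set"
  assumes \<sigma>: "basis_in B \<sigma>" and f: "linear f" "\<forall>u\<in>B. f u = (1::real)"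
  shows "f x = (\<Sum>u\<in>\<sigma>. representation \<sigma> x u)"
  unfolding linear_eq_sum_rep[OF \<sigma> f(1), of x] using f(2) \<sigma>
  by (intro sum.cong) (auto simp: basis_in_def)

lemma half_open_box_lower:
  assumes "x \<in> half_open_box \<sigma> I J" and "u \<in> \<sigma>"
  shows "if u \<in> I then 0 < representation \<sigma> x u else 0 \<le> representation \<sigma> x u"
  by (rule conjunct1[OF bspec[OF assms(1)[unfolded half_open_box_def mem_Collect_eq] assms(2)]])

lemma half_open_box_nonneg:
  assumes "x \<in> half_open_box \<sigma> I J" and "u \<in> \<sigma>"
  shows "0 \<le> representation \<sigma> x u"
  using half_open_box_lower[OF assms] by (cases "u \<in> I") simp_all

lemma half_open_box_mono:
  assumes "J \<subseteq> J'"
  shows "half_open_box \<sigma> I J' \<subseteq> half_open_box \<sigma> I J"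
proof
  fix x assume "x \<in> half_open_box \<sigma> I J'"
  note x = bspec[OF this[unfolded half_open_box_def mem_Collect_eq]]
  show "x \<in> half_open_box \<sigma> I J"
    unfolding half_open_box_def
  proof (intro CollectI ballI conjI impI)
    fix u assume "u \<in> \<sigma>"
    from conjunct1[OF x[OF this]]
    show "if u \<in> I then 0 < representation \<sigma> x u else 0 \<le> representation \<sigma> x u" .
  next
    fix u assume "u \<in> \<sigma>" "u \<in> J"
    from mp[OF conjunct2[OF x[OF this(1)]] subsetD[OF assms this(2)]]
    show "if u \<in> I then representation \<sigma> x u \<le> 1 else representation \<sigma> x u < 1" .
  qed
qed

lemma half_open_box_insert:
  assumes "u \<in> \<sigma>"
  shows "x \<in> half_open_box \<sigma> I (insert u J) \<longleftrightarrow> x \<in> half_open_box \<sigma> I J \<and>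
    (if u \<in> I then representation \<sigma> x u \<le> 1 else representation \<sigma> x u < 1)"
proof -
  have "(\<forall>w\<in>\<sigma>. P w \<and> (w \<in> insert u J \<longrightarrow> Q w)) \<longleftrightarrow> (\<forall>w\<in>\<sigma>. P w \<and> (w \<in> J \<longrightarrow> Q w)) \<and> Q u" for P Q
    using assms by blast
  then show ?thesis
    unfolding half_open_box_def mem_Collect_eq .
qed

lemma half_open_box_cong:
  assumes "x \<in> half_open_box \<sigma> I J" and "u \<notin> J"
    and "\<And>w. w \<in> \<sigma> \<Longrightarrow> w \<noteq> u \<Longrightarrow> representation \<sigma> y w = representation \<sigma> x w"
    and "if u \<in> I then 0 < representation \<sigma> y u else 0 \<le> representation \<sigma> y u"
  shows "y \<in> half_open_box \<sigma> I J"
  unfolding half_open_box_def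
proof (intro CollectI ballI)
  fix w assume w: "w \<in> \<sigma>"
  have "(if w \<in> I then 0 < representation \<sigma> x w else 0 \<le> representation \<sigma> x w) \<and>
      (w \<in> J \<longrightarrow> (if w \<in> I then representation \<sigma> x w \<le> 1 else representation \<sigma> x w < 1))"
    using bspec[OF assms(1)[unfolded half_open_box_def mem_Collect_eq] w] .
  then show "(if w \<in> I then 0 < representation \<sigma> y w else 0 \<le> representation \<sigma> y w) \<and>
      (w \<in> J \<longrightarrow> (if w \<in> I then representation \<sigma> y w \<le> 1 else representation \<sigma> y w < 1))"
    using assms(2,3,4) w by (cases "w = u") simp_all
qed

text \<open>Translation by \<open>u\<close> maps the lattice points with bounds \<open>J\<close>
  bijectively onto those of them that violate the new bound at \<open>u\<close>. As
  \<open>f u = 1\<close>, imposing the bound removes a copy of the series shifted by one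
  degree.\<close>

lemma lattice_series_bound_coordinate:
  fixes \<sigma> :: "'v::euclidean_space set"
  assumes \<sigma>: "basis_in B \<sigma>" and f: "linear f" "\<forall>u\<in>B. f u = (1::real)"
    and \<Lambda>: "B \<subseteq> \<Lambda>" "\<forall>x\<in>\<Lambda>. \<forall>y\<in>\<Lambda>. x + y \<in> \<Lambda>" "\<forall>x\<in>\<Lambda>. \<forall>y\<in>\<Lambda>. x - y \<in> \<Lambda>"
    and fin: "\<forall>b::nat. finite {x \<in> \<Lambda> \<inter> half_open_box \<sigma> I {}. f x = real b}"
    and u: "u \<in> \<sigma> - J"
  shows "lattice_series \<Lambda> f (half_open_box \<sigma> I (insert u J)) =
    (1 - fps_X) * lattice_series \<Lambda> f (half_open_box \<sigma> I J)"
proof (rule fps_ext)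
  fix b
  let ?S = "\<lambda>J b. {x \<in> \<Lambda> \<inter> half_open_box \<sigma> I J. f x = real b}"
  have finS: "finite (?S J b)" for J b
    by (rule finite_subset[OF _ spec[OF fin, of b]]) (use half_open_box_mono[of "{}" J \<sigma> I] in auto)
  have u': "u \<in> \<sigma>" "u \<notin> J" "u \<in> \<Lambda>" "f u = 1"
    using u \<sigma> f \<Lambda>(1) by (auto simp: basis_in_def)
  note rep = basis_rep_diff_basis[OF \<sigma> u'(1)]
  show "lattice_series \<Lambda> f (half_open_box \<sigma> I (insert u J)) $ b =
      ((1 - fps_X) * lattice_series \<Lambda> f (half_open_box \<sigma> I J)) $ b"
  proof (cases b)
    case 0
    \<comment> \<open>In degree 0 nothing is removed: nonnegative coordinates with sum
      \<open>f x = 0\<close> satisfy the bound.\<close>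
    have "?S (insert u J) 0 = ?S J 0"
    proof (intro equalityI subsetI)
      fix x assume x: "x \<in> ?S J 0"
      have "representation \<sigma> x u \<le> (\<Sum>w\<in>\<sigma>. representation \<sigma> x w)"
        using x by (intro member_le_sum u' finite_basis_in[OF \<sigma>]) (auto intro: half_open_box_nonneg)
      also have "\<dots> = 0"
        using x degree_eq_sum_rep[OF \<sigma> f, of x] by simp
      finally have "representation \<sigma> x u \<le> 0" .
      then show "x \<in> ?S (insert u J) 0"
        using x by (auto simp: half_open_box_def)
    qed (auto simp: half_open_box_def)
    then show ?thesis
      using 0 by (simp add: lattice_series_def fps_mult_nth_0)
  next
    case (Suc b')
    have "?S J b = ?S (insert u J) b \<union> (\<lambda>x. x + u) ` ?S J b'" (is "_ = _ \<union> ?R")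
    proof (intro equalityI subsetI)
      fix x assume x: "x \<in> ?S J b"
      show "x \<in> ?S (insert u J) b \<union> ?R"
      proof (cases "x \<in> half_open_box \<sigma> I (insert u J)")
        case False
        then have "if u \<in> I then representation \<sigma> x u > 1 else representation \<sigma> x u \<ge> 1"
          using x half_open_box_insert[OF u'(1), of x I J] by (auto split: if_splits)
        then have "x - u \<in> half_open_box \<sigma> I J"
          using x u' by - (rule half_open_box_cong[of x _ _ _ u], auto simp: rep split: if_splits)
        then have "x - u \<in> ?S J b'"
          using x u' Suc by (simp add: linear_diff[OF f(1)] \<Lambda>(3))
        then show ?thesis
          by (intro UnI2 image_eqI[of _ _ "x - u"]) auto
      qed (use x in auto)
    next
      fix x assume x: "x \<in> ?S (insert u J) b \<union> ?R"
      have "y + u \<in> ?S J b" if y: "y \<in> ?S J b'" for y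
      proof -
        have "representation \<sigma> (y + u) w = representation \<sigma> y w + (if w = u then 1 else 0)" for w
          using rep[of "y + u" w] by simp
        then have "y + u \<in> half_open_box \<sigma> I J"
          using y u' half_open_box_nonneg[of y \<sigma> I J u]
          by - (rule half_open_box_cong[of y _ _ _ u], auto split: if_splits)
        then show ?thesis
          using y u' Suc by (simp add: linear_add[OF f(1)] \<Lambda>(2))
      qed
      then show "x \<in> ?S J b"
        using x half_open_box_mono[of J "insert u J" \<sigma> I] by blast
    qed
    moreover have "?S (insert u J) b \<inter> ?R = {}"
    proof (intro equals0I, clarify)
      fix y assume y: "y \<in> half_open_box \<sigma> I J" "y + u \<in> half_open_box \<sigma> I (insert u J)"
      have "representation \<sigma> (y + u) u = representation \<sigma> y u + 1"
        using rep[of "y + u" u] by simp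
      then show False
        using half_open_box_insert[OF u'(1), of "y + u" I J] half_open_box_lower[OF y(1) u'(1)] y(2)
        by (auto split: if_splits)
    qed
    ultimately have "card (?S J b) = card (?S (insert u J) b) + card ?R"
      using finS by (simp add: card_Un_disjoint)
    also have "card ?R = card (?S J b')"
      by (intro card_image) (auto simp: inj_on_def)
    finally show ?thesis
      using Suc by (simp add: lattice_series_def left_diff_distrib)
  qed
qed

lemma lattice_series_box:
  fixes \<sigma> :: "'v::euclidean_space set"
  assumes \<sigma>: "basis_in B \<sigma>" and f: "linear f" "\<forall>u\<in>B. f u = (1::real)"
    and \<Lambda>: "B \<subseteq> \<Lambda>" "\<forall>x\<in>\<Lambda>. \<forall>y\<in>\<Lambda>. x + y \<in> \<Lambda>" "\<forall>x\<in>\<Lambda>. \<forall>y\<in>\<Lambda>. x - y \<in> \<Lambda>"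
    and fin: "\<forall>b::nat. finite {x \<in> \<Lambda> \<inter> half_open_box \<sigma> I {}. f x = real b}"
  shows "lattice_series \<Lambda> f (half_open_box \<sigma> I \<sigma>) =
    (1 - fps_X) ^ DIM('v) * lattice_series \<Lambda> f (half_open_box \<sigma> I {})"
proof -
  have step: "J \<subseteq> \<sigma> \<Longrightarrow> lattice_series \<Lambda> f (half_open_box \<sigma> I J) =
      (1 - fps_X) ^ card J * lattice_series \<Lambda> f (half_open_box \<sigma> I {})" if "finite J" for J
    using that
  proof (induction J rule: finite_induct)
    case (insert u J)
    then show ?case
      using lattice_series_bound_coordinate[OF \<sigma> f \<Lambda> fin, of u J] by (simp add: mult.assoc)
  qed simp
  have "card \<sigma> = DIM('v)"
    using \<sigma> by (metis basis_in_def dim_UNIV dim_span_eq_card_independent)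
  then show ?thesis
    using step[OF finite_basis_in[OF \<sigma>] order_refl] by simp
qed

text \<open>Let \<open>s\<close> be the sum of \<sigma>. Reflecting \<open>x\<close> to
  \<open>s - x\<close> replaces each coordinate by its complement to 1. This exchanges
  \<open>(0,1]\<close> with \<open>[0,1)\<close>, hence \<open>I\<close> with
  \<open>\<sigma> - I\<close>, and turns degree \<open>b\<close> into
  \<open>DIM('v) - b\<close>.\<close>

lemma lattice_series_box_reflect:
  fixes \<sigma> :: "'v::euclidean_space set"
  assumes \<sigma>: "basis_in B \<sigma>" and f: "linear f" "\<forall>u\<in>B. f u = (1::real)"
    and \<Lambda>: "B \<subseteq> \<Lambda>" "\<forall>x\<in>\<Lambda>. \<forall>y\<in>\<Lambda>. x + y \<in> \<Lambda>" "\<forall>x\<in>\<Lambda>. \<forall>y\<in>\<Lambda>. x - y \<in> \<Lambda>"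
    and I: "I \<subseteq> \<sigma>"
  shows "lattice_series \<Lambda> f (half_open_box \<sigma> I \<sigma>) $ b =
    (if b \<le> DIM('v) then lattice_series \<Lambda> f (half_open_box \<sigma> (\<sigma> - I) \<sigma>) $ (DIM('v) - b) else 0)"
proof -
  have card: "card \<sigma> = DIM('v)"
    using \<sigma> by (metis basis_in_def dim_UNIV dim_span_eq_card_independent)
  define s where "s = \<Sum>\<sigma>"
  have rep1: "representation \<sigma> s u = 1" if "u \<in> \<sigma>" for u
    by (rule basis_rep_unique[OF \<sigma> _ that]) (simp add: s_def)
  have rep: "representation \<sigma> (s - x) u = 1 - representation \<sigma> x u" if "u \<in> \<sigma>" for x u
    using rep1[OF that] basis_rep_add[OF \<sigma>, of "s - x" x u] by simp
  have fs: "f s = real (DIM('v))"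
    using degree_eq_sum_rep[OF \<sigma> f, of s] rep1 card by simp
  have "\<sigma> \<noteq> {}"
    using card by auto
  moreover have "T \<noteq> {} \<Longrightarrow> T \<subseteq> \<sigma> \<Longrightarrow> \<Sum>T \<in> \<Lambda>" if "finite T" for T
    using that
  proof (induction T rule: finite_ne_induct)
    case (insert u T)
    then show ?case
      using \<sigma> \<Lambda>(1) by (auto simp: basis_in_def intro!: \<Lambda>(2)[rule_format])
  qed (use \<sigma> \<Lambda>(1) in \<open>auto simp: basis_in_def\<close>)
  ultimately have s\<Lambda>: "s \<in> \<Lambda>"
    using finite_basis_in[OF \<sigma>] by (simp add: s_def)
  have mem: "s - x \<in> half_open_box \<sigma> (\<sigma> - I) \<sigma>" if "x \<in> half_open_box \<sigma> I \<sigma>" "I \<subseteq> \<sigma>" for x I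
    using that by (auto simp: half_open_box_def rep split: if_splits)
  show ?thesis
  proof (cases "b \<le> DIM('v)")
    case True
    have "bij_betw (\<lambda>x. s - x) {x \<in> \<Lambda> \<inter> half_open_box \<sigma> I \<sigma>. f x = real b}
        {x \<in> \<Lambda> \<inter> half_open_box \<sigma> (\<sigma> - I) \<sigma>. f x = real (DIM('v) - b)}"
    proof (rule bij_betwI[where g = "\<lambda>x. s - x"])
      have fd: "f (s - x) = real DIM('v) - f x" for x
        by (simp add: linear_diff[OF f(1)] fs)
      have "\<sigma> - (\<sigma> - I) = I"
        using I by blast
      then have mem': "s - x \<in> half_open_box \<sigma> I \<sigma>" if "x \<in> half_open_box \<sigma> (\<sigma> - I) \<sigma>" for x
        using mem[OF that] by simp
      show "(\<lambda>x. s - x) \<in> {x \<in> \<Lambda> \<inter> half_open_box \<sigma> I \<sigma>. f x = real b} \<rightarrow>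
          {x \<in> \<Lambda> \<inter> half_open_box \<sigma> (\<sigma> - I) \<sigma>. f x = real (DIM('v) - b)}"
        using True mem[OF _ I] \<Lambda>(3) s\<Lambda> by (simp add: fd of_nat_diff)
      show "(\<lambda>x. s - x) \<in> {x \<in> \<Lambda> \<inter> half_open_box \<sigma> (\<sigma> - I) \<sigma>. f x = real (DIM('v) - b)} \<rightarrow>
          {x \<in> \<Lambda> \<inter> half_open_box \<sigma> I \<sigma>. f x = real b}"
        using True mem' \<Lambda>(3) s\<Lambda> by (simp add: fd of_nat_diff)
    qed simp_all
    then show ?thesis
      using True by (simp add: lattice_series_def bij_betw_same_card)
  next
    case False
    \<comment> \<open>All coordinates in the box are at most 1, so no degree exceeds the number of
      basis vectors.\<close>
    have "f x \<le> real (DIM('v))" if "x \<in> half_open_box \<sigma> I \<sigma>" for x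
    proof -
      have "f x \<le> (\<Sum>u\<in>\<sigma>. 1)"
        unfolding degree_eq_sum_rep[OF \<sigma> f, of x] using that
        by (intro sum_mono) (auto simp: half_open_box_def less_imp_le split: if_splits)
      then show ?thesis
        using card by simp
    qed
    then have "{x \<in> \<Lambda> \<inter> half_open_box \<sigma> I \<sigma>. f x = real b} = {}"
      using False by fastforce
    then show ?thesis
      using False by (simp only: lattice_series_def fps_nth_Abs_fps card.empty of_nat_0 if_False)
  qed
qed

section \<open>Reciprocity and the degree of the series\<close>

text \<open>Stanley's reciprocity, with the substitution of \<open>1/t\<close> expressed by
  reversing coefficients. One triangulation serves both sides: only the facets left out depend on
  the direction, and replacing \<open>v\<close> by \<open>- v\<close> complements them in every
  simplex.\<close>

theorem lattice_series_reciprocity: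
  fixes B :: "'v::euclidean_space set"
  assumes B: "finite B" and f: "linear f" "\<forall>u\<in>B. f u = (1::real)"
    and \<Lambda>: "B \<subseteq> \<Lambda>" "\<forall>x\<in>\<Lambda>. \<forall>y\<in>\<Lambda>. x + y \<in> \<Lambda>" "\<forall>x\<in>\<Lambda>. \<forall>y\<in>\<Lambda>. x - y \<in> \<Lambda>"
    and fin: "\<forall>b::nat. finite {x \<in> \<Lambda> \<inter> convex_cone hull B. f x = real b}"
    and int: "interior (convex_cone hull B) \<noteq> {}"
  shows "((1 - fps_X) ^ DIM('v) * lattice_series \<Lambda> f (convex_cone hull B)) $ b =
    (if b \<le> DIM('v) then ((1 - fps_X) ^ DIM('v) * lattice_series \<Lambda> f (interior (convex_cone hull B))) $ (DIM('v) - b)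
     else 0)"
proof -
  let ?C = "convex_cone hull B" and ?N = "DIM('v)"
  obtain v where v: "v \<in> interior ?C" "off_walls B v"
    using exists_off_walls[OF B open_interior int] by blast
  obtain h where h: "\<forall>\<sigma> w. basis_in B \<sigma> \<longrightarrow> w \<in> B - \<sigma> \<longrightarrow> interpolate h \<sigma> w \<noteq> h w"
    using generic_heights[OF B] by blast
  let ?T = "regular_simplices h B"
  have T: "basis_in B \<sigma>" if "\<sigma> \<in> ?T" for \<sigma>
    using that by (simp add: regular_simplices_def)
  have finT: "finite ?T"
    by (rule finite_subset[of _ "Pow B"]) (use B in \<open>auto simp: regular_simplices_def basis_in_def\<close>)
  have box_sub: "half_open_box \<sigma> I {} \<subseteq> ?C" if "\<sigma> \<in> ?T" for \<sigma> I
    using convex_cone_hull_simplex[OF T[OF that]] half_open_box_nonneg by blast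
  have fin_box: "\<forall>b::nat. finite {x \<in> \<Lambda> \<inter> half_open_box \<sigma> I {}. f x = real b}" if "\<sigma> \<in> ?T" for \<sigma> I
  proof
    fix b show "finite {x \<in> \<Lambda> \<inter> half_open_box \<sigma> I {}. f x = real b}"
      by (rule finite_subset[OF _ spec[OF fin, of b]]) (use box_sub[OF that] in auto)
  qed
  \<comment> \<open>The direction stays variable because \<open>v\<close> yields the cone and
    \<open>- v\<close> its interior.\<close>
  have decomp: "(1 - fps_X) ^ ?N * lattice_series \<Lambda> f S =
      (\<Sum>\<sigma>\<in>?T. lattice_series \<Lambda> f (half_open_box \<sigma> (negative_part w \<sigma>) \<sigma>))"
    if w: "off_walls B w" and S: "\<And>x. x \<in> S \<longleftrightarrow> (\<forall>\<^sub>F \<epsilon> in at_right 0. x + \<epsilon> *\<^sub>R w \<in> ?C)" for w S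
  proof -
    note pd = perturbed_decomposition[OF B f h w]
    have "lattice_series \<Lambda> f S = (\<Sum>\<sigma>\<in>?T. lattice_series \<Lambda> f (half_open_box \<sigma> (negative_part w \<sigma>) {}))"
    proof (rule fps_ext)
      fix b
      have "x \<in> S \<longleftrightarrow> (\<exists>\<sigma>\<in>?T. x \<in> half_open_box \<sigma> (negative_part w \<sigma>) {})" for x
        by (rule trans[OF S pd(1)])
      then have "{x \<in> \<Lambda> \<inter> S. f x = real b} =
          (\<Union>\<sigma>\<in>?T. {x \<in> \<Lambda> \<inter> half_open_box \<sigma> (negative_part w \<sigma>) {}. f x = real b})"
        by blast
      also have "card \<dots> = (\<Sum>\<sigma>\<in>?T. card {x \<in> \<Lambda> \<inter> half_open_box \<sigma> (negative_part w \<sigma>) {}. f x = real b})"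
      proof (intro card_UN_disjoint finT ballI fin_box[rule_format] impI)
        fix \<sigma> \<tau> assume "\<sigma> \<in> ?T" "\<tau> \<in> ?T" "\<sigma> \<noteq> \<tau>"
        from pd(2)[OF this] show "{x \<in> \<Lambda> \<inter> half_open_box \<sigma> (negative_part w \<sigma>) {}. f x = real b} \<inter>
            {x \<in> \<Lambda> \<inter> half_open_box \<tau> (negative_part w \<tau>) {}. f x = real b} = {}"
          by blast
      qed
      finally show "lattice_series \<Lambda> f S $ b =
          (\<Sum>\<sigma>\<in>?T. lattice_series \<Lambda> f (half_open_box \<sigma> (negative_part w \<sigma>) {})) $ b"
        by (simp add: lattice_series_def fps_sum_nth)
    qed
    also have "(1 - fps_X) ^ ?N * \<dots> = (\<Sum>\<sigma>\<in>?T. lattice_series \<Lambda> f (half_open_box \<sigma> (negative_part w \<sigma>) \<sigma>))"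
      unfolding sum_distrib_left
      by (intro sum.cong refl lattice_series_box[OF T f \<Lambda> fin_box, symmetric])
    finally show ?thesis .
  qed
  have neg: "off_walls B (- v)"
    using v(2) by (simp add: off_walls_neg)
  note C = decomp[OF v(2), of ?C, OF perturbed_in_cone_iff(1)[OF B v(1), symmetric]]
  note intC = decomp[OF neg, of "interior ?C", OF perturbed_in_cone_iff(2)[OF B v(1), symmetric]]
  have "lattice_series \<Lambda> f (half_open_box \<sigma> (negative_part v \<sigma>) \<sigma>) $ b =
      (if b \<le> ?N then lattice_series \<Lambda> f (half_open_box \<sigma> (negative_part (- v) \<sigma>) \<sigma>) $ (?N - b) else 0)"
    if "\<sigma> \<in> ?T" for \<sigma>
    unfolding negative_part_neg[OF T[OF that] v(2)]
    by (rule lattice_series_box_reflect[OF T[OF that] f \<Lambda>]) (auto simp: negative_part_def)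
  then show ?thesis
    unfolding C intC by (auto simp: fps_sum_nth intro!: sum.cong)
qed

lemma fps_mult_nth_lowest:
  fixes F G :: "'a::comm_ring_1 fps"
  assumes "\<And>i. i < n \<Longrightarrow> G $ i = 0"
  shows "i < n \<Longrightarrow> (F * G) $ i = 0" and "(F * G) $ n = F $ 0 * G $ n"
proof -
  show "i < n \<Longrightarrow> (F * G) $ i = 0"
    using assms by (auto simp: fps_mult_nth intro!: sum.neutral)
  have "(F * G) $ n = (\<Sum>i=0..n. F $ i * G $ (n - i))"
    by (simp add: fps_mult_nth)
  also have "\<dots> = (\<Sum>i=0..n. if i = 0 then F $ 0 * G $ n else 0)"
    using assms by (intro sum.cong) auto
  finally show "(F * G) $ n = F $ 0 * G $ n"
    by simp
qed

text \<open>The series of the interior begins in degree \<beta>, and so does its numerator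
  \<open>G\<close>. Reversal turns \<open>G\<close> into a polynomial \<open>F\<close> of degree
  \<open>N - \<beta>\<close>, where \<open>N = DIM('v)\<close> is also the degree of the
  denominator; a common factor of the two does not change the difference.\<close>

theorem lattice_series_degree:
  fixes B :: "'v::euclidean_space set"
  assumes B: "finite B" and f: "linear f" "\<forall>u\<in>B. f u = (1::real)"
    and \<Lambda>: "B \<subseteq> \<Lambda>" "\<forall>x\<in>\<Lambda>. \<forall>y\<in>\<Lambda>. x + y \<in> \<Lambda>" "\<forall>x\<in>\<Lambda>. \<forall>y\<in>\<Lambda>. x - y \<in> \<Lambda>"
    and fin: "\<forall>b::nat. finite {x \<in> \<Lambda> \<inter> convex_cone hull B. f x = real b}"
    and \<beta>: "\<exists>x \<in> \<Lambda> \<inter> interior (convex_cone hull B). f x = real \<beta>"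
      "\<forall>b<\<beta>. \<forall>x \<in> \<Lambda> \<inter> interior (convex_cone hull B). f x \<noteq> real b"
  shows "is_rational_degree (lattice_series \<Lambda> f (convex_cone hull B)) (- int \<beta>)"
proof -
  let ?N = "DIM('v)" and ?C = "convex_cone hull B"
  define F where "F = (1 - fps_X) ^ ?N * lattice_series \<Lambda> f ?C"
  define G where "G = (1 - fps_X) ^ ?N * lattice_series \<Lambda> f (interior ?C)"
  \<comment> \<open>The truncation loses nothing: by reciprocity the coefficients of
    \<open>F\<close> beyond \<open>?N\<close> vanish.\<close>
  define p where "p = Poly (map (fps_nth F) [0..<Suc ?N])"
  define q where "q = [:1, -1 :: rat:] ^ ?N"
  have rec: "F $ b = (if b \<le> ?N then G $ (?N - b) else 0)" for b
    unfolding F_def G_def using \<beta>(1) by (intro lattice_series_reciprocity[OF B f \<Lambda> fin]) auto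
  have low: "lattice_series \<Lambda> f (interior ?C) $ b = 0" if "b < \<beta>" for b
  proof -
    have "{x \<in> \<Lambda> \<inter> interior ?C. f x = real b} = {}"
      using \<beta>(2) that by blast
    then show ?thesis
      by (simp only: lattice_series_def fps_nth_Abs_fps card.empty of_nat_0)
  qed
  have "finite {x \<in> \<Lambda> \<inter> interior ?C. f x = real \<beta>}"
    by (rule finite_subset[OF _ spec[OF fin, of \<beta>]]) (use interior_subset in blast)
  then have ne: "lattice_series \<Lambda> f (interior ?C) $ \<beta> \<noteq> 0"
    using \<beta>(1) by (auto simp: lattice_series_def)
  have G0: "G $ b = 0" if "b < \<beta>" for b
    unfolding G_def by (rule fps_mult_nth_lowest(1)[OF low that])
  have G\<beta>: "G $ \<beta> \<noteq> 0"
    unfolding G_def using ne by (subst fps_mult_nth_lowest(2)[OF low]) (auto simp: fps_nth_power_0)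
  \<comment> \<open>Otherwise \<open>G\<close> would vanish up to degree \<open>?N\<close> and its
    reversal \<open>F\<close> would be zero, although the cone has a lattice point of degree
    \<beta>.\<close>
  have "\<beta> \<le> ?N"
  proof (rule ccontr)
    assume "\<not> \<beta> \<le> ?N"
    then have "F $ b = 0" for b
      using rec[of b] G0[of "?N - b"] by simp
    then have "F = 0"
      by (simp add: fps_ext)
    then have "lattice_series \<Lambda> f ?C = 0"
      unfolding F_def using arg_cong[of "1 - fps_X :: rat fps" 0 "\<lambda>F. fps_nth F 0"] by auto
    moreover have "lattice_series \<Lambda> f ?C $ \<beta> \<noteq> 0"
      using \<beta>(1) spec[OF fin, of \<beta>] interior_subset by (auto simp: lattice_series_def)
    ultimately show False
      by simp
  qed
  have coeff: "coeff p b = F $ b" for b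
    using rec[of b] by (simp add: p_def nth_default_def del: upt_Suc)
  have pne: "coeff p (?N - \<beta>) \<noteq> 0"
    using G\<beta> \<open>\<beta> \<le> ?N\<close> by (simp add: coeff rec)
  have "degree p = ?N - \<beta>"
  proof (rule antisym)
    show "degree p \<le> ?N - \<beta>"
    proof (rule degree_le, clarify)
      fix b assume "?N - \<beta> < b"
      then show "coeff p b = 0"
        using G0[of "?N - b"] by (cases "b \<le> ?N") (auto simp: coeff rec)
    qed
  qed (rule le_degree[OF pne])
  moreover have "degree q = ?N"
    by (simp add: q_def degree_power_eq)
  moreover have "fps_of_poly q * lattice_series \<Lambda> f ?C = fps_of_poly p"
  proof -
    have "fps_of_poly [:1, -1 :: rat:] = 1 - fps_X"
      by (simp add: fps_of_poly_pCons fps_eq_iff)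
    then have "fps_of_poly q = (1 - fps_X) ^ ?N"
      by (simp add: q_def fps_of_poly_power)
    moreover have "fps_of_poly p = F"
      by (rule fps_ext) (simp add: coeff)
    ultimately show ?thesis
      by (simp add: F_def)
  qed
  moreover have "p \<noteq> 0" "q \<noteq> 0"
    using pne by (auto simp: q_def)
  ultimately show ?thesis
    unfolding is_rational_degree_def using \<open>\<beta> \<le> ?N\<close>
    by (intro exI[of _ p] exI[of _ q]) auto
qed

section \<open>The cone over a downset\<close>

lemma finite_nvec_le: "finite {\<alpha>::nat ^ 'n. \<alpha> \<le> c}"
proof (rule finite_subset)
  show "{\<alpha>. \<alpha> \<le> c} \<subseteq> vec_lambda ` (\<Pi>\<^sub>E i\<in>UNIV. {..c $ i})"
  proof
    fix \<alpha> assume "\<alpha> \<in> {\<alpha>. \<alpha> \<le> c}"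
    then have "vec_nth \<alpha> \<in> (\<Pi>\<^sub>E i\<in>UNIV. {..c $ i})"
      by (auto simp: less_eq_vec_def)
    then show "\<alpha> \<in> vec_lambda ` (\<Pi>\<^sub>E i\<in>UNIV. {..c $ i})"
      by (metis image_eqI vec_nth_inverse)
  qed
qed (intro finite_imageI finite_PiE, auto)

lemma finite_downset: "finite {\<alpha>::nat ^ 'n. \<exists>j. \<alpha> \<le> column j (A :: nat ^ 'q ^ 'n)}"
proof -
  have "{\<alpha>. \<exists>j. \<alpha> \<le> column j A} = (\<Union>j\<in>UNIV. {\<alpha>. \<alpha> \<le> column j A})"
    by auto
  then show ?thesis
    by (simp add: finite_nvec_le)
qed

lemma real_nvec_add: "real_nvec (a + b) = real_nvec a + real_nvec b"
  by (simp add: real_nvec_def vec_eq_iff)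

lemma real_nvec_zero [simp]: "real_nvec 0 = 0"
  by (simp add: real_nvec_def vec_eq_iff)

lemma real_nvec_mono: "a \<le> b \<Longrightarrow> real_nvec a \<le> real_nvec b"
  by (simp add: real_nvec_def less_eq_vec_def)

lemma real_nvec_nonneg [simp]: "0 \<le> real_nvec a"
  by (simp add: real_nvec_def less_eq_vec_def)

lemma inner_mono_vec:
  fixes x :: "real ^ 'n"
  assumes "0 \<le> x" and "a \<le> b"
  shows "x \<bullet> a \<le> x \<bullet> b"
  using assms unfolding inner_vec_def less_eq_vec_def by (intro sum_mono) (simp add: mult_left_mono)

lemma inner_nonneg_vec:
  fixes x :: "real ^ 'n"
  assumes "0 \<le> x" and "0 \<le> a"
  shows "0 \<le> x \<bullet> a"
  using inner_mono_vec[OF assms] by simp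

section \<open>The packing polytope\<close>

lemma packing_polytope_iff:
  "x \<in> packing_polytope A \<longleftrightarrow> 0 \<le> x \<and> (\<forall>j. x \<bullet> real_nvec (column j A) \<le> 1)"
  by (simp add: packing_polytope_def less_eq_vec_def vector_matrix_mult_def inner_vec_def
      real_nvec_def column_def map_matrix_def mult.commute)

lemma polyhedron_packing_polytope: "polyhedron (packing_polytope A)"
proof -
  have "packing_polytope A = (\<Inter>i. {x. - axis i 1 \<bullet> x \<le> 0}) \<inter>
      (\<Inter>j. {x. real_nvec (column j A) \<bullet> x \<le> 1})"
    by (auto simp: packing_polytope_iff less_eq_vec_def inner_axis' inner_commute[of "real_nvec _"])
  also have "polyhedron \<dots>"
    by (intro polyhedron_Int polyhedron_Inter finite_imageI) (auto intro: polyhedron_halfspace_le polyhedron_halfspace_ge)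
  finally show ?thesis .
qed

lemma zero_in_packing_polytope: "0 \<in> packing_polytope A"
  by (simp add: packing_polytope_iff)

text \<open>A nonzero row \<open>i\<close> has an entry of at least 1, and the constraint of its
  column then bounds \<open>x $ i\<close>. This is how nonzero rows make the polytope
  compact.\<close>

lemma packing_polytope_le_one:
  fixes A :: "nat ^ 'q ^ 'n"
    and x :: "real ^ 'n"
  assumes "\<forall>i. row i A \<noteq> 0" and "x \<in> packing_polytope A"
  shows "x $ i \<le> 1"
proof -
  obtain j where "A $ i $ j \<noteq> 0"
    using assms(1)[rule_format, of i] by (auto simp: row_def vec_eq_iff)
  then have "x $ i * 1 \<le> x $ i * real (A $ i $ j)"
    using assms(2) by (intro mult_left_mono) (auto simp: packing_polytope_iff less_eq_vec_def)
  also have "\<dots> \<le> (\<Sum>k\<in>UNIV. x $ k * real (A $ k $ j))"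
    using assms(2) by (intro member_le_sum) (auto simp: packing_polytope_iff less_eq_vec_def)
  also have "\<dots> = x \<bullet> real_nvec (column j A)"
    by (simp add: inner_vec_def real_nvec_def column_def)
  also have "\<dots> \<le> 1"
    using assms(2) by (simp add: packing_polytope_iff)
  finally show ?thesis
    by simp
qed

lemma compact_packing_polytope:
  fixes A :: "nat ^ 'q ^ 'n"
  assumes "\<forall>i. row i A \<noteq> 0"
  shows "compact (packing_polytope A)"
proof -
  have "packing_polytope A \<subseteq> cbox 0 1"
    using packing_polytope_le_one[OF assms]
    by (auto simp: mem_box_cart packing_polytope_iff less_eq_vec_def)
  then have "bounded (packing_polytope A)"
    using bounded_cbox bounded_subset by blast
  then show ?thesis
    using polyhedron_imp_closed[OF polyhedron_packing_polytope] by (simp add: compact_eq_bounded_closed)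
qed

section \<open>Duality between the lifted cone and the packing polytope\<close>

text \<open>Strict separation gives an affine bound \<beta>, negative because 0 lies in
  \<open>C\<close>; invariance of \<open>C\<close> under scaling turns it into a linear one.\<close>

lemma separate_point_closed_convex_cone:
  fixes C :: "'v::euclidean_space set"
  assumes "convex_cone C" and "closed C" and "z \<notin> C"
  obtains y where "y \<bullet> z < 0" "\<forall>c\<in>C. 0 \<le> y \<bullet> c"
proof -
  obtain y \<beta> where y: "y \<bullet> z < \<beta>" "\<forall>c\<in>C. \<beta> < y \<bullet> c"
    using separating_hyperplane_closed_point[of C z] assms by (auto simp: convex_cone_def)
  have "\<beta> < 0"
    using y(2) convex_cone_contains_0[OF assms(1)] by force
  have "0 \<le> y \<bullet> c" if "c \<in> C" for c
  proof (rule ccontr)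
    assume neg: "\<not> 0 \<le> y \<bullet> c"
    \<comment> \<open>On this multiple of \<open>c\<close> the functional takes exactly the value
      \<beta>, which strict separation excludes.\<close>
    then have "(\<beta> / (y \<bullet> c)) *\<^sub>R c \<in> C"
      using \<open>\<beta> < 0\<close> by (intro convex_cone_scaleR assms that) (simp add: divide_nonpos_neg)
    then have "\<beta> < y \<bullet> (\<beta> / (y \<bullet> c)) *\<^sub>R c"
      using y(2) by blast
    then show False
      using neg by simp
  qed
  moreover have "y \<bullet> z < 0"
    using y(1) \<open>\<beta> < 0\<close> by simp
  ultimately show ?thesis
    using that by blast
qed

lemma finite_lifted_points: "finite W \<Longrightarrow> finite (lifted_points W)"
  by (simp add: lifted_points_def)

text \<open>Antiblocking duality. A functional \<open>(u, \<beta>)\<close> that separates a point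
  from the cone is turned into a point of the polytope: because \<open>W\<close> is closed
  downwards, \<open>u\<close> can be replaced by its negative part, which is then scaled by
  \<open>1 / \<beta>\<close>.\<close>

lemma lifted_cone_iff:
  fixes A :: "nat ^ 'q ^ 'n"
  assumes rows: "\<forall>i. row i A \<noteq> 0" and W: "W = {\<alpha>. \<exists>j. \<alpha> \<le> column j A}"
  shows "(a, b) \<in> convex_cone hull (lifted_points W) \<longleftrightarrow>
    0 \<le> a \<and> (\<forall>x\<in>packing_polytope A. x \<bullet> a \<le> b)"
proof
  let ?D = "{(a, b). 0 \<le> a \<and> (\<forall>x\<in>packing_polytope A. x \<bullet> a \<le> b)}"
  have "convex_cone hull (lifted_points W) \<subseteq> ?D"
  proof (rule hull_minimal)
    show "lifted_points W \<subseteq> ?D"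
    proof (clarsimp simp: lifted_points_def W)
      fix \<alpha> j x assume \<alpha>: "\<alpha> \<le> column j A" and x: "x \<in> packing_polytope A"
      then have "x \<bullet> real_nvec \<alpha> \<le> x \<bullet> real_nvec (column j A)"
        by (intro inner_mono_vec real_nvec_mono) (auto simp: packing_polytope_iff)
      then show "x \<bullet> real_nvec \<alpha> \<le> 1"
        using x unfolding packing_polytope_iff by (meson order_trans)
    qed
    show "convex_cone ?D"
      unfolding convex_cone_iff
      by (auto simp: less_eq_vec_def inner_add_right zero_prod_def intro!: add_mono mult_left_mono)
  qed
  then show "(a, b) \<in> convex_cone hull (lifted_points W) \<Longrightarrow>
      0 \<le> a \<and> (\<forall>x\<in>packing_polytope A. x \<bullet> a \<le> b)"
    by blast
next
  assume ab: "0 \<le> a \<and> (\<forall>x\<in>packing_polytope A. x \<bullet> a \<le> b)"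
  let ?C = "convex_cone hull (lifted_points W)"
  show "(a, b) \<in> ?C"
  proof (rule ccontr)
    assume "(a, b) \<notin> ?C"
    moreover have "closed ?C"
      unfolding W by (intro closed_convex_cone_hull finite_lifted_points finite_downset)
    ultimately obtain y where y: "y \<bullet> (a, b) < 0" "\<forall>c\<in>?C. 0 \<le> y \<bullet> c"
      using separate_point_closed_convex_cone[OF convex_cone_convex_cone_hull] by blast
    obtain u \<beta> where u: "y = (u, \<beta>)"
      by fastforce
    have gen: "0 \<le> u \<bullet> real_nvec w + \<beta>" if "w \<in> W" for w
    proof -
      have "(real_nvec w, 1) \<in> ?C"
        using that by (auto intro: hull_inc simp: lifted_points_def)
      then show ?thesis
        using y(2) u by fastforce
    qed
    define x :: "real ^ 'n" where "x = (\<chi> i. max 0 (- u $ i))"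
    have x0: "0 \<le> x"
      by (simp add: x_def less_eq_vec_def)
    have xv: "x \<bullet> real_nvec (column j A) \<le> \<beta>" for j
    proof -
      \<comment> \<open>Column \<open>j\<close> cut down to the coordinates where \<open>u\<close>
        is negative still lies in \<open>W\<close>, and its product with \<open>u\<close> is, up to
        sign, that of \<open>x\<close> with the whole column.\<close>
      define w :: "nat ^ 'n" where "w = (\<chi> i. if u $ i < 0 then A $ i $ j else 0)"
      have "w \<le> column j A"
        by (simp add: w_def less_eq_vec_def column_def)
      then have "0 \<le> u \<bullet> real_nvec w + \<beta>"
        using gen W by blast
      moreover have "x \<bullet> real_nvec (column j A) = - (u \<bullet> real_nvec w)"
        unfolding inner_vec_def sum_negf[symmetric]
        by (intro sum.cong) (auto simp: x_def w_def real_nvec_def column_def)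
      ultimately show ?thesis
        by simp
    qed
    have "0 \<le> \<beta>"
      using xv[of undefined] inner_nonneg_vec[OF x0 real_nvec_nonneg] by (meson order_trans)
    have "(- u) \<bullet> a \<le> x \<bullet> a"
      using ab by (subst (1 2) inner_commute, intro inner_mono_vec) (auto simp: x_def less_eq_vec_def)
    then have gt: "\<beta> * b < x \<bullet> a"
      using y(1) u by simp
    show False
    proof (cases "\<beta> = 0")
      \<comment> \<open>Scaling by \<open>1 / \<beta>\<close> is impossible here; instead the
        nonzero rows force \<open>x = 0\<close>.\<close>
      case True
      have "x $ i = 0" for i
      proof -
        obtain j where j: "A $ i $ j \<noteq> 0"
          using rows[rule_format, of i] by (auto simp: row_def vec_eq_iff)
        have "x $ i * real (A $ i $ j) \<le> (\<Sum>k\<in>UNIV. x $ k * real (A $ k $ j))"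
          using x0 by (intro member_le_sum) (auto simp: less_eq_vec_def)
        also have "\<dots> \<le> 0"
          using xv[of j] True by (simp add: inner_vec_def real_nvec_def column_def)
        finally show ?thesis
          using j x0 by (auto simp: mult_le_0_iff less_eq_vec_def intro: antisym)
      qed
      then have "x = 0"
        by (simp add: vec_eq_iff)
      then show False
        using gt True by simp
    next
      case False
      then have "0 < \<beta>"
        using \<open>0 \<le> \<beta>\<close> by simp
      then have "(1 / \<beta>) *\<^sub>R x \<in> packing_polytope A"
        using xv x0 by (auto simp: packing_polytope_iff less_eq_vec_def divide_le_eq)
      then have "(1 / \<beta>) *\<^sub>R x \<bullet> a \<le> b"
        using ab by blast
      then show False
        using gt \<open>0 < \<beta>\<close> by (simp add: divide_le_eq mult.commute)
    qed
  qed
qed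

lemma finite_maximal_vertices: "finite (maximal_vertices (packing_polytope A))"
  by (rule finite_subset[OF _ finite_polyhedron_extreme_points[OF polyhedron_packing_polytope]])
    (auto simp: maximal_vertices_def)

lemma le_maximal_vertex:
  assumes "e extreme_point_of packing_polytope A"
  obtains l where "l \<in> maximal_vertices (packing_polytope A)" "e \<le> l"
proof -
  obtain l where "l extreme_point_of packing_polytope A" "e \<le> l"
    "\<forall>l'\<in>{x. x extreme_point_of packing_polytope A}. l \<le> l' \<longrightarrow> l = l'"
    using finite_has_maximal2[OF finite_polyhedron_extreme_points[OF polyhedron_packing_polytope, of A], of e] assms
    by auto
  then show ?thesis
    using that[of l] by (auto simp: maximal_vertices_def)
qed

lemma maximal_vertices_in: "l \<in> maximal_vertices P \<Longrightarrow> l \<in> P"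
  by (simp add: maximal_vertices_def extreme_point_of_def)

lemma maximal_vertices_nonempty:
  fixes A :: "nat ^ 'q ^ 'n"
  assumes "\<forall>i. row i A \<noteq> 0"
  shows "maximal_vertices (packing_polytope A) \<noteq> {}"
proof -
  have "\<exists>x. x extreme_point_of packing_polytope A"
    using extreme_point_exists_convex[OF compact_packing_polytope[OF assms]
        polyhedron_imp_convex[OF polyhedron_packing_polytope]] zero_in_packing_polytope
    by auto
  then show ?thesis
    using le_maximal_vertex by blast
qed

text \<open>The compact polytope is the convex hull of its vertices, and for
  \<open>a \<ge> 0\<close> the bound at a vertex follows from the bound at a maximal vertex above
  it.\<close>

lemma packing_bound_iff_maximal_vertices:
  fixes A :: "nat ^ 'q ^ 'n"
  assumes rows: "\<forall>i. row i A \<noteq> 0" and a: "0 \<le> a"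
  shows "(\<forall>x\<in>packing_polytope A. x \<bullet> a \<le> b) \<longleftrightarrow> (\<forall>l\<in>maximal_vertices (packing_polytope A). l \<bullet> a \<le> b)"
proof (intro iffI ballI)
  fix x assume L: "\<forall>l\<in>maximal_vertices (packing_polytope A). l \<bullet> a \<le> b" and x: "x \<in> packing_polytope A"
  have "packing_polytope A = convex hull {x. x extreme_point_of packing_polytope A}"
    by (intro Krein_Milman_Minkowski compact_packing_polytope rows
        polyhedron_imp_convex polyhedron_packing_polytope)
  also have "\<dots> \<subseteq> {x. a \<bullet> x \<le> b}"
  proof (rule hull_minimal)
    show "{x. x extreme_point_of packing_polytope A} \<subseteq> {x. a \<bullet> x \<le> b}"
    proof clarify
      fix e assume "e extreme_point_of packing_polytope A"
      then obtain l where "l \<in> maximal_vertices (packing_polytope A)" "e \<le> l"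
        using le_maximal_vertex by blast
      then show "a \<bullet> e \<le> b"
        using L inner_mono_vec[OF a, of e l] by (metis inner_commute order_trans)
    qed
  qed (rule convex_halfspace_le)
  finally show "x \<bullet> a \<le> b"
    using x by (auto simp: inner_commute)
qed (auto dest: maximal_vertices_in)

lemma lifted_cone_iff_maximal_vertices:
  fixes A :: "nat ^ 'q ^ 'n"
  assumes "\<forall>i. row i A \<noteq> 0" and "W = {\<alpha>. \<exists>j. \<alpha> \<le> column j A}"
  shows "(a, b) \<in> convex_cone hull (lifted_points W) \<longleftrightarrow>
    0 \<le> a \<and> (\<forall>l\<in>maximal_vertices (packing_polytope A). l \<bullet> a \<le> b)"
  using lifted_cone_iff[OF assms] packing_bound_iff_maximal_vertices[OF assms(1)] by blast

text \<open>An interior point may be moved a little along \<open>(- 1, 0)\<close>, which lowers all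
  coordinates of \<open>a\<close> at once, and along \<open>(0, - 1)\<close>; weak inequalities
  after the move are strict ones before it. Conversely, finitely many strict inequalities define an
  open subset of the cone.\<close>

lemma interior_lifted_cone_iff:
  fixes A :: "nat ^ 'q ^ 'n"
  assumes "\<forall>i. row i A \<noteq> 0" and "W = {\<alpha>. \<exists>j. \<alpha> \<le> column j A}"
  shows "(a, b) \<in> interior (convex_cone hull (lifted_points W)) \<longleftrightarrow>
    (\<forall>i. 0 < a $ i) \<and> (\<forall>l\<in>maximal_vertices (packing_polytope A). l \<bullet> a < b)"
proof
  let ?C = "convex_cone hull (lifted_points W)" and ?L = "maximal_vertices (packing_polytope A)"
  note C = lifted_cone_iff_maximal_vertices[OF assms]
  {
    assume ab: "(a, b) \<in> interior ?C"
    have shift: "\<exists>\<epsilon>>0. (a, b) + \<epsilon> *\<^sub>R w \<in> ?C" for w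
    proof -
      have "((\<lambda>\<epsilon>. (a, b) + \<epsilon> *\<^sub>R w) \<longlongrightarrow> (a, b) + 0 *\<^sub>R w) (at_right 0)"
        by (intro tendsto_intros)
      then have "\<forall>\<^sub>F \<epsilon> in at_right 0. (a, b) + \<epsilon> *\<^sub>R w \<in> interior ?C"
        by (rule topological_tendstoD[OF _ open_interior]) (use ab in simp)
      moreover have "\<forall>\<^sub>F \<epsilon> in at_right 0. (0::real) < \<epsilon>"
        by (simp add: eventually_at_right_less)
      ultimately have "\<forall>\<^sub>F \<epsilon> in at_right 0. 0 < \<epsilon> \<and> (a, b) + \<epsilon> *\<^sub>R w \<in> ?C"
        by eventually_elim (use interior_subset in blast)
      then show ?thesis
        using eventually_happens'[OF trivial_limit_at_right_real] by blast
    qed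
    obtain \<epsilon> where "\<epsilon> > 0" "(a, b) + \<epsilon> *\<^sub>R (- 1, 0) \<in> ?C"
      using shift by blast
    then have "0 < a $ i" for i
      using C[of "a + \<epsilon> *\<^sub>R - 1" b] by (auto simp: less_eq_vec_def dest!: spec[of _ i])
    moreover obtain \<epsilon>' where "\<epsilon>' > 0" "(a, b) + \<epsilon>' *\<^sub>R (0, - 1) \<in> ?C"
      using shift by blast
    then have "l \<bullet> a < b" if "l \<in> ?L" for l
      using C[of a "b - \<epsilon>'"] that by force
    ultimately show "(\<forall>i. 0 < a $ i) \<and> (\<forall>l\<in>?L. l \<bullet> a < b)"
      by blast
  }
  assume ab: "(\<forall>i. 0 < a $ i) \<and> (\<forall>l\<in>?L. l \<bullet> a < b)"
  let ?U = "(\<Inter>i. {z. 0 < fst z $ i}) \<inter> (\<Inter>l\<in>?L. {z. l \<bullet> fst z < snd z}) :: ((real ^ 'n) \<times> real) set"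
  have "open ?U"
    by (intro open_Int open_INT finite finite_maximal_vertices ballI open_Collect_less continuous_intros)
  moreover have "?U \<subseteq> ?C"
    using C by (auto simp: less_eq_vec_def less_imp_le)
  moreover have "(a, b) \<in> ?U"
    using ab by simp
  ultimately show "(a, b) \<in> interior ?C"
    by (meson interiorI)
qed

lemma interior_lifted_cone_nonempty:
  fixes A :: "nat ^ 'q ^ 'n"
  assumes "\<forall>i. row i A \<noteq> 0" and "W = {\<alpha>. \<exists>j. \<alpha> \<le> column j A}"
  shows "interior (convex_cone hull (lifted_points W)) \<noteq> {}"
proof -
  let ?L = "maximal_vertices (packing_polytope A)"
  define b where "b = (\<Sum>l\<in>?L. \<bar>l \<bullet> 1\<bar>) + 1"
  have "l \<bullet> 1 < b" if "l \<in> ?L" for l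
    using member_le_sum[OF that, of "\<lambda>l. \<bar>l \<bullet> 1\<bar>"] finite_maximal_vertices by (force simp: b_def)
  then have "(1, b) \<in> interior (convex_cone hull (lifted_points W))"
    unfolding interior_lifted_cone_iff[OF assms] by simp
  then show ?thesis
    by blast
qed

lemma rel_interior_lifted_cone:
  fixes A :: "nat ^ 'q ^ 'n"
  assumes "\<forall>i. row i A \<noteq> 0" and "W = {\<alpha>. \<exists>j. \<alpha> \<le> column j A}"
  shows "rel_interior (convex_cone hull (lifted_points W)) = interior (convex_cone hull (lifted_points W))"
  by (intro rel_interior_nonempty_interior interior_lifted_cone_nonempty[OF assms])

section \<open>Integer rounding and primitive multipliers\<close>

lemma nat_span_zero: "0 \<in> nat_span B"
  by (auto simp: nat_span_def intro!: exI[of _ "\<lambda>_. 0"])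

lemma nat_span_add_generator:
  assumes "finite B" and "v \<in> B" and "x \<in> nat_span B"
  shows "x + v \<in> nat_span B"
proof -
  obtain c where c: "x = (\<Sum>u\<in>B. real (c u) *\<^sub>R u)"
    using assms(3) by (auto simp: nat_span_def)
  have "x + v = (\<Sum>u\<in>B. real ((c(v := Suc (c v))) u) *\<^sub>R u)"
    unfolding c using assms(1,2) by (simp add: sum.remove[of B v] scaleR_left_distrib)
  then show ?thesis
    unfolding nat_span_def by blast
qed

text \<open>Here \<open>y\<close> is a cover of \<open>a\<close> by at most \<open>b\<close>
  columns. Each step splits off the part of \<open>a\<close> below one of these columns, an element
  of \<open>W\<close> by downward closure; once the columns are used up, \<open>0 \<in> W\<close>
  pads to exactly \<open>b\<close> summands. \<open>P\<close> is arbitrary because the decomposition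
  is needed both for products of monomials and for \<open>nat_span\<close>.\<close>

lemma downset_decomposition:
  fixes A :: "nat ^ 'q ^ 'n" and P :: "nat ^ 'n \<Rightarrow> nat \<Rightarrow> bool"
  assumes W: "W = {\<alpha>. \<exists>j. \<alpha> \<le> column j A}"
    and zero: "P 0 0" and step: "\<And>a b w. P a b \<Longrightarrow> w \<in> W \<Longrightarrow> P (a + w) (Suc b)"
  shows "(\<Sum>j\<in>UNIV. y j) \<le> b \<Longrightarrow> \<forall>i. a $ i \<le> (\<Sum>j\<in>UNIV. A $ i $ j * y j) \<Longrightarrow> P a b"
proof (induction b arbitrary: a y)
  case 0
  then have "a = 0"
    by (simp add: vec_eq_iff)
  then show ?case
    using zero by simp
next
  case (Suc b)
  show ?case
  proof (cases "\<forall>j. y j = 0")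
    case True
    then have "a = 0"
      using Suc.prems(2) by (simp add: vec_eq_iff)
    have "P 0 b"
      by (rule Suc.IH[of "\<lambda>_. 0"]) simp_all
    moreover have "0 \<in> W"
      by (simp add: W less_eq_vec_def)
    ultimately show ?thesis
      using step[of 0 b 0] \<open>a = 0\<close> by simp
  next
    case False
    then obtain j where j: "0 < y j"
      by auto
    \<comment> \<open>The minimum ensures \<open>w \<le> a\<close>, so that
      \<open>a - w + w = a\<close> despite truncated subtraction.\<close>
    define w where "w = (\<chi> i. min (a $ i) (A $ i $ j))"
    define y' where "y' = y(j := y j - 1)"
    have sums: "(\<Sum>k\<in>UNIV. c k * y k) = (\<Sum>k\<in>UNIV. c k * y' k) + c j" for c :: "'q \<Rightarrow> nat"
    proof -
      have "(\<Sum>k\<in>UNIV - {j}. c k * y k) = (\<Sum>k\<in>UNIV - {j}. c k * y' k)"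
        by (intro sum.cong) (auto simp: y'_def)
      moreover have "c j * y j = c j * y' j + c j"
        using j by (cases "y j") (simp_all add: y'_def)
      ultimately show ?thesis
        by (simp add: sum.remove[of UNIV j])
    qed
    have "P (a - w) b"
    proof (rule Suc.IH)
      show "(\<Sum>j\<in>UNIV. y' j) \<le> b"
        using Suc.prems(1) sums[of "\<lambda>_. 1"] by simp
      show "\<forall>i. (a - w) $ i \<le> (\<Sum>j\<in>UNIV. A $ i $ j * y' j)"
      proof
        fix i
        show "(a - w) $ i \<le> (\<Sum>j\<in>UNIV. A $ i $ j * y' j)"
          using Suc.prems(2)[rule_format, of i] sums[of "\<lambda>j. A $ i $ j"] by (simp add: w_def)
      qed
    qed
    moreover have "w \<le> column j A"
      by (simp add: w_def less_eq_vec_def column_def)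
    then have "w \<in> W"
      using W by blast
    moreover have "a - w + w = a"
      by (simp add: vec_eq_iff w_def)
    ultimately show ?thesis
      using step[of "a - w" b w] by simp
  qed
qed

lemma real_zvec_int: "real_zvec (\<chi> i. int (a $ i)) = real_nvec a"
  by (simp add: real_zvec_def real_nvec_def)

lemma inner_matrix_vector:
  fixes A :: "nat ^ 'q ^ 'n"
  shows "x \<bullet> (map_matrix real A *v y) = (x v* map_matrix real A) \<bullet> y"
proof -
  have "x \<bullet> (map_matrix real A *v y) = (\<Sum>i\<in>UNIV. \<Sum>j\<in>UNIV. x $ i * (real (A $ i $ j) * y $ j))"
    by (simp add: inner_vec_def matrix_vector_mult_def map_matrix_def sum_distrib_left)
  also have "\<dots> = (\<Sum>j\<in>UNIV. \<Sum>i\<in>UNIV. x $ i * (real (A $ i $ j) * y $ j))"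
    by (rule sum.swap)
  also have "\<dots> = (x v* map_matrix real A) \<bullet> y"
    by (simp add: inner_vec_def vector_matrix_mult_def map_matrix_def sum_distrib_left sum_distrib_right mult_ac)
  finally show ?thesis .
qed

text \<open>Replacing each generator by a column that dominates it turns conic coefficients of total
  \<open>b\<close> into a fractional cover of \<open>a\<close>.\<close>

lemma lifted_cone_fractional_cover:
  fixes A :: "nat ^ 'q ^ 'n"
  assumes W: "W = {\<alpha>. \<exists>j. \<alpha> \<le> column j A}"
    and ab: "(a, b) \<in> convex_cone hull (lifted_points W)"
  obtains y :: "real ^ 'q" where "0 \<le> y" "a \<le> map_matrix real A *v y" "y \<bullet> 1 = b"
proof -
  have fin: "finite W"
    unfolding W by (rule finite_downset)
  have inj: "inj_on (\<lambda>w. (real_nvec w, 1::real)) W"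
    by (auto simp: inj_on_def real_nvec_def vec_eq_iff)
  obtain c where c: "\<forall>u\<in>lifted_points W. 0 \<le> c u" "(a, b) = (\<Sum>u\<in>lifted_points W. c u *\<^sub>R u)"
    using ab unfolding convex_cone_hull_finite[OF finite_lifted_points[OF fin]] by auto
  define e where "e w = c (real_nvec w, 1)" for w
  have e0: "0 \<le> e w" if "w \<in> W" for w
    using c(1) that by (auto simp: e_def lifted_points_def)
  have "(a, b) = (\<Sum>w\<in>W. e w *\<^sub>R (real_nvec w, 1))"
    unfolding c(2) lifted_points_def sum.reindex[OF inj] by (simp add: e_def)
  then have a: "a = (\<Sum>w\<in>W. e w *\<^sub>R real_nvec w)" and b: "b = (\<Sum>w\<in>W. e w)"
    by (simp_all add: prod_eq_iff fst_sum snd_sum)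
  have "\<forall>w\<in>W. \<exists>j. w \<le> column j A"
    using W by blast
  then obtain j where j: "\<forall>w\<in>W. w \<le> column (j w) A"
    by metis
  define y :: "real ^ 'q" where "y = (\<chi> k. \<Sum>w\<in>W. if j w = k then e w else 0)"
  have sumy: "(\<Sum>k\<in>UNIV. f k * y $ k) = (\<Sum>w\<in>W. f (j w) * e w)" for f
  proof -
    have "(\<Sum>k\<in>UNIV. f k * y $ k) = (\<Sum>k\<in>UNIV. \<Sum>w\<in>W. if j w = k then f k * e w else 0)"
      by (simp add: y_def sum_distrib_left if_distrib[of "\<lambda>r. _ * r"] cong: if_cong)
    also have "\<dots> = (\<Sum>w\<in>W. \<Sum>k\<in>UNIV. if j w = k then f k * e w else 0)"
      by (rule sum.swap)
    finally show ?thesis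
      by simp
  qed
  show ?thesis
  proof
    show "0 \<le> y"
      by (auto simp: y_def less_eq_vec_def e0 intro!: sum_nonneg)
    show "y \<bullet> 1 = b"
      using sumy[of "\<lambda>_. 1"] by (simp add: inner_vec_def b)
    have "a $ i \<le> (\<Sum>k\<in>UNIV. real (A $ i $ k) * y $ k)" for i
      unfolding sumy a
      using j e0 by (auto simp: real_nvec_def less_eq_vec_def column_def mult.commute intro!: sum_mono mult_left_mono)
    then show "a \<le> map_matrix real A *v y"
      by (simp add: less_eq_vec_def matrix_vector_mult_def map_matrix_def)
  qed
qed

text \<open>The maximum \<open>m\<close> of \<open>x \<bullet> real_nvec a\<close> over the polytope
  is the optimum of the fractional covering problem: \<open>(real_nvec a, m)\<close> lies in the
  cone and so yields a cover of value \<open>m\<close>. Integer rounding then gives an integral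
  cover of size \<open>\<lceil>m\<rceil>\<close>, which is at most the integer
  \<open>b\<close>.\<close>

lemma lifted_cone_lattice_induct:
  fixes A :: "nat ^ 'q ^ 'n" and P :: "nat ^ 'n \<Rightarrow> nat \<Rightarrow> bool"
  assumes rows: "\<forall>i. row i A \<noteq> 0" and W: "W = {\<alpha>. \<exists>j. \<alpha> \<le> column j A}"
    and rounding: "integer_rounding A"
    and ab: "(real_nvec a, real b) \<in> convex_cone hull (lifted_points W)"
    and zero: "P 0 0" and step: "\<And>a b w. P a b \<Longrightarrow> w \<in> W \<Longrightarrow> P (a + w) (Suc b)"
  shows "P a b"
proof -
  obtain x where x: "x \<in> packing_polytope A" "\<forall>x'\<in>packing_polytope A. x' \<bullet> real_nvec a \<le> x \<bullet> real_nvec a"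
    using continuous_attains_sup[OF compact_packing_polytope[OF rows], of "\<lambda>x. x \<bullet> real_nvec a"]
      zero_in_packing_polytope by (fastforce intro: continuous_intros)
  define m where "m = x \<bullet> real_nvec a"
  have "m \<le> real b"
    using ab x(1) unfolding lifted_cone_iff[OF rows W] by (auto simp: m_def)
  have "(real_nvec a, m) \<in> convex_cone hull (lifted_points W)"
    using x(2) unfolding lifted_cone_iff[OF rows W] by (auto simp: m_def)
  then obtain y0 where y0: "0 \<le> y0" "real_nvec a \<le> map_matrix real A *v y0" "y0 \<bullet> 1 = m"
    using lifted_cone_fractional_cover[OF W] by blast
  \<comment> \<open>Weak duality, with the maximiser \<open>x\<close> as dual solution.\<close>
  have lower: "m \<le> y \<bullet> 1" if "0 \<le> y" "real_nvec a \<le> map_matrix real A *v y" for y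
  proof -
    have "m \<le> x \<bullet> (map_matrix real A *v y)"
      unfolding m_def using x(1) that(2) by (intro inner_mono_vec) (auto simp: packing_polytope_def)
    also have "\<dots> = y \<bullet> (x v* map_matrix real A)"
      unfolding inner_matrix_vector by (rule inner_commute)
    also have "\<dots> \<le> y \<bullet> 1"
      using x(1) that(1) by (intro inner_mono_vec) (auto simp: packing_polytope_def)
    finally show ?thesis .
  qed
  let ?z = "\<chi> i. int (a $ i)"
  have "is_minimum {y \<bullet> 1 | y :: real ^ 'q. 0 \<le> y \<and> real_zvec ?z \<le> map_matrix real A *v y} m"
    unfolding is_minimum_def real_zvec_int using y0 lower by blast
  then have "is_minimum {real_nvec y \<bullet> 1 | y :: nat ^ 'q. real_zvec ?z \<le> map_matrix real A *v real_nvec y}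
      (real_of_int \<lceil>m\<rceil>)"
    using rounding unfolding integer_rounding_def by blast
  then obtain y :: "nat ^ 'q" where y: "real_nvec y \<bullet> 1 = real_of_int \<lceil>m\<rceil>"
      "real_nvec a \<le> map_matrix real A *v real_nvec y"
    unfolding is_minimum_def real_zvec_int by auto
  have "real (\<Sum>j\<in>UNIV. y $ j) = real_of_int \<lceil>m\<rceil>"
    using y(1) by (simp add: inner_vec_def real_nvec_def)
  also have "\<dots> \<le> real b"
    using \<open>m \<le> real b\<close> by (metis ceiling_le_iff of_int_le_iff of_int_of_nat_eq)
  finally have "(\<Sum>j\<in>UNIV. y $ j) \<le> b"
    by (simp only: of_nat_le_iff)
  moreover have "a $ i \<le> (\<Sum>j\<in>UNIV. A $ i $ j * y $ j)" for i
  proof -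
    have "real (a $ i) \<le> real (\<Sum>j\<in>UNIV. A $ i $ j * y $ j)"
      using y(2) by (simp add: less_eq_vec_def real_nvec_def matrix_vector_mult_def map_matrix_def)
    then show ?thesis
      by (simp only: of_nat_le_iff)
  qed
  ultimately show ?thesis
    using downset_decomposition[OF W, of P "vec_nth y" b a] zero step by blast
qed

text \<open>
  Simultaneous approximation of \<open>l\<close> by fractions \<open>p / q\<close> with small error \<open>q l - p\<close> preserves every
  integral equation that is tight at \<open>l\<close>, so \<open>l\<close> can be moved in both directions along \<open>q l - p\<close>.
\<close>

lemma extreme_point_rational:
  fixes A :: "nat ^ 'q ^ 'n"
  assumes l: "l extreme_point_of packing_polytope A"
  obtains q :: int and p :: "int ^ 'n" where "0 < q" "real_zvec p = real_of_int q *\<^sub>R l"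
proof -
  obtain k :: "'n \<Rightarrow> nat" where k: "bij_betw k UNIV {0..<CARD('n)}"
    using ex_bij_betw_finite_nat[OF finite[of "UNIV :: 'n set"]] by blast
  \<comment> \<open>\<open>N\<close> exceeds every column sum, so errors below \<open>1 / N\<close>
    in all coordinates change the product with a column by less than 1.\<close>
  define N where "N = Suc (\<Sum>i\<in>UNIV. \<Sum>j\<in>UNIV. A $ i $ j)"
  obtain q p where q: "0 < q" and p: "\<And>i. i < CARD('n) \<Longrightarrow>
      \<bar>real_of_int q * l $ (inv k i) - real_of_int (p i)\<bar> < 1 / real N"
    using Dirichlet_approx_simult[of N "CARD('n)" "\<lambda>i. l $ (inv k i)"] unfolding N_def by (metis zero_less_Suc)
  define p' :: "int ^ 'n" where "p' = (\<chi> i. p (k i))"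
  define e where "e = real_of_int q *\<^sub>R l - real_zvec p'"
  have eN: "\<bar>e $ i\<bar> < 1 / real N" for i
  proof -
    have "k i < CARD('n)" "inv k (k i) = i"
      using k by (auto simp: bij_betw_def)
    then show ?thesis
      using p[of "k i"] by (simp add: e_def p'_def real_zvec_def)
  qed
  have "1 \<le> N"
    by (simp add: N_def)
  then have N1: "1 \<le> real N"
    by simp
  have zero: "e $ i = 0" if "l $ i = 0" for i
  proof -
    have "\<bar>e $ i\<bar> < 1"
      using eN[of i] by (rule less_le_trans) (use N1 in \<open>simp add: divide_le_eq\<close>)
    moreover have "e $ i = real_of_int (- (p' $ i))"
      using that by (simp add: e_def real_zvec_def)
    ultimately have "p' $ i = 0"
      by linarith
    then show ?thesis
      using that by (simp add: e_def real_zvec_def)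
  qed
  \<comment> \<open>At a tight column the product with the error is an integer of absolute value
    below 1.\<close>
  have tight: "e \<bullet> real_nvec (column j A) = 0" if "l \<bullet> real_nvec (column j A) = 1" for j
  proof -
    have eq: "e \<bullet> real_nvec (column j A) = real_of_int (q - (\<Sum>i\<in>UNIV. p' $ i * int (A $ i $ j)))"
      using that by (simp add: e_def inner_diff_left)
        (simp add: inner_vec_def real_zvec_def real_nvec_def column_def)
    have "\<bar>e \<bullet> real_nvec (column j A)\<bar> \<le> (\<Sum>i\<in>UNIV. \<bar>e $ i\<bar> * real (A $ i $ j))"
      unfolding inner_vec_def by (rule order_trans[OF sum_abs]) (simp add: real_nvec_def column_def abs_mult)
    also have "\<dots> \<le> (\<Sum>i\<in>UNIV. 1 / real N * real (A $ i $ j))"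
      using eN by (intro sum_mono mult_right_mono) (auto simp: less_imp_le)
    also have "\<dots> = real (\<Sum>i\<in>UNIV. A $ i $ j) / real N"
      by (simp add: sum_divide_distrib)
    also have "\<dots> < 1"
    proof -
      have "(\<Sum>i\<in>UNIV. A $ i $ j) \<le> (\<Sum>i\<in>UNIV. \<Sum>j\<in>UNIV. A $ i $ j)"
        by (intro sum_mono member_le_sum) auto
      then have "real (\<Sum>i\<in>UNIV. A $ i $ j) < real N"
        unfolding of_nat_less_iff N_def by simp
      then show ?thesis
        using N1 by (simp add: divide_less_eq)
    qed
    finally show ?thesis
      unfolding eq of_int_abs[symmetric] of_int_less_1_iff of_int_eq_0_iff by simp
  qed
  have lP: "l \<in> packing_polytope A"
    using l by (simp add: extreme_point_of_def)
  \<comment> \<open>Tight constraints stay tight along \<open>f\<close>, and the finitely many slack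
    ones survive a small step.\<close>
  have move: "\<forall>\<^sub>F \<epsilon> in at_right (0::real). l + \<epsilon> *\<^sub>R f \<in> packing_polytope A"
    if f: "\<And>i. l $ i = 0 \<Longrightarrow> f $ i = 0"
      "\<And>j. l \<bullet> real_nvec (column j A) = 1 \<Longrightarrow> f \<bullet> real_nvec (column j A) = 0" for f
  proof -
    have "\<forall>\<^sub>F \<epsilon> in at_right (0::real). 0 \<le> l $ i + \<epsilon> * f $ i" for i
    proof (cases "l $ i = 0")
      case False
      have "((\<lambda>\<epsilon>. l $ i + \<epsilon> * f $ i) \<longlongrightarrow> l $ i + 0 * f $ i) (at_right 0)"
        by (intro tendsto_intros)
      moreover have "0 < l $ i + 0 * f $ i"
        using False lP by (simp add: packing_polytope_iff less_eq_vec_def less_le)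
      ultimately have "\<forall>\<^sub>F \<epsilon> in at_right (0::real). 0 < l $ i + \<epsilon> * f $ i"
        by (rule order_tendstoD)
      then show ?thesis
        by eventually_elim simp
    qed (simp add: f)
    moreover have "\<forall>\<^sub>F \<epsilon> in at_right (0::real). l \<bullet> real_nvec (column j A) + \<epsilon> * (f \<bullet> real_nvec (column j A)) \<le> 1" for j
    proof (cases "l \<bullet> real_nvec (column j A) = 1")
      case False
      have "((\<lambda>\<epsilon>. l \<bullet> real_nvec (column j A) + \<epsilon> * (f \<bullet> real_nvec (column j A))) \<longlongrightarrow>
          l \<bullet> real_nvec (column j A) + 0 * (f \<bullet> real_nvec (column j A))) (at_right 0)"
        by (intro tendsto_intros)
      moreover have "l \<bullet> real_nvec (column j A) + 0 * (f \<bullet> real_nvec (column j A)) < 1"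
        using False lP by (simp add: packing_polytope_iff less_le)
      ultimately have "\<forall>\<^sub>F \<epsilon> in at_right (0::real).
          l \<bullet> real_nvec (column j A) + \<epsilon> * (f \<bullet> real_nvec (column j A)) < 1"
        by (rule order_tendstoD)
      then show ?thesis
        by eventually_elim simp
    qed (simp add: f)
    ultimately have "\<forall>\<^sub>F \<epsilon> in at_right (0::real). (\<forall>i. 0 \<le> l $ i + \<epsilon> * f $ i) \<and>
        (\<forall>j. l \<bullet> real_nvec (column j A) + \<epsilon> * (f \<bullet> real_nvec (column j A)) \<le> 1)"
      by (intro eventually_conj eventually_all_finite) auto
    then show ?thesis
      by eventually_elim (simp add: packing_polytope_iff less_eq_vec_def inner_add_left)
  qed
  have "\<forall>\<^sub>F \<epsilon> in at_right (0::real). 0 < \<epsilon> \<and> l + \<epsilon> *\<^sub>R e \<in> packing_polytope A \<and> l + \<epsilon> *\<^sub>R - e \<in> packing_polytope A"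
    using zero tight by (intro eventually_conj move) (auto simp: eventually_at_right_less)
  then obtain \<epsilon> where \<epsilon>: "0 < \<epsilon>" "l + \<epsilon> *\<^sub>R e \<in> packing_polytope A" "l + \<epsilon> *\<^sub>R - e \<in> packing_polytope A"
    using eventually_happens'[OF trivial_limit_at_right_real] by blast
  have "e = 0"
  proof (rule ccontr)
    assume "e \<noteq> 0"
    let ?x = "l + \<epsilon> *\<^sub>R e" and ?y = "l + \<epsilon> *\<^sub>R - e"
    have "midpoint ?x ?y = l"
      by (simp add: midpoint_def algebra_simps flip: scaleR_2)
    moreover have "?x \<noteq> ?y"
    proof
      assume "?x = ?y"
      then have "(2 * \<epsilon>) *\<^sub>R e = 0"
        by (simp add: algebra_simps flip: scaleR_2)
      then show False
        using \<epsilon>(1) \<open>e \<noteq> 0\<close> by simp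
    qed
    ultimately have "l \<in> open_segment ?x ?y"
      using midpoint_in_open_segment[of ?x ?y] by simp
    then show False
      using l \<epsilon> by (auto simp: extreme_point_of_def)
  qed
  then have "real_zvec p' = real_of_int q *\<^sub>R l"
    by (simp add: e_def)
  then show ?thesis
    using that q by blast
qed

text \<open>The least positive \<open>d\<close> with \<open>d l\<close> integral works: dividing by
  a nontrivial gcd would give a smaller one.\<close>

lemma is_primitive_multiplier_ex:
  fixes l :: "real ^ 'n"
  assumes "0 < q" and "real_zvec p = real_of_int q *\<^sub>R l"
  shows "\<exists>d. is_primitive_multiplier l d"
proof -
  define Q where "Q d \<longleftrightarrow> 0 < d \<and> (\<exists>z. real_zvec z = - (real d *\<^sub>R l))" for d :: nat
  have "real_zvec (- p) = - (real (nat q) *\<^sub>R l)"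
    using assms by (simp add: real_zvec_def vec_eq_iff)
  then have "Q (nat q)"
    using assms(1) unfolding Q_def by auto
  then obtain d where d: "Q d" "\<And>d'. Q d' \<Longrightarrow> d \<le> d'"
    using ex_has_least_nat[of Q "nat q" id] by auto
  then obtain z where z: "real_zvec z = - (real d *\<^sub>R l)" "0 < d"
    by (auto simp: Q_def)
  define G where "G = Gcd ((range (($) z) \<union> {int d}) - {0})"
  have dvd: "G dvd int d"
    using z(2) unfolding G_def by (auto intro!: Gcd_dvd)
  have dvdz: "G dvd z $ i" for i
    unfolding G_def by (cases "z $ i = 0") (auto intro!: Gcd_dvd)
  have "0 \<le> G" "G \<noteq> 0"
    using dvd z(2) by (auto simp: G_def)
  define z' where "z' = (\<chi> i. z $ i div G)"
  have zi: "real_of_int (z $ i) = - (real d * l $ i)" for i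
    using arg_cong[OF z(1), of "\<lambda>v. v $ i"] by (simp add: real_zvec_def)
  have "real_of_int (z $ i div G) = - (real (nat (int d div G)) * l $ i)" for i
  proof -
    have "real_of_int (z $ i div G) = real_of_int (z $ i) / real_of_int G"
      using dvdz by (simp add: real_of_int_div)
    moreover have "real (nat (int d div G)) = real d / real_of_int G"
    proof -
      have "0 \<le> int d div G"
        using \<open>0 \<le> G\<close> by (simp add: div_int_pos_iff)
      then have "real (nat (int d div G)) = real_of_int (int d div G)"
        by simp
      then show ?thesis
        using dvd by (simp add: real_of_int_div)
    qed
    ultimately show ?thesis
      by (simp add: zi)
  qed
  then have "real_zvec z' = - (real (nat (int d div G)) *\<^sub>R l)"
    by (simp add: z'_def real_zvec_def vec_eq_iff)
  moreover have "0 < int d div G"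
    using dvd z(2) \<open>0 \<le> G\<close> \<open>G \<noteq> 0\<close> by (simp add: zdvd_imp_le pos_imp_zdiv_pos_iff)
  ultimately have "Q (nat (int d div G))"
    unfolding Q_def by auto
  from d(2)[OF this] have "int d \<le> int d div G"
    using \<open>0 < int d div G\<close> by linarith
  then have "G = 1"
    using int_div_less_self[of "int d" G] z(2) \<open>0 \<le> G\<close> \<open>G \<noteq> 0\<close> by force
  then show ?thesis
    using z unfolding G_def is_primitive_multiplier_def
    by (intro exI[of _ "int d"] conjI exI[of _ z]) auto
qed

lemma primitive_multiplier_vertex:
  assumes "l \<in> maximal_vertices (packing_polytope A)"
  shows "0 < primitive_multiplier l"
    and "\<exists>z. real_zvec z = - (real_of_int (primitive_multiplier l) *\<^sub>R l)"
proof -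
  obtain q p where "0 < q" "real_zvec p = real_of_int q *\<^sub>R l"
    using extreme_point_rational[of l A] assms by (auto simp: maximal_vertices_def)
  then obtain d where "is_primitive_multiplier l d"
    using is_primitive_multiplier_ex by blast
  then have "is_primitive_multiplier l (primitive_multiplier l)"
    unfolding primitive_multiplier_def by (rule theI) (rule is_primitive_multiplier_unique[OF _ \<open>is_primitive_multiplier l d\<close>])
  then show "0 < primitive_multiplier l"
    and "\<exists>z. real_zvec z = - (real_of_int (primitive_multiplier l) *\<^sub>R l)"
    by (auto simp: is_primitive_multiplier_def)
qed

text \<open>Since \<open>d l\<close> and the lattice point are integral, \<open>> 0\<close> amounts to \<open>\<ge> 1\<close>.\<close>

lemma primitive_multiplier_inner_ge_one_iff:
  fixes a :: "nat ^ 'n"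
  assumes "l \<in> maximal_vertices (packing_polytope A)"
  shows "1 \<le> real_of_int (primitive_multiplier l) * (real b - l \<bullet> real_nvec a) \<longleftrightarrow> l \<bullet> real_nvec a < real b"
proof -
  let ?d = "primitive_multiplier l"
  obtain z where z: "real_zvec z = - (real_of_int ?d *\<^sub>R l)"
    using primitive_multiplier_vertex(2)[OF assms] by blast
  have "real_of_int ?d * (l \<bullet> real_nvec a) = - (real_zvec z \<bullet> real_nvec a)"
    by (simp add: z)
  also have "\<dots> = real_of_int (- (\<Sum>i\<in>UNIV. z $ i * int (a $ i)))"
    by (simp add: inner_vec_def real_zvec_def real_nvec_def)
  finally have "real_of_int ?d * (real b - l \<bullet> real_nvec a) =
      real_of_int (?d * int b + (\<Sum>i\<in>UNIV. z $ i * int (a $ i)))" (is "_ = real_of_int ?k")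
    by (simp add: algebra_simps)
  moreover have "1 \<le> real_of_int ?k \<longleftrightarrow> 0 < real_of_int ?k"
    unfolding of_int_1_le_iff of_int_0_less_iff by linarith
  ultimately have "1 \<le> real_of_int ?d * (real b - l \<bullet> real_nvec a) \<longleftrightarrow>
      0 < real_of_int ?d * (real b - l \<bullet> real_nvec a)"
    by (simp only:)
  then show ?thesis
    using primitive_multiplier_vertex(1)[OF assms] by (simp add: zero_less_mult_iff)
qed

section \<open>Normality of monomial algebras\<close>

definition lead_exp :: "('m::linorder \<Rightarrow>\<^sub>0 'a::zero) \<Rightarrow> 'm"
  where "lead_exp f = Max (Poly_Mapping.keys f)"

lemma lead_exp_in_keys: "f \<noteq> 0 \<Longrightarrow> lead_exp f \<in> Poly_Mapping.keys f"
  unfolding lead_exp_def by (intro Max_in) auto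

lemma keys_le_lead_exp: "m \<in> Poly_Mapping.keys f \<Longrightarrow> m \<le> lead_exp f"
  unfolding lead_exp_def by (intro Max_ge) auto

lemma lead_exp_eqI:
  "m \<in> Poly_Mapping.keys f \<Longrightarrow> (\<And>k. k \<in> Poly_Mapping.keys f \<Longrightarrow> k \<le> m) \<Longrightarrow> lead_exp f = m"
  unfolding lead_exp_def by (intro Max_eqI) auto

lemma keys_single_subset: "Poly_Mapping.keys (Poly_Mapping.single m c) \<subseteq> {m}"
  by (simp add: keys_single)

text \<open>Split off both leading terms: every product that involves a remainder has only exponents
  strictly below the sum of the leading ones.\<close>

lemma lookup_mult_lead_exp:
  fixes f g :: "'m::{ordered_cancel_comm_monoid_add,linorder} \<Rightarrow>\<^sub>0 'k::field"
  shows "Poly_Mapping.lookup (f * g) (lead_exp f + lead_exp g) =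
    Poly_Mapping.lookup f (lead_exp f) * Poly_Mapping.lookup g (lead_exp g)"
proof -
  let ?a = "lead_exp f" and ?b = "lead_exp g"
  let ?F = "Poly_Mapping.single ?a (Poly_Mapping.lookup f ?a)"
  let ?G = "Poly_Mapping.single ?b (Poly_Mapping.lookup g ?b)"
  have small: "m < lead_exp h" if "m \<in> Poly_Mapping.keys (h - Poly_Mapping.single (lead_exp h) (Poly_Mapping.lookup h (lead_exp h)))"
    for m and h :: "'m \<Rightarrow>\<^sub>0 'k"
  proof -
    have "m \<noteq> lead_exp h"
      using that by (auto simp: in_keys_iff lookup_minus)
    moreover from this have "m \<in> Poly_Mapping.keys h"
      using that by (auto simp: in_keys_iff lookup_minus lookup_single_not_eq)
    ultimately show ?thesis
      using keys_le_lead_exp[of m h] by simp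
  qed
  have zero: "Poly_Mapping.lookup (p * q) (?a + ?b) = 0"
    if "\<And>m n. m \<in> Poly_Mapping.keys p \<Longrightarrow> n \<in> Poly_Mapping.keys q \<Longrightarrow> m + n < ?a + ?b" for p q :: "'m \<Rightarrow>\<^sub>0 'k"
  proof (rule ccontr)
    assume "Poly_Mapping.lookup (p * q) (?a + ?b) \<noteq> 0"
    then have "?a + ?b \<in> Poly_Mapping.keys (p * q)"
      by (simp add: in_keys_iff)
    then show False
      using keys_mult[of p q] that by fastforce
  qed
  have "f * g = ?F * ?G + (f - ?F) * g + ?F * (g - ?G)"
    by (simp add: algebra_simps)
  moreover have "Poly_Mapping.lookup ((f - ?F) * g) (?a + ?b) = 0"
    using small keys_le_lead_exp by (intro zero add_less_le_mono)
  moreover have "Poly_Mapping.lookup (?F * (g - ?G)) (?a + ?b) = 0"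
    using small[of _ g] keys_single_subset[of ?a] by (intro zero) (auto intro: add_strict_left_mono)
  ultimately show ?thesis
    by (simp add: lookup_add mult_single)
qed

lemma lead_exp_mult:
  fixes f g :: "'m::{ordered_cancel_comm_monoid_add,linorder} \<Rightarrow>\<^sub>0 'k::field"
  assumes "f \<noteq> 0" and "g \<noteq> 0"
  shows "lead_exp (f * g) = lead_exp f + lead_exp g"
proof (rule lead_exp_eqI)
  show "lead_exp f + lead_exp g \<in> Poly_Mapping.keys (f * g)"
    using assms[THEN lead_exp_in_keys] by (simp add: in_keys_iff lookup_mult_lead_exp)
  fix k assume "k \<in> Poly_Mapping.keys (f * g)"
  then obtain a b where "k = a + b" "a \<in> Poly_Mapping.keys f" "b \<in> Poly_Mapping.keys g"
    using keys_mult[of f g] by blast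
  then show "k \<le> lead_exp f + lead_exp g"
    by (simp add: add_mono keys_le_lead_exp)
qed

text \<open>The \<open>k\<close>-fold multiple of an exponent is written as iterated addition
  because \<open>'m\<close> is only an ordered monoid.\<close>

lemma lead_exp_power:
  fixes f :: "'m::{ordered_cancel_comm_monoid_add,linorder} \<Rightarrow>\<^sub>0 'k::field"
  assumes "f \<noteq> 0"
  shows "lead_exp (f ^ k) = ((+) (lead_exp f) ^^ k) 0"
proof (induction k)
  case 0
  show ?case
    by (rule lead_exp_eqI) auto
next
  case (Suc k)
  then show ?case
    using assms by (simp add: lead_exp_mult)
qed

section \<open>Subalgebras given by a set of exponents\<close>

definition supported_in :: "'m set \<Rightarrow> ('m \<Rightarrow>\<^sub>0 'k::zero) set"
  where "supported_in M = {f. Poly_Mapping.keys f \<subseteq> M}"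

lemma is_subalgebra_supported_in:
  fixes M :: "'m::comm_monoid_add set"
  assumes "0 \<in> M" and "\<forall>a\<in>M. \<forall>b\<in>M. a + b \<in> M"
  shows "is_subalgebra (supported_in M :: ('m \<Rightarrow>\<^sub>0 'k::field) set)"
proof -
  have mult: "f * g \<in> supported_in M" if "f \<in> supported_in M" "g \<in> supported_in M" for f g :: "'m \<Rightarrow>\<^sub>0 'k"
    using that assms(2) keys_mult[of f g] by (fastforce simp: supported_in_def)
  moreover have "Poly_Mapping.single 0 c \<in> supported_in M" for c :: 'k
    using keys_single_subset[of 0 c] assms(1) by (auto simp: supported_in_def)
  moreover have "f + g \<in> supported_in M" if "f \<in> supported_in M" "g \<in> supported_in M" for f g :: "'m \<Rightarrow>\<^sub>0 'k"
    using that keys_add[of f g] by (fastforce simp: supported_in_def)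
  moreover have "(1 :: 'm \<Rightarrow>\<^sub>0 'k) \<in> supported_in M"
    using assms(1) by (simp add: supported_in_def)
  ultimately show ?thesis
    unfolding is_subalgebra_def scalar_mult_def by blast
qed

lemma is_subalgebra_zero: "is_subalgebra S \<Longrightarrow> 0 \<in> S"
  unfolding is_subalgebra_def scalar_mult_def by (metis mult_zero_left single_zero)

lemma is_subalgebra_neg:
  assumes "is_subalgebra S" and "f \<in> S"
  shows "- f \<in> S"
proof -
  have "scalar_mult (- 1) f = - f"
    by (simp add: scalar_mult_def single_uminus)
  then show ?thesis
    using assms unfolding is_subalgebra_def by metis
qed

lemma is_subalgebra_sum:
  assumes "is_subalgebra S" and "\<And>i. i \<in> I \<Longrightarrow> f i \<in> S"
  shows "(\<Sum>i\<in>I. f i) \<in> S"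
  using assms(2) is_subalgebra_zero[OF assms(1)] assms(1)
  by (induction I rule: infinite_finite_induct) (auto simp: is_subalgebra_def)

lemma is_subalgebra_power:
  assumes "is_subalgebra S" and "f \<in> S"
  shows "f ^ k \<in> S"
  using assms by (induction k) (auto simp: is_subalgebra_def)

lemma is_subalgebra_of_nat:
  assumes "is_subalgebra S"
  shows "of_nat k \<in> S"
  using assms is_subalgebra_zero[OF assms] by (induction k) (auto simp: is_subalgebra_def)

lemma is_subalgebra_generated: "is_subalgebra (generated_subalgebra G)"
  unfolding generated_subalgebra_def by (rule hull_in) (simp add: is_subalgebra_def)

lemma to_fract_power: "to_fract (x ^ k) = to_fract x ^ k"
  by (induction k) simp_all

lemma to_fract_sum: "to_fract (\<Sum>i\<in>I. f i) = (\<Sum>i\<in>I. to_fract (f i))"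
  by (induction I rule: infinite_finite_induct) simp_all

lemma to_fract_of_nat: "to_fract (of_nat k) = of_nat k"
  by (induction k) simp_all

section \<open>Almost integral elements and division by leading monomials\<close>

text \<open>One denominator \<open>c\<close> serves all powers of \<open>z\<close>. For
  \<open>z = f / g\<close> each condition clears to \<open>h * g ^ k = c * f ^ k\<close>, an
  equality of products that passes to leading exponents.\<close>

definition almost_integral :: "'a::idom set \<Rightarrow> 'a fract \<Rightarrow> bool"
  where "almost_integral S z \<longleftrightarrow> (\<exists>c\<in>S. c \<noteq> 0 \<and> (\<forall>k. \<exists>h\<in>S. to_fract h = to_fract c * z ^ k))"

text \<open>For a monic equation of degree \<open>N\<close> the denominator \<open>g ^ N\<close>
  works: it clears the powers below \<open>N\<close>, and the equation reduces higher powers to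
  lower ones.\<close>

lemma integral_imp_almost_integral:
  fixes S :: "('m::{ordered_cancel_comm_monoid_add,linorder} \<Rightarrow>\<^sub>0 'k::field) set"
  assumes S: "is_subalgebra S" and fg: "f \<in> S" "g \<in> S" "g \<noteq> 0"
    and int: "integral_over (to_fract ` S) (Fract f g)"
  shows "almost_integral S (Fract f g)"
proof -
  let ?z = "Fract f g"
  have mult: "x * y \<in> S" if "x \<in> S" "y \<in> S" for x y
    using S that by (simp add: is_subalgebra_def)
  obtain p where p: "lead_coeff p = 1" "\<forall>i. coeff p i \<in> to_fract ` S" "poly p ?z = 0"
    using int unfolding integral_over_def by blast
  define N where "N = degree p"
  have "\<forall>i. \<exists>s. s \<in> S \<and> coeff p i = to_fract s"
    using p(2) by blast
  from choice[OF this] obtain s where s: "\<And>i. s i \<in> S" "\<And>i. coeff p i = to_fract (s i)"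
    by blast
  have "(\<Sum>i<N. coeff p i * ?z ^ i) + ?z ^ N = 0"
    using p(1,3) by (simp add: poly_altdef N_def lessThan_Suc_atMost[symmetric] del: lessThan_Suc_atMost)
  then have zN: "?z ^ N = - (\<Sum>i<N. to_fract (s i) * ?z ^ i)"
    by (simp only: s(2) eq_neg_iff_add_eq_0 add.commute)
  have gz: "to_fract g * ?z = to_fract f"
    using fg(3) by (simp add: Fract_conv_to_fract)
  have "\<exists>h\<in>S. to_fract h = to_fract (g ^ N) * ?z ^ k" for k
  proof (induction k rule: less_induct)
    case (less k)
    show ?case
    proof (cases "k < N")
      case True
      then have "g ^ N = g ^ (N - k) * g ^ k"
        by (simp flip: power_add)
      then have "to_fract (g ^ N) * ?z ^ k = to_fract (g ^ (N - k) * f ^ k)"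
        by (simp add: to_fract_power mult.assoc flip: gz power_mult_distrib)
      moreover have "g ^ (N - k) * f ^ k \<in> S"
        by (intro mult is_subalgebra_power S fg)
      ultimately show ?thesis
        by metis
    next
      case False
      then have "\<forall>i\<in>{..<N}. \<exists>h\<in>S. to_fract h = to_fract (g ^ N) * ?z ^ (i + (k - N))"
        using less.IH by auto
      then obtain h where h: "\<forall>i\<in>{..<N}. h i \<in> S \<and> to_fract (h i) = to_fract (g ^ N) * ?z ^ (i + (k - N))"
        by metis
      have "?z ^ k = ?z ^ N * ?z ^ (k - N)"
        using False by (simp flip: power_add)
      then have "to_fract (g ^ N) * ?z ^ k = - (\<Sum>i<N. to_fract (s i) * (to_fract (g ^ N) * ?z ^ (i + (k - N))))"
        by (simp add: zN sum_distrib_left sum_distrib_right power_add mult_ac)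
      also have "\<dots> = to_fract (- (\<Sum>i<N. s i * h i))"
        using h by (simp add: to_fract_sum)
      finally show ?thesis
        using h s(1) by (metis (no_types, lifting) is_subalgebra_neg[OF S] is_subalgebra_sum[OF S] mult)
    qed
  qed
  moreover have "g ^ N \<in> S" "g ^ N \<noteq> 0"
    using fg by (auto intro: is_subalgebra_power S)
  ultimately show ?thesis
    unfolding almost_integral_def by blast
qed

text \<open>By the binomial theorem the same denominator \<open>c\<close> still works.\<close>

lemma almost_integral_diff:
  fixes S :: "('m::{ordered_cancel_comm_monoid_add,linorder} \<Rightarrow>\<^sub>0 'k::field) set"
  assumes S: "is_subalgebra S" and z: "almost_integral S z" and t: "t \<in> S"
  shows "almost_integral S (z - to_fract t)"
proof -
  have mult: "x * y \<in> S" if "x \<in> S" "y \<in> S" for x y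
    using S that by (simp add: is_subalgebra_def)
  obtain c h where c: "c \<in> S" "c \<noteq> 0" and h: "\<And>k. h k \<in> S \<and> to_fract (h k) = to_fract c * z ^ k"
    using z unfolding almost_integral_def by metis
  have "\<exists>h\<in>S. to_fract h = to_fract c * (z - to_fract t) ^ k" for k
  proof (rule bexI)
    have "to_fract c * (z - to_fract t) ^ k = to_fract c * (z + to_fract (- t)) ^ k"
      by simp
    also have "\<dots> = (\<Sum>i\<le>k. of_nat (k choose i) * (to_fract c * z ^ i) * to_fract (- t) ^ (k - i))"
      by (simp only: binomial_ring sum_distrib_left mult_ac)
    also have "\<dots> = to_fract (\<Sum>i\<le>k. of_nat (k choose i) * h i * (- t) ^ (k - i))"
      using h by (simp only: to_fract_sum to_fract_mult to_fract_power to_fract_of_nat)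
    finally show "to_fract (\<Sum>i\<le>k. of_nat (k choose i) * h i * (- t) ^ (k - i)) = to_fract c * (z - to_fract t) ^ k" ..
    show "(\<Sum>i\<le>k. of_nat (k choose i) * h i * (- t) ^ (k - i)) \<in> S"
      using h t by (intro is_subalgebra_sum S mult is_subalgebra_power is_subalgebra_neg is_subalgebra_of_nat) auto
  qed
  then show ?thesis
    unfolding almost_integral_def using c by blast
qed

text \<open>\<open>sat\<close> is complete integral closedness of the monoid \<open>M\<close>: if
  \<open>c + k (a - b)\<close> lies in \<open>M\<close> for all \<open>k\<close>, so does
  \<open>a - b\<close>. The leading exponents of the almost integrality relations supply its
  premise, so the leading monomial of \<open>g\<close> divides that of \<open>f\<close> with
  quotient exponent in \<open>M\<close>, and division continues with a smaller numerator.\<close>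

lemma supported_in_completely_integrally_closed:
  fixes M :: "'m::{ordered_cancel_comm_monoid_add,linorder} set" and f g :: "'m \<Rightarrow>\<^sub>0 'k::field"
  assumes zero: "0 \<in> M" and add: "\<forall>a\<in>M. \<forall>b\<in>M. a + b \<in> M"
    and sat: "\<forall>a\<in>M. \<forall>b\<in>M. \<forall>c.
      (\<forall>k. \<exists>m\<in>M. m + ((+) b ^^ k) 0 = c + ((+) a ^^ k) 0) \<longrightarrow> (\<exists>m\<in>M. a = m + b)"
    and fin: "\<forall>m\<in>M. finite {m'\<in>M. m' \<le> m}"
    and fg: "f \<in> supported_in M" "g \<in> supported_in M" "g \<noteq> 0"
    and ai: "almost_integral (supported_in M) (Fract f g)"
  shows "Fract f g \<in> to_fract ` supported_in M"
  using fg(1) ai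
\<comment> \<open>The exponents of \<open>M\<close> up to the leading one are counted, a finite
  number by \<open>fin\<close>. The conjunct \<open>f \<noteq> 0\<close> assigns 0 to the zero
  numerator, whose \<open>lead_exp\<close> is the unspecified \<open>Max {}\<close>.\<close>
proof (induction "card {m\<in>M. f \<noteq> 0 \<and> m \<le> lead_exp f}" arbitrary: f rule: less_induct)
  case less
  let ?S = "supported_in M :: ('m \<Rightarrow>\<^sub>0 'k) set"
  note S = is_subalgebra_supported_in[OF zero add, where 'k = 'k]
  show ?case
  proof (cases "f = 0")
    case True
    then show ?thesis
      using is_subalgebra_zero[OF S] by (auto simp: Fract_conv_to_fract intro!: image_eqI[of _ _ 0])
  next
    case False
    let ?a = "lead_exp f" and ?b = "lead_exp g"
    have ab: "?a \<in> M" "?b \<in> M"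
      using less.prems(1) fg(2,3) False lead_exp_in_keys by (auto simp: supported_in_def)
    obtain c h where c: "c \<noteq> 0" and h: "\<And>k. h k \<in> ?S \<and> to_fract (h k) = to_fract c * Fract f g ^ k"
      using less.prems(2) unfolding almost_integral_def by metis
    have "\<exists>m\<in>M. m + ((+) ?b ^^ k) 0 = lead_exp c + ((+) ?a ^^ k) 0" for k
    proof -
      have "to_fract (h k * g ^ k) = to_fract (c * f ^ k)"
        using h[of k] fg(3) by (simp add: to_fract_power Fract_conv_to_fract power_divide)
      then have eq: "h k * g ^ k = c * f ^ k"
        by (simp only: to_fract_eq_iff)
      then have hk: "h k \<noteq> 0"
        using c False by auto
      then have "lead_exp (h k) + lead_exp (g ^ k) = lead_exp c + lead_exp (f ^ k)"
        using arg_cong[OF eq, of lead_exp] c False fg(3) by (simp add: lead_exp_mult)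
      moreover have "lead_exp (h k) \<in> M"
        using h[of k] lead_exp_in_keys[OF hk] by (auto simp: supported_in_def)
      ultimately show ?thesis
        using False fg(3) by (auto simp: lead_exp_power)
    qed
    then obtain m where m: "m \<in> M" "?a = m + ?b"
      using sat ab by blast
    \<comment> \<open>The quotient of the leading terms, so that \<open>t * g\<close> cancels that
      of \<open>f\<close>.\<close>
    define t where "t = Poly_Mapping.single m (Poly_Mapping.lookup f ?a / Poly_Mapping.lookup g ?b)"
    have lc: "Poly_Mapping.lookup f ?a \<noteq> 0" "Poly_Mapping.lookup g ?b \<noteq> 0"
      using lead_exp_in_keys False fg(3) by (auto simp: in_keys_iff)
    have t0: "t \<noteq> 0"
    proof
      assume "t = 0"
      then have "Poly_Mapping.lookup t m = 0"
        by simp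
      then show False
        using lc by (simp add: t_def)
    qed
    have lt: "lead_exp t = m"
      using lc by (intro lead_exp_eqI) (auto simp: t_def)
    have tS: "t \<in> ?S"
      using m(1) keys_single_subset by (fastforce simp: supported_in_def t_def)
    define f' where "f' = f - t * g"
    have f'S: "f' \<in> ?S"
      using S less.prems(1) tS fg(2) is_subalgebra_neg[OF S, of "t * g"]
      unfolding f'_def diff_conv_add_uminus is_subalgebra_def by blast
    have z': "Fract f' g = Fract f g - to_fract t"
      using fg(3) by (simp add: f'_def Fract_conv_to_fract diff_divide_distrib)
    have lookup_tg: "Poly_Mapping.lookup (t * g) ?a = Poly_Mapping.lookup f ?a"
      using lookup_mult_lead_exp[of t g] lc unfolding lt m(2)[symmetric] by (simp add: t_def)
    have "lead_exp f' < ?a" if "f' \<noteq> 0"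
    proof -
      have "lead_exp f' \<noteq> ?a"
        using lead_exp_in_keys[OF that] lookup_tg by (auto simp: in_keys_iff f'_def lookup_minus)
      moreover have "lead_exp f' \<in> Poly_Mapping.keys f \<union> Poly_Mapping.keys (t * g)"
        using lead_exp_in_keys[OF that] keys_diff[of f "t * g"] by (auto simp: f'_def)
      then have "lead_exp f' \<le> ?a"
        using keys_le_lead_exp lead_exp_mult[OF t0 fg(3)] lt m(2) by fastforce
      ultimately show ?thesis
        by simp
    qed
    then have "{m\<in>M. f' \<noteq> 0 \<and> m \<le> lead_exp f'} \<subset> {m\<in>M. f \<noteq> 0 \<and> m \<le> ?a}"
      using ab(1) False by force
    then have "card {m\<in>M. f' \<noteq> 0 \<and> m \<le> lead_exp f'} < card {m\<in>M. f \<noteq> 0 \<and> m \<le> ?a}"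
      using bspec[OF fin ab(1)] by (intro psubset_card_mono) auto
    moreover have "almost_integral ?S (Fract f' g)"
      unfolding z' by (rule almost_integral_diff[OF S less.prems(2) tS])
    ultimately have "Fract f' g \<in> to_fract ` ?S"
      using less.hyps f'S by blast
    then obtain h' where h': "h' \<in> ?S" "Fract f g - to_fract t = to_fract h'"
      unfolding z' by blast
    then have "Fract f g = to_fract (h' + t)"
      by (simp add: algebra_simps)
    moreover have "h' + t \<in> ?S"
      using S h'(1) tS by (simp add: is_subalgebra_def)
    ultimately show ?thesis
      by blast
  qed
qed

lemma normal_subring_supported_in:
  fixes M :: "'m::{ordered_cancel_comm_monoid_add,linorder} set"
  assumes zero: "0 \<in> M" and add: "\<forall>a\<in>M. \<forall>b\<in>M. a + b \<in> M"
    and sat: "\<forall>a\<in>M. \<forall>b\<in>M. \<forall>c.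
      (\<forall>k. \<exists>m\<in>M. m + ((+) b ^^ k) 0 = c + ((+) a ^^ k) 0) \<longrightarrow> (\<exists>m\<in>M. a = m + b)"
    and fin: "\<forall>m\<in>M. finite {m'\<in>M. m' \<le> m}"
  shows "normal_subring (supported_in M :: ('m \<Rightarrow>\<^sub>0 'k::field) set)"
  unfolding normal_subring_def fraction_field_of_def
proof clarify
  fix f g :: "'m \<Rightarrow>\<^sub>0 'k"
  assume fg: "f \<in> supported_in M" "g \<in> supported_in M" "g \<noteq> 0"
    and "integral_over (to_fract ` supported_in M) (Fract f g)"
  then have "almost_integral (supported_in M) (Fract f g)"
    by (intro integral_imp_almost_integral is_subalgebra_supported_in zero add)
  then show "Fract f g \<in> to_fract ` supported_in M"
    using supported_in_completely_integrally_closed[OF zero add sat fin fg] by blast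
qed

section \<open>Monomials with exponents in the cone\<close>

definition xt_exp :: "nat ^ 'n \<Rightarrow> nat \<Rightarrow> ('n::finite option \<Rightarrow>\<^sub>0 nat)"
  where "xt_exp a b = Abs_poly_mapping (case_option b (vec_nth a))"

lemma lookup_xt_exp [simp]:
  "Poly_Mapping.lookup (xt_exp a b) None = b"
  "Poly_Mapping.lookup (xt_exp a b) (Some i) = a $ i"
  by (simp_all add: xt_exp_def lookup_Abs_poly_mapping)

definition x_part :: "('n::finite option \<Rightarrow>\<^sub>0 nat) \<Rightarrow> nat ^ 'n"
  where "x_part m = (\<chi> i. Poly_Mapping.lookup m (Some i))"

abbreviation t_part :: "('n::finite option \<Rightarrow>\<^sub>0 nat) \<Rightarrow> nat"
  where "t_part m \<equiv> Poly_Mapping.lookup m None"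

lemma xt_exp_parts [simp]: "xt_exp (x_part m) (t_part m) = m"
proof (rule poly_mapping_eqI)
  fix v show "Poly_Mapping.lookup (xt_exp (x_part m) (t_part m)) v = Poly_Mapping.lookup m v"
    by (cases v) (simp_all add: x_part_def)
qed

lemma x_part_xt_exp [simp]: "x_part (xt_exp a b) = a"
  by (simp add: x_part_def vec_eq_iff)

lemma xt_exp_add: "xt_exp a b + xt_exp a' b' = xt_exp (a + a') (b + b')"
proof (rule poly_mapping_eqI)
  fix v show "Poly_Mapping.lookup (xt_exp a b + xt_exp a' b') v = Poly_Mapping.lookup (xt_exp (a + a') (b + b')) v"
    by (cases v) (simp_all add: lookup_add)
qed

lemma xt_exp_zero: "xt_exp 0 0 = 0"
proof (rule poly_mapping_eqI)
  fix v show "Poly_Mapping.lookup (xt_exp 0 0) v = Poly_Mapping.lookup 0 v"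
    by (cases v) simp_all
qed

lemma xt_var_power:
  "(xt_var v ^ k :: ('n, 'k::field) xt_poly) = Poly_Mapping.single (Poly_Mapping.single v k) 1"
proof (induction k)
  case (Suc k)
  then show ?case
    by (simp add: xt_var_def mult_single flip: single_add)
qed simp

lemma prod_single_one:
  "(\<Prod>i\<in>I. Poly_Mapping.single (f i) (1::'k::field)) = Poly_Mapping.single (\<Sum>i\<in>I. f i) 1"
  by (induction I rule: infinite_finite_induct) (simp_all add: mult_single)

lemma xt_monom_eq_single:
  "(xt_monom a b :: ('n::finite, 'k::field) xt_poly) = Poly_Mapping.single (xt_exp a b) 1"
proof -
  have "(\<Sum>i\<in>UNIV. Poly_Mapping.single (Some i) (a $ i)) + Poly_Mapping.single None b = xt_exp a b"
  proof (rule poly_mapping_eqI)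
    fix v
    show "Poly_Mapping.lookup ((\<Sum>i\<in>UNIV. Poly_Mapping.single (Some i) (a $ i)) + Poly_Mapping.single None b) v =
        Poly_Mapping.lookup (xt_exp a b) v"
      by (cases v) (simp_all add: lookup_add lookup_sum lookup_single when_def)
  qed
  then show ?thesis
    by (simp add: xt_monom_def xt_var_power prod_single_one mult_single)
qed

section \<open>Exponents in the lifted cone\<close>

definition cone_exps :: "(nat ^ 'n) set \<Rightarrow> ('n::finite option \<Rightarrow>\<^sub>0 nat) set"
  where "cone_exps W = {m. (real_nvec (x_part m), real (t_part m)) \<in> convex_cone hull (lifted_points W)}"

lemma xt_exp_in_cone_exps:
  "xt_exp a b \<in> cone_exps W \<longleftrightarrow> (real_nvec a, real b) \<in> convex_cone hull (lifted_points W)"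
  by (simp add: cone_exps_def)

lemma x_part_add: "x_part (m + m') = x_part m + x_part m'"
  by (simp add: x_part_def vec_eq_iff lookup_add)

lemma zero_in_cone_exps: "0 \<in> cone_exps W"
proof -
  have "x_part 0 = (0 :: nat ^ 'a)"
    by (simp add: x_part_def vec_eq_iff)
  then show ?thesis
    using convex_cone_hull_contains_0[of "lifted_points W"] by (simp add: cone_exps_def zero_prod_def)
qed

lemma add_in_cone_exps: "\<forall>a\<in>cone_exps W. \<forall>b\<in>cone_exps W. a + b \<in> cone_exps W"
proof (intro ballI)
  fix a b assume "a \<in> cone_exps W" "b \<in> cone_exps W"
  then have "(real_nvec (x_part a), real (t_part a)) + (real_nvec (x_part b), real (t_part b)) \<in>
      convex_cone hull (lifted_points W)"
    unfolding cone_exps_def by (intro convex_cone_hull_add) auto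
  then show "a + b \<in> cone_exps W"
    by (simp add: cone_exps_def x_part_add lookup_add real_nvec_add)
qed

lemma lookup_funpow_add: "Poly_Mapping.lookup (((+) m ^^ k) 0) v = k * Poly_Mapping.lookup (m :: _ \<Rightarrow>\<^sub>0 nat) v"
  by (induction k) (simp_all add: lookup_add)

lemma real_le_of_multiples:
  fixes a b c :: real
  assumes "\<And>k::nat. real k * a \<le> c + real k * b"
  shows "a \<le> b"
proof (rule ccontr)
  assume "\<not> a \<le> b"
  then obtain k where "c < real k * (a - b)"
    using reals_Archimedean3[of "a - b"] by auto
  then show False
    using assms[of k] by (simp add: algebra_simps)
qed

text \<open>The cone is cut out by linear inequalities. Each of them holds at
  \<open>c + k a - k b\<close> for all \<open>k\<close>, hence at \<open>a - b\<close> by the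
  Archimedean property.\<close>

lemma cone_exps_saturated:
  fixes A :: "nat ^ 'q ^ 'n"
  assumes rows: "\<forall>i. row i A \<noteq> 0" and W: "W = {\<alpha>. \<exists>j. \<alpha> \<le> column j A}"
    and k: "\<forall>k. \<exists>m\<in>cone_exps W. m + ((+) b ^^ k) 0 = c + ((+) a ^^ k) 0"
  shows "\<exists>m\<in>cone_exps W. a = m + b"
proof -
  note C = lifted_cone_iff_maximal_vertices[OF rows W]
  obtain m where m: "\<And>k. m k \<in> cone_exps W" "\<And>k. m k + ((+) b ^^ k) 0 = c + ((+) a ^^ k) 0"
    using k by metis
  have lookup: "Poly_Mapping.lookup (m k) v + k * Poly_Mapping.lookup b v =
      Poly_Mapping.lookup c v + k * Poly_Mapping.lookup a v" for k v
    using arg_cong[OF m(2)[of k], of "\<lambda>m. Poly_Mapping.lookup m v"]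
    by (simp add: lookup_add lookup_funpow_add)
  \<comment> \<open>Subtraction of exponents truncates, so \<open>b \<le> a\<close> is what makes
    \<open>a - b\<close> the true difference.\<close>
  have le: "Poly_Mapping.lookup b v \<le> Poly_Mapping.lookup a v" for v
  proof -
    have "real (Poly_Mapping.lookup b v) \<le> real (Poly_Mapping.lookup a v)"
    proof (rule real_le_of_multiples)
      fix k
      have "k * Poly_Mapping.lookup b v \<le> Poly_Mapping.lookup c v + k * Poly_Mapping.lookup a v"
        using lookup[of k v] by linarith
      then show "real k * real (Poly_Mapping.lookup b v) \<le>
          real (Poly_Mapping.lookup c v) + real k * real (Poly_Mapping.lookup a v)"
        by (simp only: of_nat_le_iff flip: of_nat_mult of_nat_add)
    qed
    then show ?thesis
      by simp
  qed
  have ab: "a = (a - b) + b"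
    by (rule poly_mapping_eqI) (simp add: lookup_add lookup_minus le)
  have "l \<bullet> real_nvec (x_part (a - b)) \<le> real (t_part (a - b))"
    if l: "l \<in> maximal_vertices (packing_polytope A)" for l
  proof -
    \<comment> \<open>The violation of the inequality at \<open>l\<close>: additive, and at most 0
      on the cone.\<close>
    define \<phi> where "\<phi> m = l \<bullet> real_nvec (x_part m) - real (t_part m)" for m
    have \<phi>_add: "\<phi> (m + m') = \<phi> m + \<phi> m'" for m m'
      by (simp add: \<phi>_def x_part_add real_nvec_add inner_add_right lookup_add)
    have \<phi>0: "\<phi> 0 = 0"
      using \<phi>_add[of 0 0] by simp
    have \<phi>_pow: "\<phi> (((+) m ^^ k) 0) = real k * \<phi> m" for m k
      by (induction k) (simp_all add: \<phi>_add \<phi>0 algebra_simps)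
    have "\<phi> a \<le> \<phi> b"
    proof (rule real_le_of_multiples)
      fix k
      have "\<phi> (m k) \<le> 0"
        using m(1)[of k] l unfolding cone_exps_def C by (auto simp: \<phi>_def)
      moreover have "\<phi> (m k) + real k * \<phi> b = \<phi> c + real k * \<phi> a"
        using arg_cong[OF m(2)[of k], of \<phi>] by (simp add: \<phi>_add \<phi>_pow)
      ultimately show "real k * \<phi> a \<le> - \<phi> c + real k * \<phi> b"
        by simp
    qed
    moreover have "\<phi> a = \<phi> (a - b) + \<phi> b"
      using \<phi>_add[of "a - b" b] ab by simp
    ultimately show ?thesis
      by (simp add: \<phi>_def)
  qed
  then have "a - b \<in> cone_exps W"
    unfolding cone_exps_def C by simp
  then show ?thesis
    using ab by blast
qed

text \<open>On the generators each coordinate is at most \<open>K\<close> times the degree, and this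
  linear bound passes to the cone.\<close>

lemma finite_cone_exps_degree:
  fixes A :: "nat ^ 'q ^ 'n"
  assumes W: "W = {\<alpha>. \<exists>j. \<alpha> \<le> column j A}"
  shows "finite {m \<in> cone_exps W. t_part m = b}"
proof -
  define K where "K = (\<Sum>i\<in>UNIV. \<Sum>j\<in>UNIV. A $ i $ j)"
  have K: "A $ i $ j \<le> K" for i j
  proof -
    have "A $ i $ j \<le> (\<Sum>j\<in>UNIV. A $ i $ j)"
      by (intro member_le_sum) auto
    also have "\<dots> \<le> K"
      unfolding K_def by (intro member_le_sum[of i]) auto
    finally show ?thesis .
  qed
  let ?D = "{(a, b). \<forall>i. a $ i \<le> real K * b} :: ((real ^ 'n) \<times> real) set"
  have "convex_cone hull (lifted_points W) \<subseteq> ?D"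
  proof (rule hull_minimal)
    show "lifted_points W \<subseteq> ?D"
    proof (clarsimp simp: lifted_points_def W real_nvec_def less_eq_vec_def column_def)
      fix \<alpha> :: "nat ^ 'n" and j i assume "\<forall>i. \<alpha> $ i \<le> A $ i $ j"
      then show "\<alpha> $ i \<le> K"
        using K[of i j] by (meson order_trans)
    qed
    show "convex_cone ?D"
    proof -
      have "a * r \<le> real K * (a * s)" if "r \<le> real K * s" "0 \<le> a" for a r s :: real
        using mult_left_mono[OF that] by (simp add: mult_ac)
      then show ?thesis
        unfolding convex_cone_iff by (auto simp: zero_prod_def ring_distribs intro!: add_mono)
    qed
  qed
  then have "x_part m $ i \<le> K * b" if "m \<in> cone_exps W" "t_part m = b" for m i
  proof -
    have "real (x_part m $ i) \<le> real K * real b"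
      using that \<open>convex_cone hull (lifted_points W) \<subseteq> ?D\<close> by (auto simp: cone_exps_def real_nvec_def)
    then show ?thesis
      by (simp only: of_nat_le_iff flip: of_nat_mult)
  qed
  then have "{m \<in> cone_exps W. t_part m = b} \<subseteq> (\<lambda>a. xt_exp a b) ` {a. a \<le> (\<chi> i. K * b)}"
    by (force simp: less_eq_vec_def intro: image_eqI[where x = "x_part _"])
  then show ?thesis
    by (rule finite_subset) (intro finite_imageI finite_nvec_le)
qed

text \<open>Exponents are compared at the least index where they differ, and \<open>None\<close>
  precedes every \<open>Some i\<close>; so the exponent of \<open>t\<close> decides first.\<close>

lemma t_part_mono:
  fixes m m' :: "'n::{finite,linorder} option \<Rightarrow>\<^sub>0 nat"
  assumes "m' \<le> m"
  shows "t_part m' \<le> t_part m"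
proof -
  have "less_fun (Poly_Mapping.lookup m') (Poly_Mapping.lookup m) \<or>
      Poly_Mapping.lookup m' = Poly_Mapping.lookup m"
    using assms by (simp add: less_eq_poly_mapping.rep_eq)
  then show ?thesis
  proof
    assume "less_fun (Poly_Mapping.lookup m') (Poly_Mapping.lookup m)"
    then obtain k where k: "Poly_Mapping.lookup m' k < Poly_Mapping.lookup m k"
        "\<And>v. v < k \<Longrightarrow> Poly_Mapping.lookup m' v = Poly_Mapping.lookup m v"
      by (auto simp: less_fun_def)
    then show ?thesis
      by (cases k) (auto simp: less_imp_le)
  qed simp
qed

text \<open>A lexicographic order can have infinitely many exponents below a given one. Comparing
  \<open>t\<close> first bounds the degree, and each degree of the cone is finite; this makes the
  division by leading monomials terminate.\<close>

lemma finite_cone_exps_below: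
  fixes A :: "nat ^ 'q ^ 'n::{finite,linorder}"
  assumes W: "W = {\<alpha>. \<exists>j. \<alpha> \<le> column j A}"
  shows "finite {m' \<in> cone_exps W. m' \<le> m}"
proof (rule finite_subset)
  show "{m' \<in> cone_exps W. m' \<le> m} \<subseteq> (\<Union>b\<le>t_part m. {m' \<in> cone_exps W. t_part m' = b})"
    using t_part_mono by auto
qed (use finite_cone_exps_degree[OF W] in auto)

section \<open>Monomial bases of the subring and of its graded parts\<close>

lemma poly_mapping_sum_single:
  "f = (\<Sum>m\<in>Poly_Mapping.keys f. Poly_Mapping.single m (Poly_Mapping.lookup f m))"
  by (rule poly_mapping_eqI) (auto simp: lookup_sum lookup_single when_def in_keys_iff)

lemma scalar_mult_single: "scalar_mult c (Poly_Mapping.single m x) = Poly_Mapping.single m (c * x)"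
  by (simp add: scalar_mult_def mult_single)

text \<open>Integer rounding makes every lattice point of the cone a sum of generators, so every
  monomial with exponent in the cone is a product of generators of the subring.\<close>

lemma monomial_subring_eq_supported:
  fixes A :: "nat ^ 'q ^ 'n"
  assumes rows: "\<forall>i. row i A \<noteq> 0" and W: "W = {\<alpha>. \<exists>j. \<alpha> \<le> column j A}"
    and rounding: "integer_rounding A"
  shows "(monomial_subring W :: ('n, 'k::field) xt_poly set) = supported_in (cone_exps W)"
proof
  let ?S = "monomial_subring W :: ('n, 'k) xt_poly set"
  have S: "is_subalgebra ?S"
    unfolding monomial_subring_def by (rule is_subalgebra_generated)
  have gen: "xt_monom w 1 \<in> ?S" if "w \<in> W" for w
    unfolding monomial_subring_def generated_subalgebra_def using that by (auto intro: hull_inc)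
  show "?S \<subseteq> supported_in (cone_exps W)"
    unfolding monomial_subring_def generated_subalgebra_def
  proof (rule hull_minimal)
    show "is_subalgebra (supported_in (cone_exps W) :: ('n, 'k) xt_poly set)"
      by (rule is_subalgebra_supported_in[OF zero_in_cone_exps add_in_cone_exps])
    show "(\<lambda>w. xt_monom w 1) ` W \<subseteq> (supported_in (cone_exps W) :: ('n, 'k) xt_poly set)"
      by (auto simp: supported_in_def xt_monom_eq_single xt_exp_in_cone_exps lifted_points_def intro!: hull_inc)
  qed
  show "supported_in (cone_exps W) \<subseteq> ?S"
  proof
    fix f :: "('n, 'k) xt_poly" assume f: "f \<in> supported_in (cone_exps W)"
    have "Poly_Mapping.single m 1 \<in> ?S" if m: "m \<in> cone_exps W" for m
    proof -
      have "(real_nvec (x_part m), real (t_part m)) \<in> convex_cone hull (lifted_points W)"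
        using m by (simp add: cone_exps_def)
      then have "xt_monom (x_part m) (t_part m) \<in> ?S"
      proof (rule lifted_cone_lattice_induct[OF rows W rounding])
        show "xt_monom 0 0 \<in> ?S"
          using S by (simp add: xt_monom_eq_single xt_exp_zero is_subalgebra_def)
        fix a b w assume "xt_monom a b \<in> ?S" "w \<in> W"
        moreover have "xt_monom (a + w) (Suc b) = xt_monom a b * (xt_monom w 1 :: ('n, 'k) xt_poly)"
          by (simp add: xt_monom_eq_single mult_single xt_exp_add)
        ultimately show "xt_monom (a + w) (Suc b) \<in> ?S"
          using S gen by (simp add: is_subalgebra_def)
      qed
      then show ?thesis
        by (simp add: xt_monom_eq_single)
    qed
    then have "scalar_mult (Poly_Mapping.lookup f m) (Poly_Mapping.single m 1) \<in> ?S"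
      if "m \<in> Poly_Mapping.keys f" for m
      using S f that by (auto simp: is_subalgebra_def supported_in_def)
    then have "(\<Sum>m\<in>Poly_Mapping.keys f. Poly_Mapping.single m (Poly_Mapping.lookup f m)) \<in> ?S"
      by (intro is_subalgebra_sum[OF S]) (simp add: scalar_mult_single)
    then show "f \<in> ?S"
      using poly_mapping_sum_single[of f] by simp
  qed
qed

lemma dim_graded_part_supported:
  assumes "finite {m \<in> M. Poly_Mapping.lookup m None = b}"
  shows "poly_vs.dim (graded_part (supported_in M :: ('n, 'k::field) xt_poly set) b) =
    card {m \<in> M. Poly_Mapping.lookup m None = b}"
proof -
  let ?X = "{m \<in> M. Poly_Mapping.lookup m None = b}"
  let ?e = "\<lambda>m. Poly_Mapping.single m (1::'k)"
  have inj: "inj_on ?e ?X"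
  proof (rule inj_onI)
    fix m m' assume "?e m = ?e m'"
    then have "Poly_Mapping.keys (?e m) = Poly_Mapping.keys (?e m')"
      by simp
    then show "m = m'"
      by simp
  qed
  have "poly_vs.dim (graded_part (supported_in M :: ('n, 'k) xt_poly set) b) = card (?e ` ?X)"
  proof (rule poly_vs.dim_unique[OF _ _ _ refl])
    show "?e ` ?X \<subseteq> graded_part (supported_in M) b"
      by (auto simp: graded_part_def supported_in_def)
    show "graded_part (supported_in M) b \<subseteq> poly_vs.span (?e ` ?X)"
    proof
      fix f :: "('n, 'k) xt_poly" assume f: "f \<in> graded_part (supported_in M) b"
      have "(\<Sum>m\<in>Poly_Mapping.keys f. scalar_mult (Poly_Mapping.lookup f m) (?e m)) \<in> poly_vs.span (?e ` ?X)"
        using f by (intro poly_vs.span_sum poly_vs.span_scale poly_vs.span_base)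
          (auto simp: graded_part_def supported_in_def)
      then show "f \<in> poly_vs.span (?e ` ?X)"
        using poly_mapping_sum_single[of f] by (simp add: scalar_mult_single)
    qed
    show "poly_vs.independent (?e ` ?X)"
    proof (rule poly_vs.independent_if_scalars_zero)
      show "finite (?e ` ?X)"
        using assms by simp
      fix u v assume sum: "(\<Sum>v\<in>?e ` ?X. scalar_mult (u v) v) = 0" and "v \<in> ?e ` ?X"
      then obtain m where m: "m \<in> ?X" "v = ?e m" by blast
      have "0 = Poly_Mapping.lookup (\<Sum>m\<in>?X. Poly_Mapping.single m (u (?e m))) m"
        using sum by (simp add: sum.reindex[OF inj] scalar_mult_single)
      also have "\<dots> = u (?e m)"
        using assms m(1) by (simp add: lookup_sum lookup_single when_def sum.delta')
      finally show "u v = 0"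
        using m(2) by simp
    qed
  qed
  then show ?thesis
    by (simp add: card_image[OF inj])
qed

definition integral_points :: "((real ^ 'n) \<times> real) set"
  where "integral_points = {x. (\<forall>i. fst x $ i \<in> \<int>) \<and> snd x \<in> \<int>}"

lemma bij_betw_cone_exps_integral_points:
  fixes A :: "nat ^ 'q ^ 'n"
  assumes rows: "\<forall>i. row i A \<noteq> 0" and W: "W = {\<alpha>. \<exists>j. \<alpha> \<le> column j A}"
  shows "bij_betw (\<lambda>m. (real_nvec (x_part m), real (t_part m))) {m \<in> cone_exps W. t_part m = b}
    {x \<in> integral_points \<inter> convex_cone hull (lifted_points W). snd x = real b}" (is "bij_betw ?g ?X ?Y")
proof (rule bij_betw_imageI)
  show "inj_on ?g ?X"
  proof (rule inj_onI)
    fix m m' assume "?g m = ?g m'"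
    then have "x_part m = x_part m'" "t_part m = t_part m'"
      by (auto simp: real_nvec_def vec_eq_iff)
    then show "m = m'"
      by (metis xt_exp_parts)
  qed
  show "?g ` ?X = ?Y"
  proof (intro equalityI subsetI)
    fix x assume "x \<in> ?g ` ?X"
    then show "x \<in> ?Y"
      by (auto simp: cone_exps_def integral_points_def real_nvec_def)
  next
    fix x assume x: "x \<in> ?Y"
    obtain r where r: "x = (r, real b)"
      using x by (cases x) auto
    define a where "a = (\<chi> i. nat \<lfloor>r $ i\<rfloor>)"
    have "0 \<le> r"
      using x lifted_cone_iff[OF rows W, of r "real b"] by (simp add: r)
    have "real (nat \<lfloor>r $ i\<rfloor>) = r $ i" for i
    proof -
      have "r $ i \<in> \<int>"
        using x by (simp add: r integral_points_def)
      then obtain z where "r $ i = real_of_int z"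
        by (rule Ints_cases)
      moreover have "0 \<le> r $ i"
        using \<open>0 \<le> r\<close> by (simp add: less_eq_vec_def)
      ultimately show ?thesis
        by simp
    qed
    then have "real_nvec a = r"
      by (simp add: a_def real_nvec_def vec_eq_iff)
    then have g: "?g (xt_exp a b) = x"
      by (simp add: r)
    then have "xt_exp a b \<in> ?X"
      using x by (simp add: cone_exps_def)
    then show "x \<in> ?g ` ?X"
      using g by (intro image_eqI[of x ?g "xt_exp a b"]) simp_all
  qed
qed

section \<open>Hilbert series and canonical module\<close>

lemma hilbert_series_monomial_subring:
  fixes A :: "nat ^ 'q ^ 'n"
  assumes rows: "\<forall>i. row i A \<noteq> 0" and W: "W = {\<alpha>. \<exists>j. \<alpha> \<le> column j A}"
    and rounding: "integer_rounding A"
  shows "hilbert_series (monomial_subring W :: ('n, 'k::field) xt_poly set) =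
    lattice_series integral_points snd (convex_cone hull (lifted_points W))"
proof (rule fps_ext)
  fix b
  have "poly_vs.dim (graded_part (monomial_subring W :: ('n, 'k) xt_poly set) b) =
      card {m \<in> cone_exps W. t_part m = b}"
    unfolding monomial_subring_eq_supported[OF assms]
    by (rule dim_graded_part_supported[OF finite_cone_exps_degree[OF W]])
  also have "\<dots> = card {x \<in> integral_points \<inter> convex_cone hull (lifted_points W). snd x = real b}"
    by (rule bij_betw_same_card[OF bij_betw_cone_exps_integral_points[OF rows W]])
  finally show "fps_nth (hilbert_series (monomial_subring W :: ('n, 'k) xt_poly set)) b =
      fps_nth (lattice_series integral_points snd (convex_cone hull (lifted_points W))) b"
    by (simp add: hilbert_series_def lattice_series_def)
qed

lemma integral_interior_points:
  fixes A :: "nat ^ 'q ^ 'n"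
  assumes rows: "\<forall>i. row i A \<noteq> 0" and W: "W = {\<alpha>. \<exists>j. \<alpha> \<le> column j A}"
  defines "\<mu> \<equiv> Max ((\<lambda>l. \<lceil>1 / real_of_int (primitive_multiplier l) + l \<bullet> 1\<rceil>) `
    maximal_vertices (packing_polytope A))"
  shows "0 \<le> \<mu>"
    and "(1, real_of_int \<mu>) \<in> interior (convex_cone hull (lifted_points W))"
    and "\<forall>x \<in> integral_points \<inter> interior (convex_cone hull (lifted_points W)). snd x = real b \<longrightarrow> \<mu> \<le> int b"
proof -
  let ?L = "maximal_vertices (packing_polytope A)"
  have fin: "finite ?L" and ne: "?L \<noteq> {}"
    by (rule finite_maximal_vertices, rule maximal_vertices_nonempty[OF rows])
  have d: "0 < real_of_int (primitive_multiplier l)" if "l \<in> ?L" for l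
    using primitive_multiplier_vertex(1)[OF that] by simp
  \<comment> \<open>The summand \<open>1 / d > 0\<close> makes the bound strict, as the interior
    requires.\<close>
  have less: "l \<bullet> 1 < real_of_int \<mu>" if "l \<in> ?L" for l
  proof -
    have "\<lceil>1 / real_of_int (primitive_multiplier l) + l \<bullet> 1\<rceil> \<le> \<mu>"
      unfolding \<mu>_def using fin that by (intro Max_ge) auto
    then have "1 / real_of_int (primitive_multiplier l) + l \<bullet> 1 \<le> real_of_int \<mu>"
      by (simp add: ceiling_le_iff)
    moreover have "0 < 1 / real_of_int (primitive_multiplier l)"
      using d[OF that] by simp
    ultimately show ?thesis
      by linarith
  qed
  have L0: "0 \<le> l" if "l \<in> ?L" for l
    using maximal_vertices_in[OF that] by (simp add: packing_polytope_iff)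
  have one: "(0 :: real ^ 'n) \<le> 1"
    by (simp add: less_eq_vec_def)
  obtain l0 where l0: "l0 \<in> ?L"
    using ne by blast
  have "0 \<le> l0 \<bullet> 1"
    by (rule inner_nonneg_vec[OF L0[OF l0] one])
  then show "0 \<le> \<mu>"
    using less[OF l0] by linarith
  show "(1, real_of_int \<mu>) \<in> interior (convex_cone hull (lifted_points W))"
    unfolding interior_lifted_cone_iff[OF rows W] using less by simp
  show "\<forall>x \<in> integral_points \<inter> interior (convex_cone hull (lifted_points W)). snd x = real b \<longrightarrow> \<mu> \<le> int b"
  proof (intro ballI impI)
    fix x assume x: "x \<in> integral_points \<inter> interior (convex_cone hull (lifted_points W))" "snd x = real b"
    then have "x \<in> {x \<in> integral_points \<inter> convex_cone hull (lifted_points W). snd x = real b}"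
      using interior_subset by blast
    then obtain m where m: "x = (real_nvec (x_part m), real b)"
      using bij_betw_imp_surj_on[OF bij_betw_cone_exps_integral_points[OF rows W, of b]] by auto
    then have int: "\<forall>i. 0 < real_nvec (x_part m) $ i" "\<forall>l\<in>?L. l \<bullet> real_nvec (x_part m) < real b"
      using x(1) interior_lifted_cone_iff[OF rows W] by auto
    \<comment> \<open>Positive natural coordinates are at least 1, so \<open>1\<close> is the
      smallest possible \<open>x\<close>-part.\<close>
    have "Suc 0 \<le> x_part m $ i" for i
      using int(1)[rule_format, of i] by (simp add: real_nvec_def)
    then have one_le: "1 \<le> real_nvec (x_part m)"
      by (simp add: real_nvec_def less_eq_vec_def Suc_le_eq)
    have "\<lceil>1 / real_of_int (primitive_multiplier l) + l \<bullet> 1\<rceil> \<le> int b" if "l \<in> ?L" for l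
    proof -
      have "1 \<le> real_of_int (primitive_multiplier l) * (real b - l \<bullet> real_nvec (x_part m))"
        using int(2) that by (simp add: primitive_multiplier_inner_ge_one_iff[OF that])
      then have "1 / real_of_int (primitive_multiplier l) \<le> real b - l \<bullet> real_nvec (x_part m)"
        using d[OF that] by (simp add: divide_le_eq mult.commute)
      moreover have "l \<bullet> 1 \<le> l \<bullet> real_nvec (x_part m)"
        by (rule inner_mono_vec[OF L0[OF that] one_le])
      ultimately show ?thesis
        by (simp add: ceiling_le_iff)
    qed
    then show "\<mu> \<le> int b"
      unfolding \<mu>_def using fin ne by (subst Max_le_iff) auto
  qed
qed

lemma a_invariant_monomial_subring:
  fixes A :: "nat ^ 'q ^ 'n"
  assumes rows: "\<forall>i. row i A \<noteq> 0" and W: "W = {\<alpha>. \<exists>j. \<alpha> \<le> column j A}"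
    and rounding: "integer_rounding A"
  shows "a_invariant (monomial_subring W :: ('n, 'k::field) xt_poly set) =
    - Max ((\<lambda>l. \<lceil>1 / real_of_int (primitive_multiplier l) + l \<bullet> 1\<rceil>) ` maximal_vertices (packing_polytope A))"
    (is "_ = - ?\<mu>")
proof -
  let ?C = "convex_cone hull (lifted_points W)"
  have W': "finite W"
    unfolding W by (rule finite_downset)
  note \<mu> = integral_interior_points[OF rows W]
  \<comment> \<open>Degrees of lattice points are natural numbers; \<open>nat\<close> loses nothing
    here because the maximum is nonnegative.\<close>
  have "is_rational_degree (lattice_series integral_points snd ?C) (- int (nat ?\<mu>))"
  proof (rule lattice_series_degree)
    show "finite (lifted_points W)"
      by (rule finite_lifted_points[OF W'])
    show "linear (snd :: (real ^ 'n) \<times> real \<Rightarrow> real)"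
      by (rule linear_snd)
    show "\<forall>u\<in>lifted_points W. snd u = 1"
      by (auto simp: lifted_points_def)
    show "lifted_points W \<subseteq> integral_points"
      by (auto simp: lifted_points_def integral_points_def real_nvec_def)
    show "\<forall>x\<in>integral_points. \<forall>y\<in>integral_points. x + y \<in> (integral_points :: ((real ^ 'n) \<times> real) set)"
      by (auto simp: integral_points_def)
    show "\<forall>x\<in>integral_points. \<forall>y\<in>integral_points. x - y \<in> (integral_points :: ((real ^ 'n) \<times> real) set)"
      by (auto simp: integral_points_def)
    show "\<forall>b::nat. finite {x \<in> integral_points \<inter> ?C. snd x = real b}"
      using bij_betw_finite[OF bij_betw_cone_exps_integral_points[OF rows W]] finite_cone_exps_degree[OF W] by blast
    show "\<exists>x\<in>integral_points \<inter> interior ?C. snd x = real (nat ?\<mu>)"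
      using \<mu>(1,2) by (intro bexI[of _ "(1, real_of_int ?\<mu>)"]) (auto simp: integral_points_def)
    show "\<forall>b<nat ?\<mu>. \<forall>x\<in>integral_points \<inter> interior ?C. snd x \<noteq> real b"
      using \<mu>(3) by fastforce
  qed
  then have "is_rational_degree (hilbert_series (monomial_subring W :: ('n, 'k) xt_poly set)) (- ?\<mu>)"
    using \<mu>(1) unfolding hilbert_series_monomial_subring[OF assms] by simp
  then show ?thesis
    unfolding a_invariant_def by (intro the_equality) (auto intro: is_rational_degree_unique)
qed

text \<open>By integer rounding all lattice points of the cone lie in \<open>nat_span\<close>, so
  the intersection is given by the strict inequalities of the interior; integrality of
  \<open>d l\<close> and of the exponents turns these into bounds by 1.\<close>

lemma canonical_exponents:
  fixes A :: "nat ^ 'q ^ 'n"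
  assumes rows: "\<forall>i. row i A \<noteq> 0" and W: "W = {\<alpha>. \<exists>j. \<alpha> \<le> column j A}"
    and rounding: "integer_rounding A"
  shows "(real_nvec a, real b) \<in> nat_span (lifted_points W) \<inter> rel_interior (convex_cone hull (lifted_points W)) \<longleftrightarrow>
    (\<forall>l\<in>maximal_vertices (packing_polytope A). 1 \<le> (real_nvec a, real b) \<bullet>
      (- (real_of_int (primitive_multiplier l) *\<^sub>R l), real_of_int (primitive_multiplier l))) \<and>
    (\<forall>j. 1 \<le> (real_nvec a, real b) \<bullet> (axis j 1, 0))" (is "?l \<longleftrightarrow> ?r")
proof -
  let ?C = "convex_cone hull (lifted_points W)"
  have "finite (lifted_points W)"
    unfolding W by (intro finite_lifted_points finite_downset)
  have span: "(real_nvec a, real b) \<in> nat_span (lifted_points W)" if "(real_nvec a, real b) \<in> ?C"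
    using that
  proof (rule lifted_cone_lattice_induct[OF rows W rounding])
    show "(real_nvec 0, real 0) \<in> nat_span (lifted_points W)"
      using nat_span_zero[of "lifted_points W"] by (simp add: zero_prod_def)
    fix a b w assume "(real_nvec a, real b) \<in> nat_span (lifted_points W)" "w \<in> W"
    then have "(real_nvec a, real b) + (real_nvec w, 1) \<in> nat_span (lifted_points W)"
      using \<open>finite (lifted_points W)\<close> by (intro nat_span_add_generator) (auto simp: lifted_points_def)
    then show "(real_nvec (a + w), real (Suc b)) \<in> nat_span (lifted_points W)"
      by (simp add: real_nvec_add add.commute)
  qed
  have "?l \<longleftrightarrow> (real_nvec a, real b) \<in> interior ?C"
    unfolding rel_interior_lifted_cone[OF rows W] using span interior_subset by blast
  also have "\<dots> \<longleftrightarrow> (\<forall>i. 0 < real_nvec a $ i) \<and>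
      (\<forall>l\<in>maximal_vertices (packing_polytope A). l \<bullet> real_nvec a < real b)"
    by (rule interior_lifted_cone_iff[OF rows W])
  also have "\<dots> \<longleftrightarrow> ?r"
  proof -
    have "l \<bullet> real_nvec a < real b \<longleftrightarrow> 1 \<le> (real_nvec a, real b) \<bullet>
        (- (real_of_int (primitive_multiplier l) *\<^sub>R l), real_of_int (primitive_multiplier l))"
      if "l \<in> maximal_vertices (packing_polytope A)" for l
      unfolding primitive_multiplier_inner_ge_one_iff[OF that, symmetric]
      by (simp add: algebra_simps inner_commute)
    moreover have "0 < real_nvec a $ j \<longleftrightarrow> 1 \<le> (real_nvec a, real b) \<bullet> (axis j 1, 0)" for j
      by (simp add: inner_axis real_nvec_def Suc_le_eq)
    ultimately show ?thesis
      by blast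
  qed
  finally show ?thesis .
qed

theorem theorem1p5p2:
  fixes A :: "nat ^ 'q ^ 'n :: {finite, linorder}"
    and W :: "(nat ^ 'n :: {finite, linorder}) set"
    and S :: "('n :: {finite, linorder}, 'k :: field) xt_poly set"
    and L :: "(real ^ 'n :: {finite, linorder}) set"
    and d :: "real ^ 'n :: {finite, linorder} \<Rightarrow> int"
  assumes "\<forall>i. row i A \<noteq> 0"
    and "\<forall>j. column j A \<noteq> 0"
    and "W = {\<alpha>. \<exists>j. \<alpha> \<le> column j A}"
    and "S = monomial_subring W"
    and "L = maximal_vertices (packing_polytope A)"
    and "\<forall>l\<in>L. d l = primitive_multiplier l"
    and "integer_rounding A"
  shows "normal_subring S
    \<and> canonical_module W = generated_ideal S
        {xt_monom (\<chi> i. nat (a $ i)) (nat b) | (a :: int ^ 'n :: {finite, linorder}) (b :: int).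
           (\<forall>l\<in>L. (real_zvec a, real_of_int b) \<bullet> (- (real_of_int (d l) *\<^sub>R l), real_of_int (d l)) \<ge> 1)
           \<and> (\<forall>j. (real_zvec a, real_of_int b) \<bullet> (axis j 1, 0) \<ge> 1)}
    \<and> a_invariant S = - Max {\<lceil>1 / real_of_int (d l) + l \<bullet> 1\<rceil> | l. l \<in> L}"
proof (intro conjI)
  note rows = assms(1) and W = assms(3) and S = assms(4) and L = assms(5) and d = assms(6)
    and rounding = assms(7)
  show "normal_subring S"
    unfolding S monomial_subring_eq_supported[OF rows W rounding]
    using cone_exps_saturated[OF rows W] finite_cone_exps_below[OF W]
    by (intro normal_subring_supported_in zero_in_cone_exps add_in_cone_exps) blast+
  have "{\<lceil>1 / real_of_int (d l) + l \<bullet> 1\<rceil> | l. l \<in> L} =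
      (\<lambda>l. \<lceil>1 / real_of_int (primitive_multiplier l) + l \<bullet> 1\<rceil>) ` L"
    using d by force
  then show "a_invariant S = - Max {\<lceil>1 / real_of_int (d l) + l \<bullet> 1\<rceil> | l. l \<in> L}"
    unfolding S L using a_invariant_monomial_subring[OF rows W rounding] by simp
  define Q where "Q a b \<longleftrightarrow>
      (\<forall>l\<in>L. (real_zvec a, real_of_int b) \<bullet> (- (real_of_int (d l) *\<^sub>R l), real_of_int (d l)) \<ge> 1)
      \<and> (\<forall>j. (real_zvec a, real_of_int b) \<bullet> (axis j 1, 0) \<ge> 1)" for a :: "int ^ 'n :: {finite, linorder}" and b :: int
  have Q_nat: "Q (\<chi> i. int (a $ i)) (int b) \<longleftrightarrow>
      (real_nvec a, real b) \<in> nat_span (lifted_points W) \<inter> rel_interior (convex_cone hull lifted_points W)"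
    for a :: "nat ^ 'n :: {finite, linorder}" and b
    unfolding canonical_exponents[OF rows W rounding] Q_def real_zvec_int using d by (simp add: L)
  \<comment> \<open>A maximal vertex exists, and its inequality together with
    \<open>a \<ge> 1\<close> forces \<open>b \<ge> 1\<close>; hence integer solutions correspond to
    natural exponents without truncation.\<close>
  have Q_int: "a = (\<chi> i. int (nat (a $ i)))" "b = int (nat b)" if "Q a b" for a b
  proof -
    obtain l where l: "l \<in> L"
      using maximal_vertices_nonempty[OF rows] unfolding L by blast
    have "0 \<le> l"
      using l maximal_vertices_in[of l "packing_polytope A"] unfolding L by (simp add: packing_polytope_iff)
    moreover have "0 < real_of_int (d l)"
      using l d primitive_multiplier_vertex(1)[of l A] unfolding L by simp
    ultimately have "a $ j \<ge> 1" "b \<ge> 1" for j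
      using exponents_positive(1)[of l "real_of_int (d l)" a b j]
        exponents_positive(2)[of l "real_of_int (d l)" a b] that l unfolding Q_def by blast+
    then show "a = (\<chi> i. int (nat (a $ i)))" "b = int (nat b)"
      by (auto simp: vec_eq_iff intro: order_trans[of 0 1])
  qed
  have "{xt_monom a b | a b. (real_nvec a, real b) \<in>
        nat_span (lifted_points W) \<inter> rel_interior (convex_cone hull lifted_points W)} =
      ({xt_monom (\<chi> i. nat (a $ i)) (nat b) | a b. Q a b} :: ('n, 'k) xt_poly set)" (is "?X = ?Y")
  proof (intro equalityI subsetI)
    fix f assume "f \<in> ?X"
    then obtain a b where ab: "f = xt_monom a b" "Q (\<chi> i. int (a $ i)) (int b)"
      unfolding Q_nat by blast
    then show "f \<in> ?Y"
      by (intro CollectI exI[of _ "\<chi> i. int (a $ i)"] exI[of _ "int b"]) simp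
  next
    fix f assume "f \<in> ?Y"
    then obtain a b where ab: "f = xt_monom (\<chi> i. nat (a $ i)) (nat b)" "Q a b"
      by blast
    then have "Q (\<chi> i. int ((\<chi> i. nat (a $ i)) $ i)) (int (nat b))"
      using Q_int[OF ab(2)] by simp
    then show "f \<in> ?X"
      unfolding Q_nat using ab(1) by blast
  qed
  then show "canonical_module W = generated_ideal S
      {xt_monom (\<chi> i. nat (a $ i)) (nat b) | (a :: int ^ 'n :: {finite, linorder}) (b :: int).
         (\<forall>l\<in>L. (real_zvec a, real_of_int b) \<bullet> (- (real_of_int (d l) *\<^sub>R l), real_of_int (d l)) \<ge> 1)
         \<and> (\<forall>j. (real_zvec a, real_of_int b) \<bullet> (axis j 1, 0) \<ge> 1)}"
    unfolding canonical_module_def S Q_def by simp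
qed

end
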